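(* Let $\mathbb{A}$ be an abelian framed bicategory, $\mathcal{C}$ a category and $M\colon \mathcal{C}\to \mathrm{Ch}(\mathbb{A})$ a functor. For every relative pair $(X,Y)$ (given by an arrow $f\colon Y\to X$ of $\mathcal{C}$) there is a long exact sequence in the abelian category $\mathcal{A}(L(X),R(X))$: $$\cdots \to H_{i+1}(X)\to H_{i+1}(X,Y)\to {}^{X}H_i(Y)\to H_i(X)\to H_i(X,Y)\to \cdots \to H_0(X)\to H_0(X,Y)\to 0 .$$
   Context: Double categories. A (pseudo) double category $\mathbb{D}$ consists of a vertical category $\mathbb{D}_0$ (objects and vertical arrows), a horizontal category $\mathbb{D}_1$ (its objects are called 1-cells, its arrows 2-cells), and functors $U\colon\mathbb{D}_0\to\mathbb{D}_1$, $L,R\colon\mathbb{D}_1\to\mathbb{D}_0$, $\odot\colon\mathbb{D}_1\times_{\mathbb{D}_0}\mathbb{D}_1\to\mathbb{D}_1$ (pullback of $R$ and $L$) with $LU=RU=\mathrm{id}$, $L(M\odot N)=LM$, $R(M\odot N)=RN$, such that $\odot$ is associative and unital (unit $U_A=U(A)$) up to coherent natural isomorphisms satisfying the bicategory axioms. Write $M\colon A\nrightarrow B$ if $LM=A$, $RM=B$. A 2-cell $\alpha\colon M\to N$ lies over $(f,g)$ if $L\alpha=f$, $R\alpha=g$; it is globular if it lies over identities. The local category $\mathcal{D}(A,B)$ has the 1-cells $A\nrightarrow B$ and globular 2-cells. Framed bicategories. A framed bicategory is a double category such that $(L,R)\colon\mathbb{D}_1\to\mathbb{D}_0\times\mathbb{D}_0$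 is a bifibration. Choosing (co)cartesian lifts: for vertical arrows $f\colon A\to B$, $g\colon C\to D$ there are a restriction functor $f^*(-)g^*\colon\mathcal{D}(B,D)\to\mathcal{D}(A,C)$ with cartesian 2-cells $f^*Mg^*\to M$ over $(f,g)$, and an extension functor $f_!(-)g_!\colon\mathcal{D}(A,C)\to\mathcal{D}(B,D)$ with cocartesian 2-cells $N\to f_!Ng_!$ over $(f,g)$; extension is left adjoint to restriction. Abelian framed bicategories. An abelian framed bicategory $\mathbb{A}$ is a framed bicategory all of whose local categories $\mathcal{A}(A,B)$ are abelian and for which $\odot\colon\mathcal{A}(A,B)\times\mathcal{A}(B,C)\to\mathcal{A}(A,C)$ is additive (in each variable). Chain complexes. An object of $\mathrm{Ch}(\mathbb{A})$ is a non-negatively graded chain complex in some local category $\mathcal{A}(A,B)$. A morphism from $(M_i)$ in $\mathcal{A}(A,B)$ to $(N_i)$ in $\mathcal{A}(C,D)$ consists of vertical arrows $f\colon A\to C$, $g\colon B\to D$ and 2-cells $\alpha_i\colon M_i\to N_i$ over $(f,g)$ with $\partial_{i+1}\circ\alpha_{i+1}=\alpha_i\circ\partial_{i+1}$. Restriction and extension of complexes are taken degreewise. Homology. For $X$ in $\mathcal{C}$ the complex $M(X)$ lives in $\mathcal{A}(L(X),R(X))$ and $H_*(X)$ denotes its homology there. For $f\colon Y\to X$ in $\mathcal{C}$, the morphism $M(f)$ lies over vertical arrows $L(f)\colon L(Y)\to L(X)$, $R(f)\colon R(Y)\to R(X)$; write ${}^{X}(-)=L(f)_!(-)R(f)_!\colon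 \mathcal{A}(L(Y),R(Y))\to\mathcal{A}(L(X),R(X))$. The morphism $M(f)$ factors uniquely through the cocartesian morphism $M(Y)\to{}^{X}M(Y)$ as a morphism ${}^{X}M(Y)\to M(X)$ of complexes in $\mathcal{A}(L(X),R(X))$; $M(X,Y)$ denotes its cokernel and $H_*(X,Y)$ the homology of $M(X,Y)$ (relative homology). Relative pairs. A relative pair $(X,Y)$ is an arrow $f\colon Y\to X$ of $\mathcal{C}$ such that (1) the extension functor ${}^{X}(-)$ is exact, and (2) the factorization ${}^{X}M(Y)\to M(X)$ of $M(f)$ is a monomorphism. *)

theory Defs
  imports "HOL-Algebra.Group"
begin

section \<open>Categories and functors\<close>

text \<open>Composition is written in the usual order: \<open>g \<cdot> f\<close> is \<open>f\<close> followed by \<open>g\<close>, and it is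
  only meaningful when \<open>Cod f = Dom g\<close>.\<close>

record ('o, 'a) cat =
  Obj :: "'o set"
  Arr :: "'a set"
  Dom :: "'a \<Rightarrow> 'o"
  Cod :: "'a \<Rightarrow> 'o"
  Ident :: "'o \<Rightarrow> 'a"
  Comp :: "'a \<Rightarrow> 'a \<Rightarrow> 'a"  (infixl "\<cdot>\<index>" 70)

definition Hom :: "('o, 'a, 'z) cat_scheme \<Rightarrow> 'o \<Rightarrow> 'o \<Rightarrow> 'a set" where
  "Hom C x y = {f \<in> Arr C. Dom C f = x \<and> Cod C f = y}"

locale category =
  fixes C :: "('o, 'a, 'z) cat_scheme" (structure)
  assumes dom_obj: "f \<in> Arr C \<Longrightarrow> Dom C f \<in> Obj C"
    and cod_obj: "f \<in> Arr C \<Longrightarrow> Cod C f \<in> Obj C"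
    and ident_hom: "x \<in> Obj C \<Longrightarrow> Ident C x \<in> Hom C x x"
    and comp_hom: "\<lbrakk>f \<in> Hom C x y; g \<in> Hom C y z\<rbrakk> \<Longrightarrow> g \<cdot> f \<in> Hom C x z"
    and ident_left: "f \<in> Hom C x y \<Longrightarrow> Ident C y \<cdot> f = f"
    and ident_right: "f \<in> Hom C x y \<Longrightarrow> f \<cdot> Ident C x = f"
    and comp_assoc: "\<lbrakk>f \<in> Hom C w x; g \<in> Hom C x y; h \<in> Hom C y z\<rbrakk>
      \<Longrightarrow> (h \<cdot> g) \<cdot> f = h \<cdot> (g \<cdot> f)"

definition is_iso :: "('o, 'a, 'z) cat_scheme \<Rightarrow> 'a \<Rightarrow> bool" where
  "is_iso C f \<longleftrightarrow> f \<in> Arr C \<and>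
     (\<exists>g \<in> Hom C (Cod C f) (Dom C f).
        g \<cdot>\<^bsub>C\<^esub> f = Ident C (Dom C f) \<and> f \<cdot>\<^bsub>C\<^esub> g = Ident C (Cod C f))"

definition monic :: "('o, 'a, 'z) cat_scheme \<Rightarrow> 'a \<Rightarrow> bool" where
  "monic C f \<longleftrightarrow> f \<in> Arr C \<and>
     (\<forall>x. \<forall>u \<in> Hom C x (Dom C f). \<forall>v \<in> Hom C x (Dom C f). f \<cdot>\<^bsub>C\<^esub> u = f \<cdot>\<^bsub>C\<^esub> v \<longrightarrow> u = v)"

definition epic :: "('o, 'a, 'z) cat_scheme \<Rightarrow> 'a \<Rightarrow> bool" where
  "epic C f \<longleftrightarrow> f \<in> Arr C \<and>
     (\<forall>x. \<forall>u \<in> Hom C (Cod C f) x. \<forall>v \<in> Hom C (Cod C f) x. u \<cdot>\<^bsub>C\<^esub> f = v \<cdot>\<^bsub>C\<^esub> f \<longrightarrow> u = v)"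

record ('o, 'a, 'p, 'b) fctr =
  omap :: "'o \<Rightarrow> 'p"
  amap :: "'a \<Rightarrow> 'b"

definition is_functor ::
  "('o, 'a, 'z) cat_scheme \<Rightarrow> ('p, 'b, 'w) cat_scheme \<Rightarrow> ('o, 'a, 'p, 'b) fctr \<Rightarrow> bool" where
  "is_functor C D F \<longleftrightarrow>
     (\<forall>x \<in> Obj C. omap F x \<in> Obj D) \<and>
     (\<forall>x y. \<forall>f \<in> Hom C x y. amap F f \<in> Hom D (omap F x) (omap F y)) \<and>
     (\<forall>x \<in> Obj C. amap F (Ident C x) = Ident D (omap F x)) \<and>
     (\<forall>x y z. \<forall>f \<in> Hom C x y. \<forall>g \<in> Hom C y z.
        amap F (g \<cdot>\<^bsub>C\<^esub> f) = amap F g \<cdot>\<^bsub>D\<^esub> amap F f)"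

definition prod_cat ::
  "('o, 'a, 'z) cat_scheme \<Rightarrow> ('p, 'b, 'w) cat_scheme \<Rightarrow> ('o \<times> 'p, 'a \<times> 'b) cat" where
  "prod_cat C D = \<lparr>
     Obj = Obj C \<times> Obj D, Arr = Arr C \<times> Arr D,
     Dom = (\<lambda>(f, g). (Dom C f, Dom D g)), Cod = (\<lambda>(f, g). (Cod C f, Cod D g)),
     Ident = (\<lambda>(x, y). (Ident C x, Ident D y)),
     Comp = (\<lambda>(f', g') (f, g). (f' \<cdot>\<^bsub>C\<^esub> f, g' \<cdot>\<^bsub>D\<^esub> g)) \<rparr>"

definition pair_fctr ::
  "('o, 'a, 'p, 'b) fctr \<Rightarrow> ('o, 'a, 'q, 'e) fctr \<Rightarrow> ('o, 'a, 'p \<times> 'q, 'b \<times> 'e) fctr" where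
  "pair_fctr F G = \<lparr> omap = (\<lambda>x. (omap F x, omap G x)), amap = (\<lambda>f. (amap F f, amap G f)) \<rparr>"

definition pullback_cat ::
  "('o, 'a, 'z) cat_scheme \<Rightarrow> ('p, 'b, 'w) cat_scheme \<Rightarrow> ('o, 'a, 'q, 'e) fctr \<Rightarrow>
   ('p, 'b, 'q, 'e) fctr \<Rightarrow> ('o \<times> 'p, 'a \<times> 'b) cat" where
  "pullback_cat C D F G = (prod_cat C D) \<lparr>
     Obj := {(x, y). x \<in> Obj C \<and> y \<in> Obj D \<and> omap F x = omap G y},
     Arr := {(f, g). f \<in> Arr C \<and> g \<in> Arr D \<and> amap F f = amap G g} \<rparr>"


section \<open>Bifibrations\<close>

definition cartesian ::
  "('o, 'a, 'z) cat_scheme \<Rightarrow> ('p, 'b, 'w) cat_scheme \<Rightarrow> ('o, 'a, 'p, 'b) fctr \<Rightarrow> 'a \<Rightarrow> bool" where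
  "cartesian E B P \<phi> \<longleftrightarrow> \<phi> \<in> Arr E \<and>
     (\<forall>x \<in> Obj E. \<forall>\<psi> \<in> Hom E x (Cod E \<phi>). \<forall>u \<in> Hom B (omap P x) (omap P (Dom E \<phi>)).
        amap P \<psi> = amap P \<phi> \<cdot>\<^bsub>B\<^esub> u \<longrightarrow>
        (\<exists>!\<chi>. \<chi> \<in> Hom E x (Dom E \<phi>) \<and> amap P \<chi> = u \<and> \<phi> \<cdot>\<^bsub>E\<^esub> \<chi> = \<psi>))"

definition cocartesian ::
  "('o, 'a, 'z) cat_scheme \<Rightarrow> ('p, 'b, 'w) cat_scheme \<Rightarrow> ('o, 'a, 'p, 'b) fctr \<Rightarrow> 'a \<Rightarrow> bool" where
  "cocartesian E B P \<phi> \<longleftrightarrow> \<phi> \<in> Arr E \<and>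
     (\<forall>y \<in> Obj E. \<forall>\<psi> \<in> Hom E (Dom E \<phi>) y. \<forall>u \<in> Hom B (omap P (Cod E \<phi>)) (omap P y).
        amap P \<psi> = u \<cdot>\<^bsub>B\<^esub> amap P \<phi> \<longrightarrow>
        (\<exists>!\<chi>. \<chi> \<in> Hom E (Cod E \<phi>) y \<and> amap P \<chi> = u \<and> \<chi> \<cdot>\<^bsub>E\<^esub> \<phi> = \<psi>))"

definition bifibration ::
  "('o, 'a, 'z) cat_scheme \<Rightarrow> ('p, 'b, 'w) cat_scheme \<Rightarrow> ('o, 'a, 'p, 'b) fctr \<Rightarrow> bool" where
  "bifibration E B P \<longleftrightarrow> is_functor E B P \<and>
     (\<forall>e \<in> Obj E. \<forall>u \<in> Arr B. Cod B u = omap P e \<longrightarrow>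
        (\<exists>\<phi>. cartesian E B P \<phi> \<and> Cod E \<phi> = e \<and> amap P \<phi> = u)) \<and>
     (\<forall>e \<in> Obj E. \<forall>u \<in> Arr B. Dom B u = omap P e \<longrightarrow>
        (\<exists>\<phi>. cocartesian E B P \<phi> \<and> Dom E \<phi> = e \<and> amap P \<phi> = u))"


section \<open>Abelian categories\<close>

record ('o, 'a) preadd = "('o, 'a) cat" +
  Add :: "'a \<Rightarrow> 'a \<Rightarrow> 'a"
  Zero :: "'o \<Rightarrow> 'o \<Rightarrow> 'a"

locale preadditive_category = category C
  for C :: "('o, 'a, 'z) preadd_scheme" (structure) +
  assumes hom_group: "\<lbrakk>x \<in> Obj C; y \<in> Obj C\<rbrakk>
      \<Longrightarrow> comm_group \<lparr>carrier = Hom C x y, monoid.mult = Add C, one = Zero C x y\<rparr>"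
    and comp_add_right: "\<lbrakk>f \<in> Hom C x y; f' \<in> Hom C x y; g \<in> Hom C y z\<rbrakk>
      \<Longrightarrow> g \<cdot> Add C f f' = Add C (g \<cdot> f) (g \<cdot> f')"
    and comp_add_left: "\<lbrakk>f \<in> Hom C x y; g \<in> Hom C y z; g' \<in> Hom C y z\<rbrakk>
      \<Longrightarrow> Add C g g' \<cdot> f = Add C (g \<cdot> f) (g' \<cdot> f)"

definition is_zero_object :: "('o, 'a, 'z) cat_scheme \<Rightarrow> 'o \<Rightarrow> bool" where
  "is_zero_object C z \<longleftrightarrow> z \<in> Obj C \<and>
     (\<forall>x \<in> Obj C. (\<exists>!f. f \<in> Hom C x z) \<and> (\<exists>!f. f \<in> Hom C z x))"

definition is_biproduct ::
  "('o, 'a, 'z) preadd_scheme \<Rightarrow> 'o \<Rightarrow> 'o \<Rightarrow> 'o \<Rightarrow> 'a \<Rightarrow> 'a \<Rightarrow> 'a \<Rightarrow> 'a \<Rightarrow> bool" where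
  "is_biproduct C x y b i j p q \<longleftrightarrow>
     i \<in> Hom C x b \<and> j \<in> Hom C y b \<and> p \<in> Hom C b x \<and> q \<in> Hom C b y \<and>
     p \<cdot>\<^bsub>C\<^esub> i = Ident C x \<and> q \<cdot>\<^bsub>C\<^esub> j = Ident C y \<and>
     q \<cdot>\<^bsub>C\<^esub> i = Zero C x y \<and> p \<cdot>\<^bsub>C\<^esub> j = Zero C y x \<and>
     Add C (i \<cdot>\<^bsub>C\<^esub> p) (j \<cdot>\<^bsub>C\<^esub> q) = Ident C b"

definition is_kernel :: "('o, 'a, 'z) preadd_scheme \<Rightarrow> 'a \<Rightarrow> 'a \<Rightarrow> bool" where
  "is_kernel C f k \<longleftrightarrow> f \<in> Arr C \<and> k \<in> Arr C \<and> Cod C k = Dom C f \<and>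
     f \<cdot>\<^bsub>C\<^esub> k = Zero C (Dom C k) (Cod C f) \<and>
     (\<forall>x. \<forall>h \<in> Hom C x (Dom C f). f \<cdot>\<^bsub>C\<^esub> h = Zero C x (Cod C f) \<longrightarrow>
        (\<exists>!u. u \<in> Hom C x (Dom C k) \<and> k \<cdot>\<^bsub>C\<^esub> u = h))"

definition is_cokernel :: "('o, 'a, 'z) preadd_scheme \<Rightarrow> 'a \<Rightarrow> 'a \<Rightarrow> bool" where
  "is_cokernel C f c \<longleftrightarrow> f \<in> Arr C \<and> c \<in> Arr C \<and> Dom C c = Cod C f \<and>
     c \<cdot>\<^bsub>C\<^esub> f = Zero C (Dom C f) (Cod C c) \<and>
     (\<forall>y. \<forall>h \<in> Hom C (Cod C f) y. h \<cdot>\<^bsub>C\<^esub> f = Zero C (Dom C f) y \<longrightarrow>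
        (\<exists>!u. u \<in> Hom C (Cod C c) y \<and> u \<cdot>\<^bsub>C\<^esub> c = h))"

locale abelian_category = preadditive_category C
  for C :: "('o, 'a, 'z) preadd_scheme" (structure) +
  assumes ex_zero_object: "\<exists>z. is_zero_object C z"
    and ex_biproduct: "\<lbrakk>x \<in> Obj C; y \<in> Obj C\<rbrakk> \<Longrightarrow> \<exists>b i j p q. is_biproduct C x y b i j p q"
    and ex_kernel: "f \<in> Arr C \<Longrightarrow> \<exists>k. is_kernel C f k"
    and ex_cokernel: "f \<in> Arr C \<Longrightarrow> \<exists>c. is_cokernel C f c"
    and monic_normal: "monic C f \<Longrightarrow> \<exists>g. is_kernel C g f"
    and epic_normal: "epic C f \<Longrightarrow> \<exists>g. is_cokernel C g f"

definition zero_object :: "('o, 'a, 'z) cat_scheme \<Rightarrow> 'o" where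
  "zero_object C = (SOME z. is_zero_object C z)"

definition kernel :: "('o, 'a, 'z) preadd_scheme \<Rightarrow> 'a \<Rightarrow> 'a" where
  "kernel C f = (SOME k. is_kernel C f k)"

definition cokernel :: "('o, 'a, 'z) preadd_scheme \<Rightarrow> 'a \<Rightarrow> 'a" where
  "cokernel C f = (SOME c. is_cokernel C f c)"

text \<open>Exactness of \<open>\<bullet> \<rightarrow> \<bullet> \<rightarrow> \<bullet>\<close> in the middle: the image of \<open>f\<close>, i.e. a kernel of a cokernel
  of \<open>f\<close>, is a kernel of \<open>g\<close>.\<close>

definition exact :: "('o, 'a, 'z) preadd_scheme \<Rightarrow> 'a \<Rightarrow> 'a \<Rightarrow> bool" where
  "exact C f g \<longleftrightarrow> f \<in> Arr C \<and> g \<in> Arr C \<and> Cod C f = Dom C g \<and>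
     (\<exists>c k. is_cokernel C f c \<and> is_kernel C c k \<and> is_kernel C g k)"

definition short_exact :: "('o, 'a, 'z) preadd_scheme \<Rightarrow> 'a \<Rightarrow> 'a \<Rightarrow> bool" where
  "short_exact C f g \<longleftrightarrow> monic C f \<and> exact C f g \<and> epic C g"

definition additive_functor ::
  "('o, 'a, 'z) preadd_scheme \<Rightarrow> ('p, 'b, 'w) preadd_scheme \<Rightarrow> ('o, 'a, 'p, 'b) fctr \<Rightarrow> bool" where
  "additive_functor C D F \<longleftrightarrow> is_functor C D F \<and>
     (\<forall>x y. \<forall>f \<in> Hom C x y. \<forall>g \<in> Hom C x y.
        amap F (Add C f g) = Add D (amap F f) (amap F g))"

definition exact_functor ::
  "('o, 'a, 'z) preadd_scheme \<Rightarrow> ('p, 'b, 'w) preadd_scheme \<Rightarrow> ('o, 'a, 'p, 'b) fctr \<Rightarrow> bool" where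
  "exact_functor C D F \<longleftrightarrow> additive_functor C D F \<and>
     (\<forall>f g. short_exact C f g \<longrightarrow> short_exact D (amap F f) (amap F g))"


section \<open>Chain complexes and homology in an abelian category\<close>

text \<open>\<open>ch_d c n\<close> is the differential from degree \<open>n + 1\<close> to degree \<open>n\<close>.\<close>

record ('o, 'a) cpx =
  ch_ob :: "nat \<Rightarrow> 'o"
  ch_d :: "nat \<Rightarrow> 'a"

record ('o, 'a) chmap =
  ch_dom :: "('o, 'a) cpx"
  ch_cod :: "('o, 'a) cpx"
  ch_map :: "nat \<Rightarrow> 'a"

definition is_cpx :: "('o, 'a, 'z) preadd_scheme \<Rightarrow> ('o, 'a) cpx \<Rightarrow> bool" where
  "is_cpx C c \<longleftrightarrow>
     (\<forall>n. ch_ob c n \<in> Obj C) \<and>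
     (\<forall>n. ch_d c n \<in> Hom C (ch_ob c (Suc n)) (ch_ob c n)) \<and>
     (\<forall>n. ch_d c n \<cdot>\<^bsub>C\<^esub> ch_d c (Suc n) = Zero C (ch_ob c (Suc (Suc n))) (ch_ob c n))"

definition is_chmap :: "('o, 'a, 'z) preadd_scheme \<Rightarrow> ('o, 'a) chmap \<Rightarrow> bool" where
  "is_chmap C h \<longleftrightarrow> is_cpx C (ch_dom h) \<and> is_cpx C (ch_cod h) \<and>
     (\<forall>n. ch_map h n \<in> Hom C (ch_ob (ch_dom h) n) (ch_ob (ch_cod h) n)) \<and>
     (\<forall>n. ch_d (ch_cod h) n \<cdot>\<^bsub>C\<^esub> ch_map h (Suc n) = ch_map h n \<cdot>\<^bsub>C\<^esub> ch_d (ch_dom h) n)"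

definition cpx_cat :: "('o, 'a, 'z) preadd_scheme \<Rightarrow> (('o, 'a) cpx, ('o, 'a) chmap) preadd" where
  "cpx_cat C = \<lparr>
     Obj = {c. is_cpx C c}, Arr = {h. is_chmap C h}, Dom = ch_dom, Cod = ch_cod,
     Ident = (\<lambda>c. \<lparr>ch_dom = c, ch_cod = c, ch_map = (\<lambda>n. Ident C (ch_ob c n))\<rparr>),
     Comp = (\<lambda>h g. \<lparr>ch_dom = ch_dom g, ch_cod = ch_cod h,
                     ch_map = (\<lambda>n. ch_map h n \<cdot>\<^bsub>C\<^esub> ch_map g n)\<rparr>),
     Add = (\<lambda>g h. \<lparr>ch_dom = ch_dom g, ch_cod = ch_cod g,
                    ch_map = (\<lambda>n. Add C (ch_map g n) (ch_map h n))\<rparr>),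
     Zero = (\<lambda>c e. \<lparr>ch_dom = c, ch_cod = e,
                     ch_map = (\<lambda>n. Zero C (ch_ob c n) (ch_ob e n))\<rparr>) \<rparr>"

definition map_cpx :: "('o, 'a, 'p, 'b) fctr \<Rightarrow> ('o, 'a) cpx \<Rightarrow> ('p, 'b) cpx" where
  "map_cpx F c = \<lparr>ch_ob = (\<lambda>n. omap F (ch_ob c n)), ch_d = (\<lambda>n. amap F (ch_d c n))\<rparr>"

text \<open>The differential leaving degree \<open>n\<close>; in degree \<open>0\<close> it is the map to the zero object.\<close>

definition out_d :: "('o, 'a, 'z) preadd_scheme \<Rightarrow> ('o, 'a) cpx \<Rightarrow> nat \<Rightarrow> 'a" where
  "out_d C c n =
     (case n of 0 \<Rightarrow> Zero C (ch_ob c 0) (zero_object C) | Suc m \<Rightarrow> ch_d c m)"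

text \<open>The inclusion \<open>Z\<^sub>n \<rightarrow> c\<^sub>n\<close> of the cycles, the factorization \<open>c\<^bsub>n+1\<^esub> \<rightarrow> Z\<^sub>n\<close> of the
  incoming differential, and the projection \<open>Z\<^sub>n \<rightarrow> H\<^sub>n\<close> onto homology.\<close>

definition cycles :: "('o, 'a, 'z) preadd_scheme \<Rightarrow> ('o, 'a) cpx \<Rightarrow> nat \<Rightarrow> 'a" where
  "cycles C c n = kernel C (out_d C c n)"

definition bdry :: "('o, 'a, 'z) preadd_scheme \<Rightarrow> ('o, 'a) cpx \<Rightarrow> nat \<Rightarrow> 'a" where
  "bdry C c n = (THE b. b \<in> Hom C (ch_ob c (Suc n)) (Dom C (cycles C c n)) \<and>
                        cycles C c n \<cdot>\<^bsub>C\<^esub> b = ch_d c n)"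

definition hproj :: "('o, 'a, 'z) preadd_scheme \<Rightarrow> ('o, 'a) cpx \<Rightarrow> nat \<Rightarrow> 'a" where
  "hproj C c n = cokernel C (bdry C c n)"

definition homology :: "('o, 'a, 'z) preadd_scheme \<Rightarrow> ('o, 'a) cpx \<Rightarrow> nat \<Rightarrow> 'o" where
  "homology C c n = Cod C (hproj C c n)"

text \<open>The map induced by \<open>a\<close> on subquotients: given a mono \<open>z\<close> into \<open>Dom a\<close> with quotient \<open>q\<close>
  of \<open>Dom z\<close>, and a mono \<open>z'\<close> into \<open>Cod a\<close> with quotient \<open>q'\<close> of \<open>Dom z'\<close>, it is the arrow
  \<open>h\<close> making both squares of
    \<open>Cod q \<leftarrow> Dom z \<rightarrow> Dom a\<close>  over  \<open>Cod q' \<leftarrow> Dom z' \<rightarrow> Cod a\<close>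
  commute.\<close>

definition induced :: "('o, 'a, 'z) cat_scheme \<Rightarrow> 'a \<Rightarrow> 'a \<Rightarrow> 'a \<Rightarrow> 'a \<Rightarrow> 'a \<Rightarrow> 'a" where
  "induced C z q z' q' a = (THE h. h \<in> Hom C (Cod C q) (Cod C q') \<and>
     (\<exists>\<zeta> \<in> Hom C (Dom C z) (Dom C z'). z' \<cdot>\<^bsub>C\<^esub> \<zeta> = a \<cdot>\<^bsub>C\<^esub> z \<and> h \<cdot>\<^bsub>C\<^esub> q = q' \<cdot>\<^bsub>C\<^esub> \<zeta>))"

definition homology_map :: "('o, 'a, 'z) preadd_scheme \<Rightarrow> ('o, 'a) chmap \<Rightarrow> nat \<Rightarrow> 'a" where
  "homology_map C h n =
     induced C (cycles C (ch_dom h) n) (hproj C (ch_dom h) n)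
               (cycles C (ch_cod h) n) (hproj C (ch_cod h) n) (ch_map h n)"


section \<open>Double categories\<close>

text \<open>A 1-cell \<open>M : A \<nrightarrow> B\<close> has \<open>omap (Lf D) M = A\<close> and \<open>omap (Rt D) M = B\<close>; the horizontal
  composite \<open>M \<odot> N\<close> of \<open>M : A \<nrightarrow> B\<close> and \<open>N : B \<nrightarrow> C\<close> is \<open>omap (Odot D) (M, N)\<close>.\<close>

record ('o, 'v, 'm, 'c) dblcat =
  Vert :: "('o, 'v) cat"
  Horiz :: "('m, 'c) cat"
  Unt :: "('o, 'v, 'm, 'c) fctr"
  Lf :: "('m, 'c, 'o, 'v) fctr"
  Rt :: "('m, 'c, 'o, 'v) fctr"
  Odot :: "('m \<times> 'm, 'c \<times> 'c, 'm, 'c) fctr"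
  Assoc :: "'m \<Rightarrow> 'm \<Rightarrow> 'm \<Rightarrow> 'c"
  LUnit :: "'m \<Rightarrow> 'c"
  RUnit :: "'m \<Rightarrow> 'c"

abbreviation odot_ob :: "('o, 'v, 'm, 'c, 'z) dblcat_scheme \<Rightarrow> 'm \<Rightarrow> 'm \<Rightarrow> 'm" where
  "odot_ob D M N \<equiv> omap (Odot D) (M, N)"

abbreviation odot_arr :: "('o, 'v, 'm, 'c, 'z) dblcat_scheme \<Rightarrow> 'c \<Rightarrow> 'c \<Rightarrow> 'c" where
  "odot_arr D \<alpha> \<beta> \<equiv> amap (Odot D) (\<alpha>, \<beta>)"

definition glob_iso :: "('o, 'v, 'm, 'c, 'z) dblcat_scheme \<Rightarrow> 'm \<Rightarrow> 'm \<Rightarrow> 'c \<Rightarrow> bool" where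
  "glob_iso D M N \<alpha> \<longleftrightarrow> \<alpha> \<in> Hom (Horiz D) M N \<and> is_iso (Horiz D) \<alpha> \<and>
     amap (Lf D) \<alpha> = Ident (Vert D) (omap (Lf D) M) \<and>
     amap (Rt D) \<alpha> = Ident (Vert D) (omap (Rt D) M)"

locale double_category =
  fixes D :: "('o, 'v, 'm, 'c, 'z) dblcat_scheme"
  assumes vert_cat: "category (Vert D)"
    and horiz_cat: "category (Horiz D)"
    and un_functor: "is_functor (Vert D) (Horiz D) (Unt D)"
    and lf_functor: "is_functor (Horiz D) (Vert D) (Lf D)"
    and rt_functor: "is_functor (Horiz D) (Vert D) (Rt D)"
    and odot_functor:
      "is_functor (pullback_cat (Horiz D) (Horiz D) (Rt D) (Lf D)) (Horiz D) (Odot D)"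
    and lf_un_ob: "A \<in> Obj (Vert D) \<Longrightarrow> omap (Lf D) (omap (Unt D) A) = A"
    and rt_un_ob: "A \<in> Obj (Vert D) \<Longrightarrow> omap (Rt D) (omap (Unt D) A) = A"
    and lf_un_arr: "f \<in> Arr (Vert D) \<Longrightarrow> amap (Lf D) (amap (Unt D) f) = f"
    and rt_un_arr: "f \<in> Arr (Vert D) \<Longrightarrow> amap (Rt D) (amap (Unt D) f) = f"
    and odot_frame_ob: "\<lbrakk>M \<in> Obj (Horiz D); N \<in> Obj (Horiz D); omap (Rt D) M = omap (Lf D) N\<rbrakk>
      \<Longrightarrow> omap (Lf D) (odot_ob D M N) = omap (Lf D) M \<and>
          omap (Rt D) (odot_ob D M N) = omap (Rt D) N"
    and odot_frame_arr: "\<lbrakk>\<alpha> \<in> Arr (Horiz D); \<beta> \<in> Arr (Horiz D); amap (Rt D) \<alpha> = amap (Lf D) \<beta>\<rbrakk>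
      \<Longrightarrow> amap (Lf D) (odot_arr D \<alpha> \<beta>) = amap (Lf D) \<alpha> \<and>
          amap (Rt D) (odot_arr D \<alpha> \<beta>) = amap (Rt D) \<beta>"
    and assoc_iso: "\<lbrakk>M \<in> Obj (Horiz D); N \<in> Obj (Horiz D); P \<in> Obj (Horiz D);
        omap (Rt D) M = omap (Lf D) N; omap (Rt D) N = omap (Lf D) P\<rbrakk>
      \<Longrightarrow> glob_iso D (odot_ob D (odot_ob D M N) P) (odot_ob D M (odot_ob D N P)) (Assoc D M N P)"
    and assoc_natural: "\<lbrakk>\<alpha> \<in> Hom (Horiz D) M M'; \<beta> \<in> Hom (Horiz D) N N'; \<gamma> \<in> Hom (Horiz D) P P';
        amap (Rt D) \<alpha> = amap (Lf D) \<beta>; amap (Rt D) \<beta> = amap (Lf D) \<gamma>\<rbrakk>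
      \<Longrightarrow> Assoc D M' N' P' \<cdot>\<^bsub>Horiz D\<^esub> odot_arr D (odot_arr D \<alpha> \<beta>) \<gamma> =
          odot_arr D \<alpha> (odot_arr D \<beta> \<gamma>) \<cdot>\<^bsub>Horiz D\<^esub> Assoc D M N P"
    and lunit_iso: "M \<in> Obj (Horiz D)
      \<Longrightarrow> glob_iso D (odot_ob D (omap (Unt D) (omap (Lf D) M)) M) M (LUnit D M)"
    and lunit_natural: "\<alpha> \<in> Hom (Horiz D) M M'
      \<Longrightarrow> LUnit D M' \<cdot>\<^bsub>Horiz D\<^esub> odot_arr D (amap (Unt D) (amap (Lf D) \<alpha>)) \<alpha> =
          \<alpha> \<cdot>\<^bsub>Horiz D\<^esub> LUnit D M"
    and runit_iso: "M \<in> Obj (Horiz D)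
      \<Longrightarrow> glob_iso D (odot_ob D M (omap (Unt D) (omap (Rt D) M))) M (RUnit D M)"
    and runit_natural: "\<alpha> \<in> Hom (Horiz D) M M'
      \<Longrightarrow> RUnit D M' \<cdot>\<^bsub>Horiz D\<^esub> odot_arr D \<alpha> (amap (Unt D) (amap (Rt D) \<alpha>)) =
          \<alpha> \<cdot>\<^bsub>Horiz D\<^esub> RUnit D M"
    and pentagon: "\<lbrakk>M \<in> Obj (Horiz D); N \<in> Obj (Horiz D); P \<in> Obj (Horiz D); Q \<in> Obj (Horiz D);
        omap (Rt D) M = omap (Lf D) N; omap (Rt D) N = omap (Lf D) P;
        omap (Rt D) P = omap (Lf D) Q\<rbrakk>
      \<Longrightarrow> Assoc D M N (odot_ob D P Q) \<cdot>\<^bsub>Horiz D\<^esub> Assoc D (odot_ob D M N) P Q =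
          odot_arr D (Ident (Horiz D) M) (Assoc D N P Q) \<cdot>\<^bsub>Horiz D\<^esub>
            (Assoc D M (odot_ob D N P) Q \<cdot>\<^bsub>Horiz D\<^esub>
               odot_arr D (Assoc D M N P) (Ident (Horiz D) Q))"
    and triangle: "\<lbrakk>M \<in> Obj (Horiz D); N \<in> Obj (Horiz D); omap (Rt D) M = omap (Lf D) N\<rbrakk>
      \<Longrightarrow> odot_arr D (Ident (Horiz D) M) (LUnit D N) \<cdot>\<^bsub>Horiz D\<^esub>
            Assoc D M (omap (Unt D) (omap (Rt D) M)) N =
          odot_arr D (RUnit D M) (Ident (Horiz D) N)"


section \<open>Framed and abelian framed bicategories\<close>

locale framed_bicategory = double_category D
  for D :: "('o, 'v, 'm, 'c, 'z) dblcat_scheme" +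
  assumes bifib:
    "bifibration (Horiz D) (prod_cat (Vert D) (Vert D)) (pair_fctr (Lf D) (Rt D))"

text \<open>\<open>HAdd\<close> and \<open>HZero\<close> carry the additive structures of all local categories at once.\<close>

record ('o, 'v, 'm, 'c) abdblcat = "('o, 'v, 'm, 'c) dblcat" +
  HAdd :: "'c \<Rightarrow> 'c \<Rightarrow> 'c"
  HZero :: "'m \<Rightarrow> 'm \<Rightarrow> 'c"

definition loc :: "('o, 'v, 'm, 'c, 'z) abdblcat_scheme \<Rightarrow> 'o \<Rightarrow> 'o \<Rightarrow> ('m, 'c) preadd" where
  "loc D A B = \<lparr>
     Obj = {M \<in> Obj (Horiz D). omap (Lf D) M = A \<and> omap (Rt D) M = B},
     Arr = {\<alpha> \<in> Arr (Horiz D). amap (Lf D) \<alpha> = Ident (Vert D) A \<and>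
                               amap (Rt D) \<alpha> = Ident (Vert D) B},
     Dom = Dom (Horiz D), Cod = Cod (Horiz D), Ident = Ident (Horiz D), Comp = Comp (Horiz D),
     Add = HAdd D, Zero = HZero D \<rparr>"

locale abelian_framed_bicategory = framed_bicategory D
  for D :: "('o, 'v, 'm, 'c, 'z) abdblcat_scheme" +
  assumes loc_abelian:
      "\<lbrakk>A \<in> Obj (Vert D); B \<in> Obj (Vert D)\<rbrakk> \<Longrightarrow> abelian_category (loc D A B)"
    and odot_additive_left:
      "\<lbrakk>A \<in> Obj (Vert D); B \<in> Obj (Vert D); E \<in> Obj (Vert D); N \<in> Obj (loc D B E)\<rbrakk>
       \<Longrightarrow> additive_functor (loc D A B) (loc D A E)
             \<lparr>omap = (\<lambda>M. odot_ob D M N), amap = (\<lambda>\<alpha>. odot_arr D \<alpha> (Ident (Horiz D) N))\<rparr>"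
    and odot_additive_right:
      "\<lbrakk>A \<in> Obj (Vert D); B \<in> Obj (Vert D); E \<in> Obj (Vert D); M \<in> Obj (loc D A B)\<rbrakk>
       \<Longrightarrow> additive_functor (loc D B E) (loc D A E)
             \<lparr>omap = (\<lambda>N. odot_ob D M N), amap = (\<lambda>\<beta>. odot_arr D (Ident (Horiz D) M) \<beta>)\<rparr>"

text \<open>A choice of cocartesian lifts: \<open>K f g N\<close> is the chosen cocartesian 2-cell
  \<open>N \<rightarrow> f\<^sub>!Ng\<^sub>!\<close> over \<open>(f, g)\<close>, so that \<open>f\<^sub>!Ng\<^sub>!\<close> is its codomain.\<close>

definition extension_choice ::
  "('o, 'v, 'm, 'c, 'z) dblcat_scheme \<Rightarrow> ('v \<Rightarrow> 'v \<Rightarrow> 'm \<Rightarrow> 'c) \<Rightarrow> bool" where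
  "extension_choice D K \<longleftrightarrow>
     (\<forall>f \<in> Arr (Vert D). \<forall>g \<in> Arr (Vert D). \<forall>N \<in> Obj (Horiz D).
        omap (Lf D) N = Dom (Vert D) f \<and> omap (Rt D) N = Dom (Vert D) g \<longrightarrow>
        cocartesian (Horiz D) (prod_cat (Vert D) (Vert D)) (pair_fctr (Lf D) (Rt D)) (K f g N) \<and>
        Dom (Horiz D) (K f g N) = N \<and>
        amap (Lf D) (K f g N) = f \<and> amap (Rt D) (K f g N) = g)"

definition extension ::
  "('o, 'v, 'm, 'c, 'z) abdblcat_scheme \<Rightarrow> ('v \<Rightarrow> 'v \<Rightarrow> 'm \<Rightarrow> 'c) \<Rightarrow> 'v \<Rightarrow> 'v \<Rightarrow> ('m, 'c, 'm, 'c) fctr"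
  where
  "extension D K f g = \<lparr>
     omap = (\<lambda>N. Cod (Horiz D) (K f g N)),
     amap = (\<lambda>\<alpha>. THE \<beta>.
        \<beta> \<in> Hom (loc D (Cod (Vert D) f) (Cod (Vert D) g))
               (Cod (Horiz D) (K f g (Dom (Horiz D) \<alpha>))) (Cod (Horiz D) (K f g (Cod (Horiz D) \<alpha>))) \<and>
        \<beta> \<cdot>\<^bsub>Horiz D\<^esub> K f g (Dom (Horiz D) \<alpha>) = K f g (Cod (Horiz D) \<alpha>) \<cdot>\<^bsub>Horiz D\<^esub> \<alpha>) \<rparr>"


section \<open>The category of chain complexes of an abelian framed bicategory\<close>

record ('m, 'c, 'v) dchmap = "('m, 'c) chmap" +
  ch_left :: 'v
  ch_right :: 'v

definition is_dcpx :: "('o, 'v, 'm, 'c, 'z) abdblcat_scheme \<Rightarrow> ('m, 'c) cpx \<Rightarrow> bool" where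
  "is_dcpx D c \<longleftrightarrow> (\<exists>A \<in> Obj (Vert D). \<exists>B \<in> Obj (Vert D). is_cpx (loc D A B) c)"

definition cpx_left :: "('o, 'v, 'm, 'c, 'z) dblcat_scheme \<Rightarrow> ('m, 'c) cpx \<Rightarrow> 'o" where
  "cpx_left D c = omap (Lf D) (ch_ob c 0)"

definition cpx_right :: "('o, 'v, 'm, 'c, 'z) dblcat_scheme \<Rightarrow> ('m, 'c) cpx \<Rightarrow> 'o" where
  "cpx_right D c = omap (Rt D) (ch_ob c 0)"

definition is_dchmap :: "('o, 'v, 'm, 'c, 'z) abdblcat_scheme \<Rightarrow> ('m, 'c, 'v) dchmap \<Rightarrow> bool" where
  "is_dchmap D h \<longleftrightarrow> is_dcpx D (ch_dom h) \<and> is_dcpx D (ch_cod h) \<and>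
     ch_left h \<in> Hom (Vert D) (cpx_left D (ch_dom h)) (cpx_left D (ch_cod h)) \<and>
     ch_right h \<in> Hom (Vert D) (cpx_right D (ch_dom h)) (cpx_right D (ch_cod h)) \<and>
     (\<forall>n. ch_map h n \<in> Hom (Horiz D) (ch_ob (ch_dom h) n) (ch_ob (ch_cod h) n) \<and>
          amap (Lf D) (ch_map h n) = ch_left h \<and> amap (Rt D) (ch_map h n) = ch_right h) \<and>
     (\<forall>n. ch_d (ch_cod h) n \<cdot>\<^bsub>Horiz D\<^esub> ch_map h (Suc n) =
          ch_map h n \<cdot>\<^bsub>Horiz D\<^esub> ch_d (ch_dom h) n)"

definition Ch :: "('o, 'v, 'm, 'c, 'z) abdblcat_scheme \<Rightarrow> (('m, 'c) cpx, ('m, 'c, 'v) dchmap) cat" where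
  "Ch D = \<lparr>
     Obj = {c. is_dcpx D c}, Arr = {h. is_dchmap D h}, Dom = ch_dom, Cod = ch_cod,
     Ident = (\<lambda>c. \<lparr>ch_dom = c, ch_cod = c, ch_map = (\<lambda>n. Ident (Horiz D) (ch_ob c n)),
                   ch_left = Ident (Vert D) (cpx_left D c),
                   ch_right = Ident (Vert D) (cpx_right D c)\<rparr>),
     Comp = (\<lambda>h g. \<lparr>ch_dom = ch_dom g, ch_cod = ch_cod h,
                     ch_map = (\<lambda>n. ch_map h n \<cdot>\<^bsub>Horiz D\<^esub> ch_map g n),
                     ch_left = ch_left h \<cdot>\<^bsub>Vert D\<^esub> ch_left g,
                     ch_right = ch_right h \<cdot>\<^bsub>Vert D\<^esub> ch_right g\<rparr>) \<rparr>"


section \<open>Relative pairs and relative homology\<close>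

text \<open>In the following \<open>M\<close> is a functor from a category to \<open>Ch D\<close>, \<open>K\<close> is a choice of
  cocartesian lifts and \<open>f : Y \<rightarrow> X\<close> is an arrow of the source category of \<open>M\<close>.\<close>

definition loc_at ::
  "('o, 'v, 'm, 'c, 'z) abdblcat_scheme \<Rightarrow> ('x, 'f, ('m, 'c) cpx, ('m, 'c, 'v) dchmap) fctr \<Rightarrow>
   'x \<Rightarrow> ('m, 'c) preadd" where
  "loc_at D M X = loc D (cpx_left D (omap M X)) (cpx_right D (omap M X))"

definition abs_homology ::
  "('o, 'v, 'm, 'c, 'z) abdblcat_scheme \<Rightarrow> ('x, 'f, ('m, 'c) cpx, ('m, 'c, 'v) dchmap) fctr \<Rightarrow>
   'x \<Rightarrow> nat \<Rightarrow> 'm" where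
  "abs_homology D M X = homology (loc_at D M X) (omap M X)"

text \<open>The functor \<open>L(f)\<^sub>!(-)R(f)\<^sub>!\<close>, denoted \<open>\<^sup>X(-)\<close>.\<close>

definition ext_along ::
  "('o, 'v, 'm, 'c, 'z) abdblcat_scheme \<Rightarrow> ('v \<Rightarrow> 'v \<Rightarrow> 'm \<Rightarrow> 'c) \<Rightarrow>
   ('x, 'f, ('m, 'c) cpx, ('m, 'c, 'v) dchmap) fctr \<Rightarrow> 'f \<Rightarrow> ('m, 'c, 'm, 'c) fctr" where
  "ext_along D K M f = extension D K (ch_left (amap M f)) (ch_right (amap M f))"

text \<open>The factorization \<open>\<^sup>XM(Y) \<rightarrow> M(X)\<close> of \<open>M(f)\<close> through the (degreewise) cocartesian
  morphism \<open>M(Y) \<rightarrow> \<^sup>XM(Y)\<close>.\<close>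

definition rel_fact ::
  "('o, 'v, 'm, 'c, 'z) abdblcat_scheme \<Rightarrow> ('v \<Rightarrow> 'v \<Rightarrow> 'm \<Rightarrow> 'c) \<Rightarrow> ('x, 'f, 'w) cat_scheme \<Rightarrow>
   ('x, 'f, ('m, 'c) cpx, ('m, 'c, 'v) dchmap) fctr \<Rightarrow> 'f \<Rightarrow> ('m, 'c) chmap" where
  "rel_fact D K C M f = (THE h.
     h \<in> Hom (cpx_cat (loc_at D M (Cod C f)))
          (map_cpx (ext_along D K M f) (omap M (Dom C f))) (omap M (Cod C f)) \<and>
     (\<forall>n. ch_map h n \<cdot>\<^bsub>Horiz D\<^esub>
            K (ch_left (amap M f)) (ch_right (amap M f)) (ch_ob (omap M (Dom C f)) n) =
          ch_map (amap M f) n))"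

definition relative_pair ::
  "('o, 'v, 'm, 'c, 'z) abdblcat_scheme \<Rightarrow> ('v \<Rightarrow> 'v \<Rightarrow> 'm \<Rightarrow> 'c) \<Rightarrow> ('x, 'f, 'w) cat_scheme \<Rightarrow>
   ('x, 'f, ('m, 'c) cpx, ('m, 'c, 'v) dchmap) fctr \<Rightarrow> 'f \<Rightarrow> bool" where
  "relative_pair D K C M f \<longleftrightarrow> f \<in> Arr C \<and>
     exact_functor (loc_at D M (Dom C f)) (loc_at D M (Cod C f)) (ext_along D K M f) \<and>
     monic (cpx_cat (loc_at D M (Cod C f))) (rel_fact D K C M f)"

text \<open>The projection \<open>M(X) \<rightarrow> M(X,Y)\<close> and the relative complex \<open>M(X,Y)\<close>.\<close>

definition rel_proj ::
  "('o, 'v, 'm, 'c, 'z) abdblcat_scheme \<Rightarrow> ('v \<Rightarrow> 'v \<Rightarrow> 'm \<Rightarrow> 'c) \<Rightarrow> ('x, 'f, 'w) cat_scheme \<Rightarrow>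
   ('x, 'f, ('m, 'c) cpx, ('m, 'c, 'v) dchmap) fctr \<Rightarrow> 'f \<Rightarrow> ('m, 'c) chmap" where
  "rel_proj D K C M f = cokernel (cpx_cat (loc_at D M (Cod C f))) (rel_fact D K C M f)"

definition rel_cpx ::
  "('o, 'v, 'm, 'c, 'z) abdblcat_scheme \<Rightarrow> ('v \<Rightarrow> 'v \<Rightarrow> 'm \<Rightarrow> 'c) \<Rightarrow> ('x, 'f, 'w) cat_scheme \<Rightarrow>
   ('x, 'f, ('m, 'c) cpx, ('m, 'c, 'v) dchmap) fctr \<Rightarrow> 'f \<Rightarrow> ('m, 'c) cpx" where
  "rel_cpx D K C M f = ch_cod (rel_proj D K C M f)"

definition rel_homology ::
  "('o, 'v, 'm, 'c, 'z) abdblcat_scheme \<Rightarrow> ('v \<Rightarrow> 'v \<Rightarrow> 'm \<Rightarrow> 'c) \<Rightarrow> ('x, 'f, 'w) cat_scheme \<Rightarrow>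
   ('x, 'f, ('m, 'c) cpx, ('m, 'c, 'v) dchmap) fctr \<Rightarrow> 'f \<Rightarrow> nat \<Rightarrow> 'm" where
  "rel_homology D K C M f = homology (loc_at D M (Cod C f)) (rel_cpx D K C M f)"

text \<open>The canonical map \<open>\<^sup>XH\<^sub>i(Y) \<rightarrow> H\<^sub>i(X)\<close>: since \<open>\<^sup>X(-)\<close> is exact, it carries the
  presentation \<open>H\<^sub>i(Y) \<leftarrow> Z\<^sub>i(Y) \<rightarrow> M(Y)\<^sub>i\<close> to one of \<open>H\<^sub>i(\<^sup>XM(Y))\<close>, and the map is the one
  induced by \<open>\<^sup>XM(Y) \<rightarrow> M(X)\<close>.\<close>

definition ext_homology_map ::
  "('o, 'v, 'm, 'c, 'z) abdblcat_scheme \<Rightarrow> ('v \<Rightarrow> 'v \<Rightarrow> 'm \<Rightarrow> 'c) \<Rightarrow> ('x, 'f, 'w) cat_scheme \<Rightarrow>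
   ('x, 'f, ('m, 'c) cpx, ('m, 'c, 'v) dchmap) fctr \<Rightarrow> 'f \<Rightarrow> nat \<Rightarrow> 'c" where
  "ext_homology_map D K C M f i =
     induced (loc_at D M (Cod C f))
       (amap (ext_along D K M f) (cycles (loc_at D M (Dom C f)) (omap M (Dom C f)) i))
       (amap (ext_along D K M f) (hproj (loc_at D M (Dom C f)) (omap M (Dom C f)) i))
       (cycles (loc_at D M (Cod C f)) (omap M (Cod C f)) i)
       (hproj (loc_at D M (Cod C f)) (omap M (Cod C f)) i)
       (ch_map (rel_fact D K C M f) i)"

end

theory Submission
  imports Defs
begin

text \<open>
  The theorem is the long exact homology sequence of a short exact sequence of chain complexes
  \<open>0 \<rightarrow> \<^sup>XM(Y) \<rightarrow> M(X) \<rightarrow> M(X,Y) \<rightarrow> 0\<close> in the abelian category \<open>\<A>(L(X), R(X))\<close>, in which the homology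
  of \<open>\<^sup>XM(Y)\<close> is replaced by the extension \<open>\<^sup>XH(Y)\<close> of the homology of \<open>M(Y)\<close>. Three points carry it.

  First, the long exact sequence in an arbitrary abelian category (locale
  \<open>short_exact_complexes\<close>). The usual diagram chase with elements is made rigorous by taking
  arrows \<open>x : T \<rightarrow> A\<close> as elements of \<open>A\<close>. A preimage under an epimorphism, or under an arrow
  whose image contains \<open>x\<close>, exists after precomposing \<open>x\<close> with some epimorphism \<open>p\<close> onto
  \<open>T\<close>, because epimorphisms are stable under pullback (\<open>pullback_epic\<close>). Two arrows that agree after
  such a \<open>p\<close> are equal, so equations, vanishing and lifts along monomorphisms
  (\<open>monic_local_lift\<close>) descend from \<open>p\<close> to \<open>T\<close>, and exactness is a statement about
  elements (\<open>exact_lift\<close>, \<open>exactI\<close>). A cycle \<open>x\<close> has a class \<open>hclass\<close> in homology, every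
  element of homology is locally such a class, and a class vanishes iff the cycle is locally a
  boundary. The chases then read as they do for modules. The connecting arrow is produced
  once, on the pullback of the cycles of the quotient complex along the projection
  (\<open>connecting_exists\<close>).

  Second, the homology objects are not tied to chosen kernels and cokernels: the chase only uses
  that \<open>z\<close> and \<open>q\<close> are a \<open>homology_presentation\<close>, i.e. a monomorphism from an object of cycles and an
  epimorphism onto an object of homology classes. An exact functor sends a presentation for \<open>c\<close>
  to one for the image complex (\<open>F_presentation\<close>). With the exact functor \<open>\<^sup>X(-)\<close> this makes
  \<open>\<^sup>XH\<^sub>i(Y)\<close> an object of homology for \<open>\<^sup>XM(Y)\<close>.

  Third, the hypotheses on the pair concern the category of complexes. A monomorphism of
  complexes is monic in every degree and a cokernel of complexes is a cokernel in every degree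
  (\<open>chmap_monic_degreewise\<close>, \<open>chmap_cokernel_degreewise\<close>), which gives the degreewise short
  exactness; and the factorization \<open>\<^sup>XM(Y) \<rightarrow> M(X)\<close> exists as a chain map by the universal property of the
  cocartesian cells (\<open>rel_fact_properties\<close>).
\<close>

section \<open>Categories and preadditive categories\<close>

lemma Hom_iff [simp]: "f \<in> Hom C x y \<longleftrightarrow> f \<in> Arr C \<and> Dom C f = x \<and> Cod C f = y"
  by (simp add: Hom_def)

context category
begin

lemma arr_comp [simp]:
  assumes "f \<in> Arr C" "g \<in> Arr C" "Cod C f = Dom C g"
  shows "g \<cdot> f \<in> Arr C" "Dom C (g \<cdot> f) = Dom C f" "Cod C (g \<cdot> f) = Cod C g"
  using comp_hom[of f "Dom C f" "Cod C f" g "Cod C g"] assms by auto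

lemma arr_ident [simp]:
  assumes "x \<in> Obj C"
  shows "Ident C x \<in> Arr C" "Dom C (Ident C x) = x" "Cod C (Ident C x) = x"
  using ident_hom[OF assms] by auto

lemma comp_ident [simp]:
  assumes "f \<in> Arr C"
  shows "Dom C f = x \<Longrightarrow> f \<cdot> Ident C x = f" "Cod C f = y \<Longrightarrow> Ident C y \<cdot> f = f"
  using assms ident_left ident_right by auto

lemma assoc [simp]:
  assumes "f \<in> Arr C" "g \<in> Arr C" "h \<in> Arr C" "Cod C f = Dom C g" "Cod C g = Dom C h"
  shows "(h \<cdot> g) \<cdot> f = h \<cdot> (g \<cdot> f)"
  using comp_assoc[of f "Dom C f" "Dom C g" g "Dom C h" h "Cod C h"] assms by auto

text \<open>Composites are kept nested to the right. An equation between two composites is applied in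
  front of a further factor \<open>t\<close> by this lemma and the next.\<close>

lemma comp_extend:
  assumes "g \<cdot> f = k \<cdot> h" "f \<in> Arr C" "g \<in> Arr C" "h \<in> Arr C" "k \<in> Arr C" "t \<in> Arr C"
    "Cod C f = Dom C g" "Cod C h = Dom C k" "Cod C t = Dom C f"
  shows "g \<cdot> (f \<cdot> t) = k \<cdot> (h \<cdot> t)"
proof -
  have "Dom C f = Dom C h"
    using assms arr_comp(2)[of f g] arr_comp(2)[of h k] by simp
  then show ?thesis
    using assms assoc[of t f g] assoc[of t h k] by simp
qed

lemma comp_extend':
  assumes "g \<cdot> f = k" "f \<in> Arr C" "g \<in> Arr C" "t \<in> Arr C" "Cod C f = Dom C g" "Cod C t = Dom C f"
  shows "g \<cdot> (f \<cdot> t) = k \<cdot> t"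
  using assms assoc[of t f g] by simp

lemmas obj_arr [simp] = dom_obj cod_obj

lemma monic_cancel:
  assumes "monic C m" "m \<cdot> u = m \<cdot> v" "u \<in> Arr C" "v \<in> Arr C"
    "Dom C u = Dom C v" "Cod C u = Dom C m" "Cod C v = Dom C m"
  shows "u = v"
  using assms unfolding monic_def by auto

lemma epic_cancel:
  assumes "epic C e" "u \<cdot> e = v \<cdot> e" "u \<in> Arr C" "v \<in> Arr C"
    "Cod C u = Cod C v" "Dom C u = Cod C e" "Dom C v = Cod C e"
  shows "u = v"
  using assms unfolding epic_def by auto

lemma monic_arr [simp]: "monic C m \<Longrightarrow> m \<in> Arr C"
  by (simp add: monic_def)

lemma epic_arr [simp]: "epic C m \<Longrightarrow> m \<in> Arr C"
  by (simp add: epic_def)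

lemma epic_ident: "x \<in> Obj C \<Longrightarrow> epic C (Ident C x)"
  unfolding epic_def by auto

lemma epic_comp:
  assumes "epic C e" "epic C f" "Cod C f = Dom C e"
  shows "epic C (e \<cdot> f)"
  unfolding epic_def
proof (intro conjI allI ballI impI)
  show "e \<cdot> f \<in> Arr C" using assms by simp
  fix x u v
  assume u: "u \<in> Hom C (Cod C (e \<cdot> f)) x" and v: "v \<in> Hom C (Cod C (e \<cdot> f)) x"
    and eq: "u \<cdot> (e \<cdot> f) = v \<cdot> (e \<cdot> f)"
  have "(u \<cdot> e) \<cdot> f = (v \<cdot> e) \<cdot> f" using u v eq assms by simp
  then have "u \<cdot> e = v \<cdot> e" by (rule epic_cancel[OF assms(2)]) (use u v assms in auto)
  then show "u = v" by (rule epic_cancel[OF assms(1)]) (use u v assms in auto)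
qed

end

definition sub :: "('o, 'a, 'z) preadd_scheme \<Rightarrow> 'a \<Rightarrow> 'a \<Rightarrow> 'a" where
  "sub C f g = Add C f
     (m_inv \<lparr>carrier = Hom C (Dom C f) (Cod C f), monoid.mult = Add C,
             one = Zero C (Dom C f) (Cod C f)\<rparr> g)"

context preadditive_category
begin

abbreviation hom_grp where
  "hom_grp x y \<equiv> \<lparr>carrier = Hom C x y, monoid.mult = Add C, one = Zero C x y\<rparr>"

lemma zero_arr [simp]:
  assumes "x \<in> Obj C" "y \<in> Obj C"
  shows "Zero C x y \<in> Arr C" "Dom C (Zero C x y) = x" "Cod C (Zero C x y) = y"
proof -
  interpret comm_group "hom_grp x y" by (rule hom_group[OF assms])
  show "Zero C x y \<in> Arr C" "Dom C (Zero C x y) = x" "Cod C (Zero C x y) = y"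
    using one_closed by auto
qed

lemma sub_arr [simp]:
  assumes "f \<in> Arr C" "g \<in> Arr C" "Dom C f = Dom C g" "Cod C f = Cod C g"
  shows "sub C f g \<in> Arr C" "Dom C (sub C f g) = Dom C g" "Cod C (sub C f g) = Cod C g"
proof -
  interpret comm_group "hom_grp (Dom C f) (Cod C f)" using assms by (intro hom_group) auto
  have "sub C f g \<in> Hom C (Dom C f) (Cod C f)"
    using assms inv_closed[of g] m_closed[of f] unfolding sub_def by auto
  then show "sub C f g \<in> Arr C" "Dom C (sub C f g) = Dom C g" "Cod C (sub C f g) = Cod C g"
    using assms by auto
qed

lemma add_arr [simp]:
  assumes "f \<in> Arr C" "g \<in> Arr C" "Dom C f = Dom C g" "Cod C f = Cod C g"
  shows "Add C f g \<in> Arr C" "Dom C (Add C f g) = Dom C g" "Cod C (Add C f g) = Cod C g"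
proof -
  interpret comm_group "hom_grp (Dom C f) (Cod C f)" using assms by (intro hom_group) auto
  have "Add C f g \<in> Hom C (Dom C f) (Cod C f)"
    using assms m_closed[of f g] by auto
  then show "Add C f g \<in> Arr C" "Dom C (Add C f g) = Dom C g" "Cod C (Add C f g) = Cod C g"
    using assms by auto
qed

lemma add_zero:
  assumes "f \<in> Arr C" "Dom C f = x" "Cod C f = y"
  shows "Add C f (Zero C x y) = f" "Add C (Zero C x y) f = f"
proof -
  interpret comm_group "hom_grp (Dom C f) (Cod C f)" using assms by (intro hom_group) auto
  show "Add C f (Zero C x y) = f" "Add C (Zero C x y) f = f"
    using r_one[of f] l_one[of f] assms by auto
qed

text \<open>This is how additivity forces a map to preserve zero arrows.\<close>

lemma add_idem_zero:
  assumes "f \<in> Arr C" "Add C f f = f"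
  shows "f = Zero C (Dom C f) (Cod C f)"
proof -
  interpret comm_group "hom_grp (Dom C f) (Cod C f)" using assms by (intro hom_group) auto
  show ?thesis using assms r_cancel_one[of f f] by simp
qed

lemma sub_add:
  assumes "f \<in> Arr C" "g \<in> Arr C" "Dom C f = Dom C g" "Cod C f = Cod C g"
  shows "Add C (sub C f g) g = f"
proof -
  interpret comm_group "hom_grp (Dom C f) (Cod C f)" using assms by (intro hom_group) auto
  have "Add C (Add C f (inv\<^bsub>hom_grp (Dom C f) (Cod C f)\<^esub> g)) g = f"
    using assms m_assoc[of f "inv\<^bsub>hom_grp (Dom C f) (Cod C f)\<^esub> g" g] inv_closed[of g] l_inv[of g]
      r_one[of f] by simp
  then show ?thesis by (simp add: sub_def)
qed

lemma sub_unique: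
  assumes "f \<in> Arr C" "g \<in> Arr C" "h \<in> Arr C" "Dom C f = Dom C g" "Cod C f = Cod C g"
    "Dom C h = Dom C g" "Cod C h = Cod C g" "Add C h g = f"
  shows "h = sub C f g"
proof -
  interpret comm_group "hom_grp (Dom C f) (Cod C f)" using assms by (intro hom_group) auto
  have "Add C (sub C f g) g = Add C h g" using sub_add assms by simp
  then show ?thesis using assms right_cancel[of g h "sub C f g"] by auto
qed

lemma sub_self:
  assumes "f \<in> Arr C" "Dom C f = x" "Cod C f = y"
  shows "sub C f f = Zero C x y"
  using sub_unique[of f f "Zero C x y"] assms by (auto simp: add_zero)

lemma sub_eq_zero_iff:
  assumes "f \<in> Arr C" "g \<in> Arr C" "Dom C f = Dom C g" "Cod C f = Cod C g"
  shows "sub C f g = Zero C (Dom C g) (Cod C g) \<longleftrightarrow> f = g"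
  using sub_add[of f g] assms by (auto simp: add_zero sub_self)

lemma comp_zero [simp]:
  "\<lbrakk>g \<in> Arr C; Dom C g = y; x \<in> Obj C\<rbrakk> \<Longrightarrow> g \<cdot> Zero C x y = Zero C x (Cod C g)"
  "\<lbrakk>f \<in> Arr C; Cod C f = x; y \<in> Obj C\<rbrakk> \<Longrightarrow> Zero C x y \<cdot> f = Zero C (Dom C f) y"
proof -
  assume g: "g \<in> Arr C" "Dom C g = y" "x \<in> Obj C"
  have y: "y \<in> Obj C" using g by auto
  have "Add C (g \<cdot> Zero C x y) (g \<cdot> Zero C x y) = g \<cdot> Zero C x y"
    using comp_add_right[of "Zero C x y" x y "Zero C x y" g "Cod C g"] g y by (simp add: add_zero)
  from add_idem_zero[OF _ this] show "g \<cdot> Zero C x y = Zero C x (Cod C g)" using g y by simp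
next
  assume g: "f \<in> Arr C" "Cod C f = x" "y \<in> Obj C"
  have y: "x \<in> Obj C" using g by auto
  have "Add C (Zero C x y \<cdot> f) (Zero C x y \<cdot> f) = Zero C x y \<cdot> f"
    using comp_add_left[of f "Dom C f" x "Zero C x y" y "Zero C x y"] g y by (simp add: add_zero)
  from add_idem_zero[OF _ this] show "Zero C x y \<cdot> f = Zero C (Dom C f) y" using g y by simp
qed

lemma comp_sub:
  assumes "f \<in> Arr C" "g \<in> Arr C" "Dom C f = Dom C g" "Cod C f = Cod C g"
  shows "\<lbrakk>h \<in> Arr C; Dom C h = Cod C g\<rbrakk> \<Longrightarrow> h \<cdot> sub C f g = sub C (h \<cdot> f) (h \<cdot> g)"
    and "\<lbrakk>h \<in> Arr C; Cod C h = Dom C g\<rbrakk> \<Longrightarrow> sub C f g \<cdot> h = sub C (f \<cdot> h) (g \<cdot> h)"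
proof -
  note s = sub_add[of f g]
  show "h \<cdot> sub C f g = sub C (h \<cdot> f) (h \<cdot> g)" if "h \<in> Arr C" "Dom C h = Cod C g"
    using comp_add_right[of "sub C f g" "Dom C g" "Cod C g" g h "Cod C h"] assms that s
    by (intro sub_unique) auto
  show "sub C f g \<cdot> h = sub C (f \<cdot> h) (g \<cdot> h)" if "h \<in> Arr C" "Cod C h = Dom C g"
    using comp_add_left[of h "Dom C h" "Dom C g" "sub C f g" "Cod C g" g] assms that s
    by (intro sub_unique) auto
qed

lemma sub_zero:
  assumes "f \<in> Arr C" "Dom C f = x" "Cod C f = y"
  shows "sub C f (Zero C x y) = f"
  using sub_unique[of f "Zero C x y" f] assms by (auto simp: add_zero)

lemma monicI:
  assumes "m \<in> Arr C"
    and "\<And>u. \<lbrakk>u \<in> Arr C; Cod C u = Dom C m; m \<cdot> u = Zero C (Dom C u) (Cod C m)\<rbrakk>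
      \<Longrightarrow> u = Zero C (Dom C u) (Dom C m)"
  shows "monic C m"
  unfolding monic_def
proof (intro conjI allI ballI impI)
  show "m \<in> Arr C" by fact
  fix x u v
  assume u: "u \<in> Hom C x (Dom C m)" and v: "v \<in> Hom C x (Dom C m)" and eq: "m \<cdot> u = m \<cdot> v"
  have "m \<cdot> sub C u v = Zero C x (Cod C m)"
    using u v eq assms(1) by (simp add: comp_sub sub_self)
  then have "sub C u v = Zero C (Dom C v) (Cod C v)"
    using assms(2)[of "sub C u v"] u v by simp
  then show "u = v" using u v sub_eq_zero_iff[of u v] by simp
qed

lemma epicI:
  assumes "e \<in> Arr C"
    and "\<And>u. \<lbrakk>u \<in> Arr C; Dom C u = Cod C e; u \<cdot> e = Zero C (Dom C e) (Cod C u)\<rbrakk>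
      \<Longrightarrow> u = Zero C (Cod C e) (Cod C u)"
  shows "epic C e"
  unfolding epic_def
proof (intro conjI allI ballI impI)
  show "e \<in> Arr C" by fact
  fix x u v
  assume u: "u \<in> Hom C (Cod C e) x" and v: "v \<in> Hom C (Cod C e) x" and eq: "u \<cdot> e = v \<cdot> e"
  have "sub C u v \<cdot> e = Zero C (Dom C e) x"
    using u v eq assms(1) by (simp add: comp_sub sub_self)
  then have "sub C u v = Zero C (Dom C v) (Cod C v)"
    using assms(2)[of "sub C u v"] u v by simp
  then show "u = v" using u v sub_eq_zero_iff[of u v] by simp
qed

lemma monic_zero:
  assumes "monic C m" "u \<in> Arr C" "Cod C u = Dom C m" "m \<cdot> u = Zero C (Dom C u) (Cod C m)"
  shows "u = Zero C (Dom C u) (Dom C m)"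
  by (rule monic_cancel[OF assms(1)]) (use assms in auto)

lemma epic_zero:
  assumes "epic C e" "u \<in> Arr C" "Dom C u = Cod C e" "u \<cdot> e = Zero C (Dom C e) (Cod C u)"
  shows "u = Zero C (Cod C e) (Cod C u)"
  by (rule epic_cancel[OF assms(1)]) (use assms in auto)

lemma kernel_arr:
  assumes "is_kernel C f k"
  shows "f \<in> Arr C" "k \<in> Arr C" "Cod C k = Dom C f" "f \<cdot> k = Zero C (Dom C k) (Cod C f)"
  using assms by (auto simp: is_kernel_def)

lemma kernel_lift:
  assumes "is_kernel C f k" "h \<in> Arr C" "Cod C h = Dom C f" "f \<cdot> h = Zero C (Dom C h) (Cod C f)"
  obtains u where "u \<in> Arr C" "Dom C u = Dom C h" "Cod C u = Dom C k" "k \<cdot> u = h"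
proof -
  have "\<exists>!u. u \<in> Hom C (Dom C h) (Dom C k) \<and> k \<cdot> u = h"
    using assms(1-4) unfolding is_kernel_def by (elim conjE allE[of _ "Dom C h"] ballE[of _ _ h]) auto
  then show thesis using that by auto
qed

lemma kernel_monic:
  assumes "is_kernel C f k"
  shows "monic C k"
  unfolding monic_def
proof (intro conjI allI ballI impI)
  note k = kernel_arr[OF assms]
  show "k \<in> Arr C" by fact
  fix x u v
  assume u: "u \<in> Hom C x (Dom C k)" and v: "v \<in> Hom C x (Dom C k)" and eq: "k \<cdot> u = k \<cdot> v"
  have "f \<cdot> (k \<cdot> u) = Zero C x (Cod C f)" using k u by (simp add: comp_extend'[OF k(4)])
  then have "\<exists>!w. w \<in> Hom C x (Dom C k) \<and> k \<cdot> w = k \<cdot> u"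
    using assms k u unfolding is_kernel_def by (elim conjE allE[of _ x] ballE[of _ _ "k \<cdot> u"]) auto
  then show "u = v" using u v eq by metis
qed

lemma cokernel_arr:
  assumes "is_cokernel C f c"
  shows "f \<in> Arr C" "c \<in> Arr C" "Dom C c = Cod C f" "c \<cdot> f = Zero C (Dom C f) (Cod C c)"
  using assms by (auto simp: is_cokernel_def)

lemma cokernel_desc:
  assumes "is_cokernel C f c" "h \<in> Arr C" "Dom C h = Cod C f" "h \<cdot> f = Zero C (Dom C f) (Cod C h)"
  obtains u where "u \<in> Arr C" "Dom C u = Cod C c" "Cod C u = Cod C h" "u \<cdot> c = h"
proof -
  have "\<exists>!u. u \<in> Hom C (Cod C c) (Cod C h) \<and> u \<cdot> c = h"
    using assms(1-4) unfolding is_cokernel_def by (elim conjE allE[of _ "Cod C h"] ballE[of _ _ h]) auto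
  then show thesis using that by auto
qed

lemma cokernel_epic:
  assumes "is_cokernel C f c"
  shows "epic C c"
  unfolding epic_def
proof (intro conjI allI ballI impI)
  note c = cokernel_arr[OF assms]
  show "c \<in> Arr C" by fact
  fix x u v
  assume u: "u \<in> Hom C (Cod C c) x" and v: "v \<in> Hom C (Cod C c) x" and eq: "u \<cdot> c = v \<cdot> c"
  have "(u \<cdot> c) \<cdot> f = Zero C (Dom C f) x" using c u by simp
  then have "\<exists>!w. w \<in> Hom C (Cod C c) x \<and> w \<cdot> c = u \<cdot> c"
    using assms c u unfolding is_cokernel_def by (elim conjE allE[of _ x] ballE[of _ _ "u \<cdot> c"]) auto
  then show "u = v" using u v eq by metis
qed

lemma is_kernelI:
  assumes "f \<in> Arr C" "monic C k" "Cod C k = Dom C f" "f \<cdot> k = Zero C (Dom C k) (Cod C f)"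
    and "\<And>h. \<lbrakk>h \<in> Arr C; Cod C h = Dom C f; f \<cdot> h = Zero C (Dom C h) (Cod C f)\<rbrakk>
      \<Longrightarrow> \<exists>u. u \<in> Hom C (Dom C h) (Dom C k) \<and> k \<cdot> u = h"
  shows "is_kernel C f k"
  unfolding is_kernel_def
proof (intro conjI allI ballI impI)
  fix x h assume h: "h \<in> Hom C x (Dom C f)" "f \<cdot> h = Zero C x (Cod C f)"
  obtain u where "u \<in> Hom C x (Dom C k)" "k \<cdot> u = h" using assms(5)[of h] h by auto
  then show "\<exists>!u. u \<in> Hom C x (Dom C k) \<and> k \<cdot> u = h"
    by (intro ex1I[of _ u] monic_cancel[OF assms(2), of _ u]) auto
qed (use assms in auto)

lemma is_cokernelI:
  assumes "f \<in> Arr C" "epic C c" "Dom C c = Cod C f" "c \<cdot> f = Zero C (Dom C f) (Cod C c)"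
    and "\<And>h. \<lbrakk>h \<in> Arr C; Dom C h = Cod C f; h \<cdot> f = Zero C (Dom C f) (Cod C h)\<rbrakk>
      \<Longrightarrow> \<exists>u. u \<in> Hom C (Cod C c) (Cod C h) \<and> u \<cdot> c = h"
  shows "is_cokernel C f c"
  unfolding is_cokernel_def
proof (intro conjI allI ballI impI)
  fix x h assume h: "h \<in> Hom C (Cod C f) x" "h \<cdot> f = Zero C (Dom C f) x"
  obtain u where "u \<in> Hom C (Cod C c) x" "u \<cdot> c = h" using assms(5)[of h] h by auto
  then show "\<exists>!u. u \<in> Hom C (Cod C c) x \<and> u \<cdot> c = h"
    by (intro ex1I[of _ u] epic_cancel[OF assms(2), of _ u]) auto
qed (use assms in auto)

end

section \<open>Exactness in abelian categories\<close>

context abelian_category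
begin

lemma is_kernel_kernel: "f \<in> Arr C \<Longrightarrow> is_kernel C f (kernel C f)"
  unfolding kernel_def by (rule someI_ex) (rule ex_kernel)

lemma is_cokernel_cokernel: "f \<in> Arr C \<Longrightarrow> is_cokernel C f (cokernel C f)"
  unfolding cokernel_def by (rule someI_ex) (rule ex_cokernel)

text \<open>If \<open>m\<close> is a kernel of \<open>g\<close>, then \<open>g\<close> factors through the cokernel \<open>c\<close> of \<open>m\<close>, so \<open>c\<close> kills
  only what \<open>g\<close> kills.\<close>

lemma monic_is_kernel:
  assumes "monic C m" "is_cokernel C m c"
  shows "is_kernel C c m"
proof -
  note c = cokernel_arr[OF assms(2)]
  obtain g where g: "is_kernel C g m" using monic_normal[OF assms(1)] by blast
  note g' = kernel_arr[OF g]
  obtain u where u: "u \<in> Arr C" "Dom C u = Cod C c" "Cod C u = Cod C g" "u \<cdot> c = g"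
    using cokernel_desc[OF assms(2), of g] g' by auto
  show ?thesis
  proof (rule is_kernelI)
    fix h assume h: "h \<in> Arr C" "Cod C h = Dom C c" "c \<cdot> h = Zero C (Dom C h) (Cod C c)"
    have "g \<cdot> h = Zero C (Dom C h) (Cod C g)" using comp_extend'[OF u(4), of h] h u c by simp
    then show "\<exists>u. u \<in> Hom C (Dom C h) (Dom C m) \<and> m \<cdot> u = h"
      using kernel_lift[OF g, of h] h c g' by auto
  qed (use c assms g' in auto)
qed

lemma epic_is_cokernel:
  assumes "epic C e" "is_kernel C e k"
  shows "is_cokernel C k e"
proof -
  note k = kernel_arr[OF assms(2)]
  obtain g where g: "is_cokernel C g e" using epic_normal[OF assms(1)] by blast
  note g' = cokernel_arr[OF g]
  obtain u where u: "u \<in> Arr C" "Dom C u = Dom C g" "Cod C u = Dom C k" "k \<cdot> u = g"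
    using kernel_lift[OF assms(2), of g] g' by auto
  show ?thesis
  proof (rule is_cokernelI)
    fix h assume h: "h \<in> Arr C" "Dom C h = Cod C k" "h \<cdot> k = Zero C (Dom C k) (Cod C h)"
    have "h \<cdot> (k \<cdot> u) = Zero C (Dom C g) (Cod C h)"
      using h u(1-3) k comp_extend'[OF h(3), of u] by simp
    then have "h \<cdot> g = Zero C (Dom C g) (Cod C h)" unfolding u(4) .
    then show "\<exists>u. u \<in> Hom C (Cod C e) (Cod C h) \<and> u \<cdot> e = h"
      using cokernel_desc[OF g, of h] h k g' by auto
  qed (use k assms g' in auto)
qed

text \<open>If \<open>r \<cdot> e\<close> vanishes, then \<open>f\<close> factors through \<open>k \<cdot> m\<close> for a kernel \<open>m\<close> of \<open>r\<close>. This
  composite is a monomorphism, hence a kernel of some \<open>g\<close>; and \<open>g\<close> kills \<open>f\<close>, hence also \<open>k\<close>. So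
  \<open>k\<close> factors through \<open>k \<cdot> m\<close>, which makes \<open>m\<close> split epic and \<open>r\<close> zero.\<close>

lemma image_factorization:
  assumes "is_cokernel C f c" "is_kernel C c k"
  obtains e where "epic C e" "Dom C e = Dom C f" "Cod C e = Dom C k" "k \<cdot> e = f"
proof -
  note c = cokernel_arr[OF assms(1)] note k = kernel_arr[OF assms(2)]
  obtain e where e: "e \<in> Arr C" "Dom C e = Dom C f" "Cod C e = Dom C k" "k \<cdot> e = f"
    using kernel_lift[OF assms(2), of f] c by auto
  have "epic C e"
  proof (rule epicI)
    fix r assume r: "r \<in> Arr C" "Dom C r = Cod C e" "r \<cdot> e = Zero C (Dom C e) (Cod C r)"
    obtain m where m: "is_kernel C r m" using r ex_kernel by blast
    note m' = kernel_arr[OF m]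
    obtain e' where e': "e' \<in> Arr C" "Dom C e' = Dom C e" "Cod C e' = Dom C m" "m \<cdot> e' = e"
      using kernel_lift[OF m, of e] r e by auto
    have km: "monic C (k \<cdot> m)"
    proof (rule monicI)
      fix u assume u: "u \<in> Arr C" "Cod C u = Dom C (k \<cdot> m)"
        "(k \<cdot> m) \<cdot> u = Zero C (Dom C u) (Cod C (k \<cdot> m))"
      have "m \<cdot> u = Zero C (Dom C u) (Dom C k)"
        using monic_zero[OF kernel_monic[OF assms(2)], of "m \<cdot> u"] u m' k r e by simp
      then show "u = Zero C (Dom C u) (Dom C (k \<cdot> m))"
        using monic_zero[OF kernel_monic[OF m], of u] u m' k r e by simp
    qed (use k m' r e in auto)
    obtain g where g: "is_kernel C g (k \<cdot> m)" using monic_normal[OF km] by blast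
    note g' = kernel_arr[OF g]
    have "g \<cdot> f = Zero C (Dom C f) (Cod C g)"
      using comp_extend'[OF g'(4), of e'] e' e k g' m' r by simp
    then obtain g1 where g1: "g1 \<in> Arr C" "Dom C g1 = Cod C c" "Cod C g1 = Cod C g" "g1 \<cdot> c = g"
      using cokernel_desc[OF assms(1), of g] g' c k m' r e by auto
    have "g \<cdot> k = Zero C (Dom C k) (Cod C g)"
      using comp_extend'[OF g1(4), of k] g1 c k by simp
    then obtain s where s: "s \<in> Arr C" "Dom C s = Dom C k" "Cod C s = Dom C (k \<cdot> m)" "(k \<cdot> m) \<cdot> s = k"
      using kernel_lift[OF g, of k] k g' g1 m' r e by auto
    have "m \<cdot> s = Ident C (Dom C k)"
      by (rule monic_cancel[OF kernel_monic[OF assms(2)]]) (use s k m' r e in auto)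
    then have "r = r \<cdot> (m \<cdot> s)" using r e by simp
    also have "\<dots> = Zero C (Dom C k) (Cod C r)"
      using comp_extend'[OF m'(4), of s] s r e m' k by simp
    finally show "r = Zero C (Cod C e) (Cod C r)" using e by simp
  qed (use e in auto)
  then show thesis using that e by blast
qed

text \<open>The pullback is the kernel \<open>k\<close> of the difference \<open>\<phi>\<close> of \<open>f\<close> and \<open>g\<close> on the biproduct. As
  \<open>\<phi>\<close> restricts to \<open>f\<close> on the first summand it is epic, hence a cokernel of \<open>k\<close>. An arrow that
  vanishes on the projection \<open>e\<close> therefore extends along \<open>\<phi>\<close>, and its extension vanishes on \<open>f\<close>.\<close>

lemma pullback_epic:
  assumes f: "epic C f" and g: "g \<in> Arr C" "Cod C g = Cod C f"
  obtains e l where "epic C e" "Cod C e = Dom C g" "l \<in> Arr C" "Dom C l = Dom C e" "Cod C l = Dom C f"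
    "f \<cdot> l = g \<cdot> e"
    "\<And>t u. \<lbrakk>t \<in> Arr C; u \<in> Arr C; Dom C t = Dom C u; Cod C t = Dom C g; Cod C u = Dom C f;
       f \<cdot> u = g \<cdot> t\<rbrakk> \<Longrightarrow> \<exists>w \<in> Hom C (Dom C t) (Dom C e). e \<cdot> w = t \<and> l \<cdot> w = u"
proof -
  have fa: "f \<in> Arr C" using f by simp
  obtain b i j p q where "is_biproduct C (Dom C f) (Dom C g) b i j p q"
    using ex_biproduct[of "Dom C f" "Dom C g"] fa g by auto
  then have bi: "i \<in> Arr C" "Dom C i = Dom C f" "Cod C i = b" "j \<in> Arr C" "Dom C j = Dom C g" "Cod C j = b"
    "p \<in> Arr C" "Dom C p = b" "Cod C p = Dom C f" "q \<in> Arr C" "Dom C q = b" "Cod C q = Dom C g"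
    and b: "p \<cdot> i = Ident C (Dom C f)" "q \<cdot> j = Ident C (Dom C g)"
    "q \<cdot> i = Zero C (Dom C f) (Dom C g)" "p \<cdot> j = Zero C (Dom C g) (Dom C f)"
    "Add C (i \<cdot> p) (j \<cdot> q) = Ident C b"
    by (auto simp: is_biproduct_def)
  define \<phi> where "\<phi> = sub C (f \<cdot> p) (g \<cdot> q)"
  have \<phi>: "\<phi> \<in> Arr C" "Dom C \<phi> = b" "Cod C \<phi> = Cod C f"
    unfolding \<phi>_def using fa g bi by auto
  have \<phi>i: "\<phi> \<cdot> i = f" unfolding \<phi>_def
    using fa g bi b by (simp add: comp_sub sub_zero)
  have \<phi>e: "epic C \<phi>"
  proof (rule epicI)
    fix u assume u: "u \<in> Arr C" "Dom C u = Cod C \<phi>" "u \<cdot> \<phi> = Zero C (Dom C \<phi>) (Cod C u)"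
    have "u \<cdot> f = Zero C (Dom C f) (Cod C u)"
      using comp_extend'[OF u(3), of i] u \<phi> bi \<phi>i by simp
    then show "u = Zero C (Cod C \<phi>) (Cod C u)" using epic_zero[OF f, of u] u \<phi> by simp
  qed (rule \<phi>)
  obtain k where k: "is_kernel C \<phi> k" using \<phi> ex_kernel by blast
  note k' = kernel_arr[OF k]
  note cok = epic_is_cokernel[OF \<phi>e k]
  let ?e = "q \<cdot> k" and ?l = "p \<cdot> k"
  have ee: "epic C ?e"
  proof (rule epicI)
    fix r assume r: "r \<in> Arr C" "Dom C r = Cod C ?e" "r \<cdot> ?e = Zero C (Dom C ?e) (Cod C r)"
    have "(r \<cdot> q) \<cdot> k = Zero C (Dom C k) (Cod C r)" using r k' bi \<phi> by simp
    then obtain s where s: "s \<in> Arr C" "Dom C s = Cod C \<phi>" "Cod C s = Cod C r" "s \<cdot> \<phi> = r \<cdot> q"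
      using cokernel_desc[OF cok, of "r \<cdot> q"] r k' bi \<phi> by auto
    have "s \<cdot> f = Zero C (Dom C f) (Cod C r)"
      using comp_extend'[OF s(4), of i] s \<phi> bi \<phi>i r k' b fa by simp
    then have "s = Zero C (Cod C f) (Cod C r)" using epic_zero[OF f, of s] s \<phi> by simp
    then have "r \<cdot> q = Zero C b (Cod C r)" using s \<phi> r by (metis comp_zero(2) obj_arr(2))
    then have "(r \<cdot> q) \<cdot> j = Zero C (Dom C g) (Cod C r)" using bi r by simp
    then show "r = Zero C (Cod C ?e) (Cod C r)" using r k' bi b \<phi> by simp
  qed (use k' bi \<phi> in auto)
  have sq: "f \<cdot> ?l = g \<cdot> ?e"
    using k' sub_eq_zero_iff[of "f \<cdot> ?l" "g \<cdot> ?e"] fa g bi \<phi> unfolding \<phi>_def by (simp add: comp_sub)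
  have up: "\<exists>w \<in> Hom C (Dom C t) (Dom C ?e). ?e \<cdot> w = t \<and> ?l \<cdot> w = u"
    if t: "t \<in> Arr C" "u \<in> Arr C" "Dom C t = Dom C u" "Cod C t = Dom C g" "Cod C u = Dom C f"
       "f \<cdot> u = g \<cdot> t" for t u
  proof -
    define s where "s = Add C (i \<cdot> u) (j \<cdot> t)"
    have s: "s \<in> Arr C" "Dom C s = Dom C u" "Cod C s = b" unfolding s_def using t bi by auto
    have ps: "p \<cdot> s = u" and qs: "q \<cdot> s = t"
      unfolding s_def
      using comp_add_right[of "i \<cdot> u" "Dom C u" b "j \<cdot> t" p "Dom C f"]
        comp_add_right[of "i \<cdot> u" "Dom C u" b "j \<cdot> t" q "Dom C g"] t bi fa g
      by (simp_all add: comp_extend'[OF b(1)] comp_extend'[OF b(2)] comp_extend'[OF b(3)]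
          comp_extend'[OF b(4)] add_zero)
    have "\<phi> \<cdot> s = Zero C (Dom C s) (Cod C \<phi>)" using t g fa bi s \<phi> unfolding \<phi>_def
      by (simp add: comp_sub ps qs sub_self)
    then obtain w where "w \<in> Arr C" "Dom C w = Dom C s" "Cod C w = Dom C k" "k \<cdot> w = s"
      using kernel_lift[OF k, of s] s \<phi> by auto
    then show ?thesis using ps qs s t k' bi \<phi> by (intro bexI[of _ w]) auto
  qed
  show thesis by (rule that[OF ee _ _ _ _ sq up]) (use k' bi \<phi> in auto)
qed

text \<open>Arrows \<open>x : T \<rightarrow> A\<close> serve as elements of \<open>A\<close>, and an epimorphism \<open>p\<close> onto \<open>T\<close> as a cover on
  which a preimage has to be found. The following lemmas are the rules of this calculus.\<close>

lemma epic_lift: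
  assumes "epic C f" "x \<in> Arr C" "Cod C x = Cod C f"
  obtains p y where "epic C p" "Cod C p = Dom C x" "y \<in> Arr C" "Dom C y = Dom C p"
    "Cod C y = Dom C f" "f \<cdot> y = x \<cdot> p"
  using pullback_epic[OF assms] by metis

lemma exact_arr:
  assumes "exact C f g"
  shows "f \<in> Arr C" "g \<in> Arr C" "Cod C f = Dom C g" "g \<cdot> f = Zero C (Dom C f) (Cod C g)"
proof -
  obtain c k where c: "is_cokernel C f c" and k: "is_kernel C c k" and g: "is_kernel C g k"
    using assms unfolding exact_def by auto
  note c' = cokernel_arr[OF c] and k' = kernel_arr[OF k] and g' = kernel_arr[OF g]
  obtain e where e: "e \<in> Arr C" "Dom C e = Dom C f" "Cod C e = Dom C k" "k \<cdot> e = f"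
    using kernel_lift[OF k, of f] c' by auto
  have "g \<cdot> (k \<cdot> e) = Zero C (Dom C f) (Cod C g)" using comp_extend'[OF g'(4), of e] g' e by simp
  then show "g \<cdot> f = Zero C (Dom C f) (Cod C g)" unfolding e(4) .
qed (use assms in \<open>auto simp: exact_def\<close>)

lemma exact_lift:
  assumes "exact C f g" "x \<in> Arr C" "Cod C x = Dom C g" "g \<cdot> x = Zero C (Dom C x) (Cod C g)"
  obtains p y where "epic C p" "Cod C p = Dom C x" "y \<in> Arr C" "Dom C y = Dom C p"
    "Cod C y = Dom C f" "f \<cdot> y = x \<cdot> p"
proof -
  obtain c k where c: "is_cokernel C f c" and k: "is_kernel C c k" and g: "is_kernel C g k"
    using assms unfolding exact_def by auto
  note c' = cokernel_arr[OF c] and k' = kernel_arr[OF k] and g' = kernel_arr[OF g]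
  obtain e where e: "epic C e" "Dom C e = Dom C f" "Cod C e = Dom C k" "k \<cdot> e = f"
    using image_factorization[OF c k] .
  obtain u where u: "u \<in> Arr C" "Dom C u = Dom C x" "Cod C u = Dom C k" "k \<cdot> u = x"
    using kernel_lift[OF g, of x] assms by auto
  obtain p y where p: "epic C p" "Cod C p = Dom C u" "y \<in> Arr C" "Dom C y = Dom C p"
    "Cod C y = Dom C e" "e \<cdot> y = u \<cdot> p"
    using epic_lift[OF e(1), of u] u e by auto
  have "f \<cdot> y = x \<cdot> p"
    using comp_extend'[OF e(4), of y] comp_extend'[OF u(4), of p] p u e k' by simp
  then show thesis using that[of p y] p u e by simp
qed

text \<open>Local lifts along \<open>f\<close> of everything killed by \<open>g\<close> show that whatever \<open>g\<close> kills is killed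
  by the cokernel of \<open>f\<close>, and so lies in the image of \<open>f\<close>.\<close>

lemma exactI:
  assumes "f \<in> Arr C" "g \<in> Arr C" "Cod C f = Dom C g" "g \<cdot> f = Zero C (Dom C f) (Cod C g)"
    and "\<And>x. \<lbrakk>x \<in> Arr C; Cod C x = Dom C g; g \<cdot> x = Zero C (Dom C x) (Cod C g)\<rbrakk>
      \<Longrightarrow> \<exists>p y. epic C p \<and> Cod C p = Dom C x \<and> y \<in> Hom C (Dom C p) (Dom C f) \<and> f \<cdot> y = x \<cdot> p"
  shows "exact C f g"
proof -
  obtain c where c: "is_cokernel C f c" using ex_cokernel assms(1) by blast
  note c' = cokernel_arr[OF c]
  obtain k where k: "is_kernel C c k" using ex_kernel c'(2) by blast
  note k' = kernel_arr[OF k]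
  obtain u where u: "u \<in> Arr C" "Dom C u = Cod C c" "Cod C u = Cod C g" "u \<cdot> c = g"
    using cokernel_desc[OF c, of g] assms by auto
  have "is_kernel C g k"
  proof (rule is_kernelI)
    show "g \<cdot> k = Zero C (Dom C k) (Cod C g)" using comp_extend'[OF u(4), of k] u c' k' by simp
    fix x assume x: "x \<in> Arr C" "Cod C x = Dom C g" "g \<cdot> x = Zero C (Dom C x) (Cod C g)"
    obtain p y where p: "epic C p" "Cod C p = Dom C x" "y \<in> Hom C (Dom C p) (Dom C f)" "f \<cdot> y = x \<cdot> p"
      using assms(5)[OF x] by blast
    have "(c \<cdot> x) \<cdot> p = Zero C (Dom C p) (Cod C c)"
      using comp_extend'[OF c'(4), of y] p c' x assms(1-4) by simp
    then have "c \<cdot> x = Zero C (Dom C x) (Cod C c)"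
      using epic_zero[OF p(1), of "c \<cdot> x"] p c' x assms by simp
    then show "\<exists>u. u \<in> Hom C (Dom C x) (Dom C k) \<and> k \<cdot> u = x"
      using kernel_lift[OF k, of x] x c' assms by auto
  qed (use k' c' assms kernel_monic[OF k] in auto)
  then show ?thesis unfolding exact_def using assms c k by blast
qed

lemma exact_cokernel:
  assumes "is_cokernel C f c"
  shows "exact C f c"
proof -
  note c = cokernel_arr[OF assms]
  obtain k where "is_kernel C c k" using ex_kernel c(2) by blast
  then show ?thesis unfolding exact_def using assms c by auto
qed

lemma exact_kernel:
  assumes "is_kernel C f k"
  shows "exact C k f"
proof -
  note k = kernel_arr[OF assms]
  obtain c where "is_cokernel C k c" using ex_cokernel k(2) by blast
  then show ?thesis
    unfolding exact_def using monic_is_kernel[OF kernel_monic[OF assms]] assms k by auto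
qed

text \<open>An epimorphism is a cokernel of its kernel; so a map on the cover \<open>Dom C e\<close> that vanishes
  on whatever \<open>e\<close> kills is induced by a map on the base.\<close>

lemma epic_descend:
  assumes "epic C e" "y \<in> Arr C" "Dom C y = Dom C e"
    and "\<And>t. \<lbrakk>t \<in> Arr C; Cod C t = Dom C e; e \<cdot> t = Zero C (Dom C t) (Cod C e)\<rbrakk>
      \<Longrightarrow> y \<cdot> t = Zero C (Dom C t) (Cod C y)"
  obtains h where "h \<in> Arr C" "Dom C h = Cod C e" "Cod C h = Cod C y" "h \<cdot> e = y"
proof -
  obtain k where k: "is_kernel C e k" using ex_kernel epic_arr[OF assms(1)] by blast
  note k' = kernel_arr[OF k]
  show thesis
    using cokernel_desc[OF epic_is_cokernel[OF assms(1) k], of y] assms(4)[of k] assms(2,3) k' that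
    by auto
qed

text \<open>Local preimages under a monomorphism are unique, so they glue to a global one.\<close>

lemma monic_local_lift:
  assumes "monic C m" "x \<in> Arr C" "Cod C x = Cod C m" "epic C p" "Cod C p = Dom C x"
    "y \<in> Arr C" "Dom C y = Dom C p" "Cod C y = Dom C m" "m \<cdot> y = x \<cdot> p"
  obtains w where "w \<in> Arr C" "Dom C w = Dom C x" "Cod C w = Dom C m" "m \<cdot> w = x"
proof -
  have "y \<cdot> t = Zero C (Dom C t) (Cod C y)"
    if t: "t \<in> Arr C" "Cod C t = Dom C p" "p \<cdot> t = Zero C (Dom C t) (Cod C p)" for t
  proof -
    have "m \<cdot> (y \<cdot> t) = x \<cdot> (p \<cdot> t)" by (rule comp_extend[OF assms(9)]) (use assms t in auto)
    then show ?thesis using monic_zero[OF assms(1), of "y \<cdot> t"] assms t by simp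
  qed
  then obtain h where h: "h \<in> Arr C" "Dom C h = Cod C p" "Cod C h = Cod C y" "h \<cdot> p = y"
    using epic_descend[OF assms(4), of y] assms by auto
  have "m \<cdot> h = x"
    by (rule epic_cancel[OF assms(4)]) (use assms h in auto)
  then show thesis using that[of h] h assms by auto
qed

lemma zero_object_obj: "is_zero_object C (zero_object C)"
  unfolding zero_object_def by (rule someI_ex) (rule ex_zero_object)

end

section \<open>Homology classes of cycles\<close>

definition cycle :: "('o, 'a, 'z) preadd_scheme \<Rightarrow> ('o, 'a) cpx \<Rightarrow> nat \<Rightarrow> 'a \<Rightarrow> bool" where
  "cycle C c n x \<longleftrightarrow> x \<in> Arr C \<and> Cod C x = ch_ob c n \<and>
     (\<forall>m. n = Suc m \<longrightarrow> ch_d c m \<cdot>\<^bsub>C\<^esub> x = Zero C (Dom C x) (ch_ob c m))"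

text \<open>\<open>z\<close> is a universal cycle in degree \<open>n\<close> and \<open>q\<close> its quotient by the boundaries. Boundaries
  are described locally, without an image object, since that is the form in which the condition
  is used in diagram chases and verified for the image of a presentation under an exact functor.\<close>

definition homology_presentation ::
  "('o, 'a, 'z) preadd_scheme \<Rightarrow> ('o, 'a) cpx \<Rightarrow> nat \<Rightarrow> 'a \<Rightarrow> 'a \<Rightarrow> bool" where
  "homology_presentation C c n z q \<longleftrightarrow>
     is_cpx C c \<and> monic C z \<and> epic C q \<and> Dom C q = Dom C z \<and> cycle C c n z \<and>
     (\<forall>x. cycle C c n x \<longrightarrow> (\<exists>y \<in> Hom C (Dom C x) (Dom C z). z \<cdot>\<^bsub>C\<^esub> y = x)) \<and>
     (\<forall>y \<in> Arr C. Cod C y = Dom C z \<longrightarrow>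
        (q \<cdot>\<^bsub>C\<^esub> y = Zero C (Dom C y) (Cod C q) \<longleftrightarrow>
         (\<exists>p w. epic C p \<and> Cod C p = Dom C y \<and> w \<in> Hom C (Dom C p) (ch_ob c (Suc n)) \<and>
                z \<cdot>\<^bsub>C\<^esub> (y \<cdot>\<^bsub>C\<^esub> p) = ch_d c n \<cdot>\<^bsub>C\<^esub> w)))"

text \<open>Meaningful for cycles \<open>x\<close> only: those are the arrows that factor, uniquely, through \<open>z\<close>.\<close>

definition hclass :: "('o, 'a, 'z) cat_scheme \<Rightarrow> 'a \<Rightarrow> 'a \<Rightarrow> 'a \<Rightarrow> 'a" where
  "hclass C z q x = q \<cdot>\<^bsub>C\<^esub> (THE y. y \<in> Hom C (Dom C x) (Dom C z) \<and> z \<cdot>\<^bsub>C\<^esub> y = x)"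

lemma cycle_arr: "cycle C c n x \<Longrightarrow> x \<in> Arr C" "cycle C c n x \<Longrightarrow> Cod C x = ch_ob c n"
  by (auto simp: cycle_def)

context abelian_category
begin

lemma cpx_arr [simp]:
  assumes "is_cpx C c"
  shows "ch_ob c n \<in> Obj C" "ch_d c n \<in> Arr C" "Dom C (ch_d c n) = ch_ob c (Suc n)"
    "Cod C (ch_d c n) = ch_ob c n"
    "ch_d c n \<cdot> ch_d c (Suc n) = Zero C (ch_ob c (Suc (Suc n))) (ch_ob c n)"
  using assms unfolding is_cpx_def by auto

lemma cpx_dd [simp]:
  assumes "is_cpx C c" "w \<in> Arr C" "Cod C w = ch_ob c (Suc (Suc n))"
  shows "ch_d c n \<cdot> (ch_d c (Suc n) \<cdot> w) = Zero C (Dom C w) (ch_ob c n)"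
  using assms by (subst comp_extend'[OF cpx_arr(5)[OF assms(1)]]) auto

lemma cycle_comp:
  assumes "is_cpx C c" "cycle C c n x" "t \<in> Arr C" "Cod C t = Dom C x"
  shows "cycle C c n (x \<cdot> t)"
proof -
  have "ch_d c m \<cdot> (x \<cdot> t) = Zero C (Dom C t) (ch_ob c m)" if "n = Suc m" for m
    using that assms comp_extend'[of "ch_d c m" x "Zero C (Dom C x) (ch_ob c m)" t]
    by (auto simp: cycle_def)
  then show ?thesis using assms by (auto simp: cycle_def)
qed

lemma cycle_sub:
  assumes "is_cpx C c" "cycle C c n x" "cycle C c n y" "Dom C x = Dom C y"
  shows "cycle C c n (sub C x y)"
  using assms by (auto simp: cycle_def comp_sub sub_self)

lemma cycle_boundary:
  assumes "is_cpx C c" "w \<in> Arr C" "Cod C w = ch_ob c (Suc n)"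
  shows "cycle C c n (ch_d c n \<cdot> w)"
  using assms by (auto simp: cycle_def)

lemma hclass_eqI:
  assumes P: "homology_presentation C c n z q"
    and y: "y \<in> Arr C" "Cod C y = Dom C z" "z \<cdot> y = x"
  shows "hclass C z q x = q \<cdot> y"
proof -
  have m: "monic C z" using P by (simp add: homology_presentation_def)
  have x: "Dom C x = Dom C y" using arr_comp(2)[of y z] m y by simp
  have "(THE y. y \<in> Hom C (Dom C x) (Dom C z) \<and> z \<cdot> y = x) = y"
  proof (rule the_equality)
    fix u assume "u \<in> Hom C (Dom C x) (Dom C z) \<and> z \<cdot> u = x"
    then show "u = y" using x y by (intro monic_cancel[OF m, of u y]) auto
  qed (use x y in auto)
  then show ?thesis unfolding hclass_def by simp
qed

lemma presentation_arr:
  assumes "homology_presentation C c n z q"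
  shows "is_cpx C c" "monic C z" "epic C q" "z \<in> Arr C" "q \<in> Arr C" "Dom C q = Dom C z"
    "cycle C c n z" "Cod C z = ch_ob c n"
  using assms by (auto simp: homology_presentation_def dest: cycle_arr)

lemma cycle_lift:
  assumes "homology_presentation C c n z q" "cycle C c n x"
  obtains y where "y \<in> Arr C" "Dom C y = Dom C x" "Cod C y = Dom C z" "z \<cdot> y = x"
  using assms unfolding homology_presentation_def by (metis Hom_iff)

lemma hclass_arr [simp]:
  assumes "homology_presentation C c n z q" "cycle C c n x"
  shows "hclass C z q x \<in> Arr C" "Dom C (hclass C z q x) = Dom C x" "Cod C (hclass C z q x) = Cod C q"
proof -
  obtain y where y: "y \<in> Arr C" "Dom C y = Dom C x" "Cod C y = Dom C z" "z \<cdot> y = x"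
    using cycle_lift[OF assms] .
  note P = presentation_arr[OF assms(1)]
  show "hclass C z q x \<in> Arr C" "Dom C (hclass C z q x) = Dom C x" "Cod C (hclass C z q x) = Cod C q"
    using hclass_eqI[OF assms(1) y(1,3,4)] y P by auto
qed

lemma hclass_universal:
  assumes "homology_presentation C c n z q"
  shows "hclass C z q z = q"
  using hclass_eqI[OF assms, of "Ident C (Dom C z)" z] presentation_arr[OF assms] by simp

lemma hclass_comp:
  assumes "homology_presentation C c n z q" "cycle C c n x" "t \<in> Arr C" "Cod C t = Dom C x"
  shows "hclass C z q (x \<cdot> t) = hclass C z q x \<cdot> t"
proof -
  obtain y where y: "y \<in> Arr C" "Dom C y = Dom C x" "Cod C y = Dom C z" "z \<cdot> y = x"
    using cycle_lift[OF assms(1,2)] .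
  note P = presentation_arr[OF assms(1)]
  show ?thesis
    using hclass_eqI[OF assms(1) y(1,3,4)] hclass_eqI[OF assms(1), of "y \<cdot> t" "x \<cdot> t"]
      comp_extend'[OF y(4), of t] y P assms by auto
qed

lemma hclass_sub:
  assumes "homology_presentation C c n z q" "cycle C c n x" "cycle C c n x'" "Dom C x = Dom C x'"
  shows "hclass C z q (sub C x x') = sub C (hclass C z q x) (hclass C z q x')"
proof -
  obtain y where y: "y \<in> Arr C" "Dom C y = Dom C x" "Cod C y = Dom C z" "z \<cdot> y = x"
    using cycle_lift[OF assms(1,2)] .
  obtain y' where y': "y' \<in> Arr C" "Dom C y' = Dom C x'" "Cod C y' = Dom C z" "z \<cdot> y' = x'"
    using cycle_lift[OF assms(1,3)] .
  note P = presentation_arr[OF assms(1)]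
  show ?thesis
    using hclass_eqI[OF assms(1) y(1,3,4)] hclass_eqI[OF assms(1) y'(1,3,4)]
      hclass_eqI[OF assms(1), of "sub C y y'" "sub C x x'"] y y' P assms by (auto simp: comp_sub)
qed

lemma hclass_boundary:
  assumes "homology_presentation C c n z q" "w \<in> Arr C" "Cod C w = ch_ob c (Suc n)"
  shows "hclass C z q (ch_d c n \<cdot> w) = Zero C (Dom C w) (Cod C q)"
proof -
  note P = presentation_arr[OF assms(1)]
  obtain y where y: "y \<in> Arr C" "Dom C y = Dom C (ch_d c n \<cdot> w)" "Cod C y = Dom C z"
    "z \<cdot> y = ch_d c n \<cdot> w"
    using cycle_lift[OF assms(1) cycle_boundary[OF P(1) assms(2,3)]] .
  have yw: "Dom C y = Dom C w" using y P assms by simp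
  have "q \<cdot> y = Zero C (Dom C y) (Cod C q) \<longleftrightarrow>
         (\<exists>p w. epic C p \<and> Cod C p = Dom C y \<and> w \<in> Hom C (Dom C p) (ch_ob c (Suc n)) \<and>
                z \<cdot> (y \<cdot> p) = ch_d c n \<cdot> w)"
    using assms(1) y unfolding homology_presentation_def by blast
  moreover have "\<exists>p w. epic C p \<and> Cod C p = Dom C y \<and> w \<in> Hom C (Dom C p) (ch_ob c (Suc n)) \<and>
                z \<cdot> (y \<cdot> p) = ch_d c n \<cdot> w"
    using epic_ident[of "Dom C w"] yw y assms
    by (intro exI[of _ "Ident C (Dom C w)"] exI[of _ w]) auto
  ultimately show ?thesis using hclass_eqI[OF assms(1) y(1,3,4)] yw by simp
qed

lemma hclass_zero_boundary:
  assumes "homology_presentation C c n z q" "cycle C c n x"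
    "hclass C z q x = Zero C (Dom C x) (Cod C q)"
  obtains p w where "epic C p" "Cod C p = Dom C x" "w \<in> Arr C" "Dom C w = Dom C p"
    "Cod C w = ch_ob c (Suc n)" "x \<cdot> p = ch_d c n \<cdot> w"
proof -
  note P = presentation_arr[OF assms(1)]
  obtain y where y: "y \<in> Arr C" "Dom C y = Dom C x" "Cod C y = Dom C z" "z \<cdot> y = x"
    using cycle_lift[OF assms(1,2)] .
  have "q \<cdot> y = Zero C (Dom C y) (Cod C q)"
    using hclass_eqI[OF assms(1) y(1,3,4)] y assms by simp
  then obtain p w where p: "epic C p" "Cod C p = Dom C y" "w \<in> Hom C (Dom C p) (ch_ob c (Suc n))"
    "z \<cdot> (y \<cdot> p) = ch_d c n \<cdot> w"
    using assms(1) y unfolding homology_presentation_def by blast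
  then show thesis using that[of p w] y P comp_extend'[OF y(4), of p] by auto
qed

lemma hclass_surjective:
  assumes "homology_presentation C c n z q" "h \<in> Arr C" "Cod C h = Cod C q"
  obtains p x where "epic C p" "Cod C p = Dom C h" "cycle C c n x" "Dom C x = Dom C p"
    "hclass C z q x = h \<cdot> p"
proof -
  note P = presentation_arr[OF assms(1)]
  obtain p y where p: "epic C p" "Cod C p = Dom C h" "y \<in> Arr C" "Dom C y = Dom C p"
    "Cod C y = Dom C q" "q \<cdot> y = h \<cdot> p"
    using epic_lift[OF P(3) assms(2,3)] .
  show thesis
    using that[of p "z \<cdot> y"] p P hclass_eqI[OF assms(1), of y "z \<cdot> y"] cycle_comp[OF P(1,7), of y]
    by auto
qed

lemma chmap_arr [simp]:
  assumes "is_chmap C h"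
  shows "is_cpx C (ch_dom h)" "is_cpx C (ch_cod h)" "ch_map h n \<in> Arr C"
    "Dom C (ch_map h n) = ch_ob (ch_dom h) n" "Cod C (ch_map h n) = ch_ob (ch_cod h) n"
  using assms unfolding is_chmap_def by auto

lemma chmap_natural:
  assumes "is_chmap C h" "x \<in> Arr C" "Cod C x = ch_ob (ch_dom h) (Suc n)"
  shows "ch_d (ch_cod h) n \<cdot> (ch_map h (Suc n) \<cdot> x) = ch_map h n \<cdot> (ch_d (ch_dom h) n \<cdot> x)"
proof (rule comp_extend)
  show "ch_d (ch_cod h) n \<cdot> ch_map h (Suc n) = ch_map h n \<cdot> ch_d (ch_dom h) n"
    using assms(1) by (simp only: is_chmap_def)
qed (use assms in auto)

lemma cycle_chmap:
  assumes "is_chmap C h" "cycle C (ch_dom h) n x"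
  shows "cycle C (ch_cod h) n (ch_map h n \<cdot> x)"
  using assms chmap_natural[OF assms(1), of x] by (auto simp: cycle_def)

text \<open>A degreewise monic chain map detects cycles because it detects vanishing of the
  differential.\<close>

lemma cycle_reflect:
  assumes "is_chmap C h" "\<And>n. monic C (ch_map h n)" "x \<in> Arr C" "Cod C x = ch_ob (ch_dom h) n"
    "cycle C (ch_cod h) n (ch_map h n \<cdot> x)"
  shows "cycle C (ch_dom h) n x"
proof -
  have "ch_d (ch_dom h) m \<cdot> x = Zero C (Dom C x) (ch_ob (ch_dom h) m)" if m: "n = Suc m" for m
  proof -
    have "ch_map h m \<cdot> (ch_d (ch_dom h) m \<cdot> x) = Zero C (Dom C x) (ch_ob (ch_cod h) m)"
      using assms m chmap_natural[OF assms(1), of x m] unfolding cycle_def by auto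
    then show ?thesis using monic_zero[OF assms(2)[of m], of "ch_d (ch_dom h) m \<cdot> x"] assms m by simp
  qed
  then show ?thesis using assms unfolding cycle_def by auto
qed

text \<open>The image of the universal cycle \<open>z\<close> is a cycle and lifts to \<open>\<zeta>\<close>; the class of this lift
  vanishes on boundaries since a chain map preserves them, so it descends along \<open>q\<close>.\<close>

lemma induced_hclass:
  assumes h: "is_chmap C h" and P: "homology_presentation C (ch_dom h) n z q"
    and P': "homology_presentation C (ch_cod h) n z' q'"
  shows "induced C z q z' q' (ch_map h n) \<in> Hom C (Cod C q) (Cod C q')"
    and "cycle C (ch_dom h) n x \<Longrightarrow>
      induced C z q z' q' (ch_map h n) \<cdot> hclass C z q x = hclass C z' q' (ch_map h n \<cdot> x)"
proof -
  note p = presentation_arr[OF P] and p' = presentation_arr[OF P']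
  let ?a = "ch_map h n"
  have cyc: "cycle C (ch_cod h) n (?a \<cdot> z)" by (rule cycle_chmap[OF h p(7)])
  obtain \<zeta> where z: "\<zeta> \<in> Arr C" "Dom C \<zeta> = Dom C (?a \<cdot> z)" "Cod C \<zeta> = Dom C z'" "z' \<cdot> \<zeta> = ?a \<cdot> z"
    using cycle_lift[OF P' cyc] .
  have zd: "Dom C \<zeta> = Dom C z" using z p h by simp
  have kill: "(q' \<cdot> \<zeta>) \<cdot> t = Zero C (Dom C t) (Cod C (q' \<cdot> \<zeta>))"
    if t: "t \<in> Arr C" "Cod C t = Dom C q" "q \<cdot> t = Zero C (Dom C t) (Cod C q)" for t
  proof -
    have ct: "cycle C (ch_dom h) n (z \<cdot> t)" using cycle_comp[OF p(1,7)] t p by simp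
    have "hclass C z q (z \<cdot> t) = Zero C (Dom C (z \<cdot> t)) (Cod C q)"
      using hclass_eqI[OF P, of t] t p by simp
    then obtain r w where r: "epic C r" "Cod C r = Dom C (z \<cdot> t)" "w \<in> Arr C" "Dom C w = Dom C r"
      "Cod C w = ch_ob (ch_dom h) (Suc n)" "(z \<cdot> t) \<cdot> r = ch_d (ch_dom h) n \<cdot> w"
      using hclass_zero_boundary[OF P ct] by blast
    have r2: "Cod C r = Dom C t" using r t p by simp
    have e1: "z' \<cdot> (\<zeta> \<cdot> (t \<cdot> r)) = ?a \<cdot> (z \<cdot> (t \<cdot> r))"
      using comp_extend[OF z(4), of "t \<cdot> r"] z zd p p' h t r(1-5) r2 by simp
    have e2: "z \<cdot> (t \<cdot> r) = ch_d (ch_dom h) n \<cdot> w" using r(6) t r(1) r2 p by simp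
    have eq: "z' \<cdot> (\<zeta> \<cdot> (t \<cdot> r)) = ch_d (ch_cod h) n \<cdot> (ch_map h (Suc n) \<cdot> w)"
      unfolding e1 e2 using chmap_natural[OF h, of w n] r by simp
    have "q' \<cdot> (\<zeta> \<cdot> (t \<cdot> r)) = Zero C (Dom C w) (Cod C q')"
      using hclass_eqI[OF P' _ _ eq] hclass_boundary[OF P', of "ch_map h (Suc n) \<cdot> w"]
         z zd p p' h t r r2 by simp
    then show ?thesis
      using epic_zero[OF r(1), of "q' \<cdot> (\<zeta> \<cdot> t)"] z zd p p' h t r r2 by simp
  qed
  obtain b where b: "b \<in> Arr C" "Dom C b = Cod C q" "Cod C b = Cod C (q' \<cdot> \<zeta>)" "b \<cdot> q = q' \<cdot> \<zeta>"
  proof (rule epic_descend[OF p(3), of "q' \<cdot> \<zeta>"])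
    show "q' \<cdot> \<zeta> \<in> Arr C" "Dom C (q' \<cdot> \<zeta>) = Dom C q" using z zd p p' by simp_all
  qed (use kill that in blast)+
  have ind: "induced C z q z' q' ?a = b"
    unfolding induced_def
  proof (rule the_equality)
    show "b \<in> Hom C (Cod C q) (Cod C q') \<and>
     (\<exists>\<zeta> \<in> Hom C (Dom C z) (Dom C z'). z' \<cdot>\<^bsub>C\<^esub> \<zeta> = ?a \<cdot>\<^bsub>C\<^esub> z \<and> b \<cdot>\<^bsub>C\<^esub> q = q' \<cdot>\<^bsub>C\<^esub> \<zeta>)"
      using b z zd p p' by auto
    fix b' assume b': "b' \<in> Hom C (Cod C q) (Cod C q') \<and>
     (\<exists>\<zeta> \<in> Hom C (Dom C z) (Dom C z'). z' \<cdot>\<^bsub>C\<^esub> \<zeta> = ?a \<cdot>\<^bsub>C\<^esub> z \<and> b' \<cdot>\<^bsub>C\<^esub> q = q' \<cdot>\<^bsub>C\<^esub> \<zeta>)"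
    then obtain \<zeta>' where z': "\<zeta>' \<in> Hom C (Dom C z) (Dom C z')" "z' \<cdot> \<zeta>' = ?a \<cdot> z" "b' \<cdot> q = q' \<cdot> \<zeta>'"
      by blast
    have "\<zeta>' = \<zeta>" by (rule monic_cancel[OF p'(2)]) (use z z' zd in auto)
    then show "b' = b" by (intro epic_cancel[OF p(3), of b' b]) (use b b' z z' zd p p' in auto)
  qed
  show "induced C z q z' q' ?a \<in> Hom C (Cod C q) (Cod C q')"
    unfolding ind using b z p p' by simp
  assume x: "cycle C (ch_dom h) n x"
  obtain y where y: "y \<in> Arr C" "Dom C y = Dom C x" "Cod C y = Dom C z" "z \<cdot> y = x"
    using cycle_lift[OF P x] .
  have e: "z' \<cdot> (\<zeta> \<cdot> y) = ?a \<cdot> x"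
    using comp_extend[OF z(4), of y] z zd p p' h y by simp
  have e2: "b \<cdot> (q \<cdot> y) = q' \<cdot> (\<zeta> \<cdot> y)"
    by (rule comp_extend[OF b(4)]) (use b z zd p p' y in auto)
  show "induced C z q z' q' ?a \<cdot> hclass C z q x = hclass C z' q' (?a \<cdot> x)"
    unfolding ind hclass_eqI[OF P y(1,3,4)]
    using hclass_eqI[OF P' _ _ e] e2 z zd p p' h y by simp
qed

end

section \<open>The long exact homology sequence\<close>

text \<open>\<open>0 \<rightarrow> P \<rightarrow> Q \<rightarrow> R \<rightarrow> 0\<close> with maps \<open>i\<close> and \<open>j\<close>, exact in every degree, where \<open>P\<close>, \<open>Q\<close> and \<open>R\<close>
  are the complexes \<open>ch_dom i\<close>, \<open>ch_dom j\<close> and \<open>ch_cod j\<close>. All three homologies have arbitrary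
  presentations, which is needed for \<open>P\<close>: there the presentation will be the image of one in
  another abelian category.\<close>

locale short_exact_complexes = abelian_category C
  for C :: "('o, 'a, 'z) preadd_scheme" (structure) +
  fixes i j :: "('o, 'a) chmap"
    and zP qP zQ qQ zR qR :: "nat \<Rightarrow> 'a"
  assumes chmap_i: "is_chmap C i" and chmap_j: "is_chmap C j"
    and middle: "ch_cod i = ch_dom j"
    and monic_i: "monic C (ch_map i n)"
    and exact_ij: "exact C (ch_map i n) (ch_map j n)"
    and epic_j: "epic C (ch_map j n)"
    and P: "homology_presentation C (ch_dom i) n (zP n) (qP n)"
    and Q: "homology_presentation C (ch_dom j) n (zQ n) (qQ n)"
    and R: "homology_presentation C (ch_cod j) n (zR n) (qR n)"
begin

abbreviation "clP n x \<equiv> hclass C (zP n) (qP n) x"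
abbreviation "clQ n x \<equiv> hclass C (zQ n) (qQ n) x"
abbreviation "clR n x \<equiv> hclass C (zR n) (qR n) x"
abbreviation "dP n \<equiv> ch_d (ch_dom i) n"
abbreviation "dQ n \<equiv> ch_d (ch_dom j) n"
abbreviation "dR n \<equiv> ch_d (ch_cod j) n"

abbreviation "Hi n \<equiv> induced C (zP n) (qP n) (zQ n) (qQ n) (ch_map i n)"
abbreviation "Hj n \<equiv> induced C (zQ n) (qQ n) (zR n) (qR n) (ch_map j n)"

lemma cpxs [simp]: "is_cpx C (ch_dom i)" "is_cpx C (ch_dom j)" "is_cpx C (ch_cod j)"
  using chmap_i chmap_j by auto

lemma i_arr [simp]:
  "ch_map i n \<in> Arr C" "Dom C (ch_map i n) = ch_ob (ch_dom i) n"
  "Cod C (ch_map i n) = ch_ob (ch_dom j) n"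
  using chmap_i middle by auto

lemma j_arr [simp]:
  "ch_map j n \<in> Arr C" "Dom C (ch_map j n) = ch_ob (ch_dom j) n"
  "Cod C (ch_map j n) = ch_ob (ch_cod j) n"
  using chmap_j by auto

lemma i_natural:
  assumes "x \<in> Arr C" "Cod C x = ch_ob (ch_dom i) (Suc n)"
  shows "ch_map i n \<cdot> (dP n \<cdot> x) = dQ n \<cdot> (ch_map i (Suc n) \<cdot> x)"
  using chmap_natural[OF chmap_i assms] middle by simp

lemma j_natural:
  assumes "x \<in> Arr C" "Cod C x = ch_ob (ch_dom j) (Suc n)"
  shows "ch_map j n \<cdot> (dQ n \<cdot> x) = dR n \<cdot> (ch_map j (Suc n) \<cdot> x)"
  using chmap_natural[OF chmap_j assms] by simp

lemma j_i [simp]: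
  assumes "x \<in> Arr C" "Cod C x = ch_ob (ch_dom i) n"
  shows "ch_map j n \<cdot> (ch_map i n \<cdot> x) = Zero C (Dom C x) (ch_ob (ch_cod j) n)"
  using comp_extend'[OF exact_arr(4)[OF exact_ij[of n]], of x] assms by simp

text \<open>\<open>P\<close> is the kernel of \<open>Q \<rightarrow> R\<close>: exactness gives local preimages, which glue because \<open>i\<close> is
  monic.\<close>

lemma i_lift:
  assumes "x \<in> Arr C" "Cod C x = ch_ob (ch_dom j) n"
    "ch_map j n \<cdot> x = Zero C (Dom C x) (ch_ob (ch_cod j) n)"
  obtains w where "w \<in> Arr C" "Dom C w = Dom C x" "Cod C w = ch_ob (ch_dom i) n" "ch_map i n \<cdot> w = x"
proof -
  obtain p y where p: "epic C p" "Cod C p = Dom C x" "y \<in> Arr C" "Dom C y = Dom C p"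
    "Cod C y = Dom C (ch_map i n)" "ch_map i n \<cdot> y = x \<cdot> p"
    using exact_lift[OF exact_ij, of x n] assms by auto
  show thesis
    by (rule monic_local_lift[OF monic_i, of x n p y]) (use p assms that in auto)
qed

lemma cycle_i: "cycle C (ch_dom i) n x \<Longrightarrow> cycle C (ch_dom j) n (ch_map i n \<cdot> x)"
  using cycle_chmap[OF chmap_i] middle by simp

lemma cycle_j: "cycle C (ch_dom j) n x \<Longrightarrow> cycle C (ch_cod j) n (ch_map j n \<cdot> x)"
  using cycle_chmap[OF chmap_j] by simp

lemma cycle_i_reflect:
  assumes "x \<in> Arr C" "Cod C x = ch_ob (ch_dom i) n" "cycle C (ch_dom j) n (ch_map i n \<cdot> x)"
  shows "cycle C (ch_dom i) n x"
  using cycle_reflect[OF chmap_i monic_i] assms middle by simp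

lemma Hi_arr [simp]: "Hi n \<in> Arr C" "Dom C (Hi n) = Cod C (qP n)" "Cod C (Hi n) = Cod C (qQ n)"
  and Hi_class: "cycle C (ch_dom i) n x \<Longrightarrow> Hi n \<cdot> clP n x = clQ n (ch_map i n \<cdot> x)"
  using induced_hclass[OF chmap_i P[of n], of "zQ n" "qQ n"] Q[of n] middle by auto

lemma Hj_arr [simp]: "Hj n \<in> Arr C" "Dom C (Hj n) = Cod C (qQ n)" "Cod C (Hj n) = Cod C (qR n)"
  and Hj_class: "cycle C (ch_dom j) n x \<Longrightarrow> Hj n \<cdot> clQ n x = clR n (ch_map j n \<cdot> x)"
  using induced_hclass[OF chmap_j Q[of n] R[of n]] by auto

text \<open>The graph of the connecting map on representatives: it sends the class of \<open>j \<cdot> l\<close> to that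
  of \<open>m\<close>.\<close>

definition zigzag :: "nat \<Rightarrow> 'a \<Rightarrow> 'a \<Rightarrow> bool" where
  "zigzag n l m \<longleftrightarrow> l \<in> Arr C \<and> Cod C l = ch_ob (ch_dom j) (Suc n) \<and>
     m \<in> Arr C \<and> Cod C m = ch_ob (ch_dom i) n \<and> Dom C m = Dom C l \<and>
     ch_map i n \<cdot> m = dQ n \<cdot> l"

lemma zigzag_cycles:
  assumes "zigzag n l m"
  shows "cycle C (ch_dom i) n m" "cycle C (ch_cod j) (Suc n) (ch_map j (Suc n) \<cdot> l)"
proof -
  have a: "l \<in> Arr C" "Cod C l = ch_ob (ch_dom j) (Suc n)" "m \<in> Arr C" "Cod C m = ch_ob (ch_dom i) n"
    "Dom C m = Dom C l" "ch_map i n \<cdot> m = dQ n \<cdot> l"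
    using assms by (auto simp: zigzag_def)
  show "cycle C (ch_dom i) n m"
    by (rule cycle_i_reflect) (use a cycle_boundary[of "ch_dom j" l n] in auto)
  have "dR n \<cdot> (ch_map j (Suc n) \<cdot> l) = Zero C (Dom C l) (ch_ob (ch_cod j) n)"
    using j_natural[of l n] a j_i[of m n] by simp
  then show "cycle C (ch_cod j) (Suc n) (ch_map j (Suc n) \<cdot> l)"
    using a by (auto simp: cycle_def)
qed

lemma zigzag_exists:
  assumes "cycle C (ch_cod j) (Suc n) (ch_map j (Suc n) \<cdot> l)" "l \<in> Arr C"
    "Cod C l = ch_ob (ch_dom j) (Suc n)"
  obtains m where "zigzag n l m"
proof -
  have "ch_map j n \<cdot> (dQ n \<cdot> l) = Zero C (Dom C l) (ch_ob (ch_cod j) n)"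
    using assms j_natural[of l n] by (auto simp: cycle_def)
  then obtain m where "m \<in> Arr C" "Dom C m = Dom C (dQ n \<cdot> l)" "Cod C m = ch_ob (ch_dom i) n"
    "ch_map i n \<cdot> m = dQ n \<cdot> l"
    using i_lift[of "dQ n \<cdot> l" n] assms by auto
  then show thesis using that[of m] assms by (auto simp: zigzag_def)
qed

text \<open>Independence of the connecting map from all choices. If \<open>j l\<close> is locally a boundary \<open>d w\<close>,
  lift \<open>w\<close> locally to \<open>u\<close> in \<open>Q\<close>. Then \<open>l - d u\<close> comes from some \<open>v\<close> in \<open>P\<close>, and \<open>i m = d l = d
  (l - d u) = i (d v)\<close>, so \<open>m\<close> is locally the boundary of \<open>v\<close>.\<close>

lemma zigzag_null:
  assumes "zigzag n l m" "clR (Suc n) (ch_map j (Suc n) \<cdot> l) = Zero C (Dom C l) (Cod C (qR (Suc n)))"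
  shows "clP n m = Zero C (Dom C l) (Cod C (qP n))"
proof -
  have a: "l \<in> Arr C" "Cod C l = ch_ob (ch_dom j) (Suc n)" "m \<in> Arr C" "Cod C m = ch_ob (ch_dom i) n"
    "Dom C m = Dom C l" "ch_map i n \<cdot> m = dQ n \<cdot> l"
    using assms by (auto simp: zigzag_def)
  note cyc = zigzag_cycles[OF assms(1)]
  obtain p w where p: "epic C p" "Cod C p = Dom C (ch_map j (Suc n) \<cdot> l)" "w \<in> Arr C"
    "Dom C w = Dom C p" "Cod C w = ch_ob (ch_cod j) (Suc (Suc n))"
    "(ch_map j (Suc n) \<cdot> l) \<cdot> p = dR (Suc n) \<cdot> w"
    using hclass_zero_boundary[OF R cyc(2)] assms(2) a by auto
  obtain r u where r: "epic C r" "Cod C r = Dom C w" "u \<in> Arr C" "Dom C u = Dom C r"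
    "Cod C u = Dom C (ch_map j (Suc (Suc n)))" "ch_map j (Suc (Suc n)) \<cdot> u = w \<cdot> r"
    using epic_lift[OF epic_j, of w "Suc (Suc n)"] p by auto
  define s where "s = p \<cdot> r"
  have s: "epic C s" "s \<in> Arr C" "Cod C s = Dom C l" "Dom C s = Dom C u"
    using epic_comp[OF p(1) r(1)] p r a by (auto simp: s_def)
  have jl: "ch_map j (Suc n) \<cdot> (l \<cdot> s) = ch_map j (Suc n) \<cdot> (dQ (Suc n) \<cdot> u)"
    using comp_extend[OF p(6), of r] p(1-5) r a j_natural[of u "Suc n"] by (simp add: s_def)
  define l' where "l' = sub C (l \<cdot> s) (dQ (Suc n) \<cdot> u)"
  have l': "l' \<in> Arr C" "Dom C l' = Dom C u" "Cod C l' = ch_ob (ch_dom j) (Suc n)"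
    using s r a by (auto simp: l'_def)
  have jl': "ch_map j (Suc n) \<cdot> l' = Zero C (Dom C l') (ch_ob (ch_cod j) (Suc n))"
    using jl s r a l' by (simp add: l'_def comp_sub sub_self)
  obtain v where v: "v \<in> Arr C" "Dom C v = Dom C l'" "Cod C v = ch_ob (ch_dom i) (Suc n)"
    "ch_map i (Suc n) \<cdot> v = l'"
    using i_lift[OF l'(1) l'(3) jl'] .
  have "ch_map i n \<cdot> (m \<cdot> s) = dQ n \<cdot> (l \<cdot> s)"
    by (rule comp_extend[OF a(6)]) (use a s in auto)
  also have "\<dots> = dQ n \<cdot> l'"
    using s r a by (simp add: l'_def comp_sub sub_zero)
  also have "\<dots> = ch_map i n \<cdot> (dP n \<cdot> v)" using i_natural[of v n] v by simp
  finally have ms: "m \<cdot> s = dP n \<cdot> v"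
    by (rule monic_cancel[OF monic_i]) (use a s v l' in auto)
  have "clP n m \<cdot> s = Zero C (Dom C s) (Cod C (qP n))"
    using hclass_comp[OF P cyc(1), of s] hclass_boundary[OF P, of v n] ms a s v l' by simp
  then show ?thesis
    using epic_zero[OF s(1), of "clP n m"] a s hclass_arr[OF P cyc(1)] by simp
qed

text \<open>Pulling the universal cycle \<open>zR\<close> back along \<open>j\<close> gives the universal zigzag \<open>(l, m)\<close>: every
  zigzag is of the form \<open>(l \<cdot> t, m \<cdot> t)\<close>. The class of \<open>m\<close> descends to the homology of \<open>R\<close> by
  \<open>zigzag_null\<close>, and its value on any zigzag is then obtained by restriction along \<open>t\<close>.\<close>

lemma connecting_exists:
  "\<exists>\<delta>. \<delta> \<in> Hom C (Cod C (qR (Suc n))) (Cod C (qP n)) \<and>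
     (\<forall>l m. zigzag n l m \<longrightarrow> \<delta> \<cdot> clR (Suc n) (ch_map j (Suc n) \<cdot> l) = clP n m)"
proof -
  let ?N = "Suc n"
  note r = presentation_arr[OF R[of ?N]] note p = presentation_arr[OF P[of n]]
  obtain e l where e: "epic C e" "Cod C e = Dom C (zR ?N)" "l \<in> Arr C" "Dom C l = Dom C e"
    "Cod C l = Dom C (ch_map j ?N)" "ch_map j ?N \<cdot> l = zR ?N \<cdot> e"
    and univ: "\<And>t u. \<lbrakk>t \<in> Arr C; u \<in> Arr C; Dom C t = Dom C u; Cod C t = Dom C (zR ?N);
       Cod C u = Dom C (ch_map j ?N); ch_map j ?N \<cdot> u = zR ?N \<cdot> t\<rbrakk>
       \<Longrightarrow> \<exists>w \<in> Hom C (Dom C t) (Dom C e). e \<cdot> w = t \<and> l \<cdot> w = u"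
    by (rule pullback_epic[OF epic_j[of ?N] r(4)]) (use r in auto)
  have cze: "cycle C (ch_cod j) ?N (zR ?N \<cdot> e)" using cycle_comp[OF r(1,7)] e by simp
  obtain m where zz: "zigzag n l m"
    by (rule zigzag_exists[of n l]) (use e cze in auto)
  have m: "m \<in> Arr C" "Cod C m = ch_ob (ch_dom i) n" "Dom C m = Dom C l" "ch_map i n \<cdot> m = dQ n \<cdot> l"
    using zz by (auto simp: zigzag_def)
  note cyc = zigzag_cycles[OF zz]
  have qe: "clR ?N (ch_map j ?N \<cdot> l) = qR ?N \<cdot> e"
    unfolding e(6) by (rule hclass_eqI[OF R]) (use e in auto)
  have zzt: "zigzag n (l \<cdot> t) (m \<cdot> t)" if t: "t \<in> Arr C" "Cod C t = Dom C l" for t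
    using comp_extend[OF m(4), of t] e m t by (simp add: zigzag_def)
  have qet: "clR ?N (ch_map j ?N \<cdot> (l \<cdot> t)) = (qR ?N \<cdot> e) \<cdot> t" if t: "t \<in> Arr C" "Cod C t = Dom C l" for t
    using hclass_comp[OF R cyc(2), of t] t e(1-5) qe by simp
  have qme: "clP n (m \<cdot> t) = clP n m \<cdot> t" if t: "t \<in> Arr C" "Cod C t = Dom C l" for t
    using hclass_comp[OF P cyc(1), of t] t m by simp
  have epi: "epic C (qR ?N \<cdot> e)" using epic_comp[OF r(3) e(1)] e r by simp
  have kill: "clP n m \<cdot> t = Zero C (Dom C t) (Cod C (clP n m))"
    if t: "t \<in> Arr C" "Cod C t = Dom C (qR ?N \<cdot> e)" "(qR ?N \<cdot> e) \<cdot> t = Zero C (Dom C t) (Cod C (qR ?N \<cdot> e))"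
    for t
  proof -
    have tl: "Cod C t = Dom C l" using t e r by simp
    have "clR ?N (ch_map j ?N \<cdot> (l \<cdot> t)) = Zero C (Dom C (l \<cdot> t)) (Cod C (qR ?N))"
      using qet[OF t(1) tl] t e tl r by simp
    then show ?thesis
      using zigzag_null[OF zzt[OF t(1) tl]] qme[OF t(1) tl] t e tl hclass_arr[OF P cyc(1)] by simp
  qed
  obtain \<delta> where d: "\<delta> \<in> Arr C" "Dom C \<delta> = Cod C (qR ?N \<cdot> e)" "Cod C \<delta> = Cod C (clP n m)"
    "\<delta> \<cdot> (qR ?N \<cdot> e) = clP n m"
    by (rule epic_descend[OF epi hclass_arr(1)[OF P cyc(1)]])
      (use kill hclass_arr[OF P cyc(1)] e r m in auto)
  have "\<delta> \<cdot> clR ?N (ch_map j ?N \<cdot> l') = clP n m'" if z': "zigzag n l' m'" for l' m'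
  proof -
    have a: "l' \<in> Arr C" "Cod C l' = ch_ob (ch_dom j) ?N" "m' \<in> Arr C" "Cod C m' = ch_ob (ch_dom i) n"
      "Dom C m' = Dom C l'" "ch_map i n \<cdot> m' = dQ n \<cdot> l'"
      using z' by (auto simp: zigzag_def)
    obtain y where y: "y \<in> Arr C" "Dom C y = Dom C (ch_map j ?N \<cdot> l')" "Cod C y = Dom C (zR ?N)"
      "zR ?N \<cdot> y = ch_map j ?N \<cdot> l'"
      using cycle_lift[OF R zigzag_cycles(2)[OF z']] .
    have "\<exists>t \<in> Hom C (Dom C y) (Dom C e). e \<cdot> t = y \<and> l \<cdot> t = l'"
      by (rule univ) (use y a(1,2) in simp_all)
    then obtain t where t: "t \<in> Hom C (Dom C y) (Dom C e)" "e \<cdot> t = y" "l \<cdot> t = l'" by blast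
    have tl: "t \<in> Arr C" "Cod C t = Dom C l" using t e by auto
    have imt: "ch_map i n \<cdot> (m \<cdot> t) = ch_map i n \<cdot> m'"
      using comp_extend[OF m(4), of t] e m t tl a by simp
    have td: "Dom C t = Dom C l'" using t y a by simp
    have m': "m \<cdot> t = m'"
      by (rule monic_cancel[OF monic_i imt]) (use a(1-5) m(1-3) tl td in simp_all)
    show ?thesis
      using qet[OF tl] qme[OF tl] comp_extend'[OF d(4), of t] d(1-3) t m' tl e(1-5) r by simp
  qed
  then show ?thesis using d e r hclass_arr[OF P cyc(1)] by (intro exI[of _ \<delta>]) auto
qed

definition connecting :: "nat \<Rightarrow> 'a" where
  "connecting n = (SOME \<delta>. \<delta> \<in> Hom C (Cod C (qR (Suc n))) (Cod C (qP n)) \<and>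
     (\<forall>l m. zigzag n l m \<longrightarrow> \<delta> \<cdot> clR (Suc n) (ch_map j (Suc n) \<cdot> l) = clP n m))"

lemma connecting_arr [simp]:
  "connecting n \<in> Arr C" "Dom C (connecting n) = Cod C (qR (Suc n))" "Cod C (connecting n) = Cod C (qP n)"
  and connecting_class:
  "zigzag n l m \<Longrightarrow> connecting n \<cdot> clR (Suc n) (ch_map j (Suc n) \<cdot> l) = clP n m"
  using someI_ex[OF connecting_exists[of n]] unfolding connecting_def[symmetric] by auto


text \<open>If the class of \<open>y\<close> dies in \<open>R\<close>, then locally \<open>j y = d w\<close> with \<open>w = j u\<close>, so \<open>y - d u\<close> has
  the same class as \<open>y\<close> and comes from a cycle \<open>a\<close> of \<open>P\<close>.\<close>

lemma exact_Hi_Hj: "exact C (Hi n) (Hj n)"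
proof (rule exactI)
  note p = presentation_arr[OF P[of n]] and q = presentation_arr[OF Q[of n]]
    and r = presentation_arr[OF R[of n]]
  have "(Hj n \<cdot> Hi n) \<cdot> qP n = Zero C (Dom C (qP n)) (Cod C (qR n))"
  proof -
    have "Hi n \<cdot> qP n = clQ n (ch_map i n \<cdot> zP n)"
      using Hi_class[OF p(7)] hclass_universal[OF P] by simp
    moreover have "Hj n \<cdot> clQ n (ch_map i n \<cdot> zP n) = clR n (ch_map j n \<cdot> (ch_map i n \<cdot> zP n))"
      by (rule Hj_class[OF cycle_i[OF p(7)]])
    moreover have "clR n (ch_map j n \<cdot> (ch_map i n \<cdot> zP n)) = Zero C (Dom C (zP n)) (Cod C (qR n))"
      using hclass_eqI[OF R, of "Zero C (Dom C (zP n)) (Dom C (zR n))" n] p r by simp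
    ultimately show ?thesis using p q r by simp
  qed
  then show "Hj n \<cdot> Hi n = Zero C (Dom C (Hi n)) (Cod C (Hj n))"
    using epic_zero[OF p(3), of "Hj n \<cdot> Hi n"] p by simp
  fix x assume x: "x \<in> Arr C" "Cod C x = Dom C (Hj n)" "Hj n \<cdot> x = Zero C (Dom C x) (Cod C (Hj n))"
  obtain s y where s: "epic C s" "Cod C s = Dom C x" "cycle C (ch_dom j) n y" "Dom C y = Dom C s"
    "clQ n y = x \<cdot> s"
    by (rule hclass_surjective[OF Q[of n] x(1)]) (use x in auto)
  note y = cycle_arr[OF s(3)] and jy = cycle_j[OF s(3)]
  have "clR n (ch_map j n \<cdot> y) = Zero C (Dom C (ch_map j n \<cdot> y)) (Cod C (qR n))"
    using Hj_class[OF s(3)] comp_extend'[OF x(3), of s] s x y r(5) by simp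
  then obtain t w where t: "epic C t" "Cod C t = Dom C (ch_map j n \<cdot> y)" "w \<in> Arr C" "Dom C w = Dom C t"
    "Cod C w = ch_ob (ch_cod j) (Suc n)" "(ch_map j n \<cdot> y) \<cdot> t = dR n \<cdot> w"
    using hclass_zero_boundary[OF R jy] by blast
  obtain v u where v: "epic C v" "Cod C v = Dom C w" "u \<in> Arr C" "Dom C u = Dom C v"
    "Cod C u = Dom C (ch_map j (Suc n))" "ch_map j (Suc n) \<cdot> u = w \<cdot> v"
    by (rule epic_lift[OF epic_j[of "Suc n"] t(3)]) (use t in auto)
  define k where "k = t \<cdot> v"
  have ty: "Cod C t = Dom C y" using t y by simp
  have k: "epic C k" "k \<in> Arr C" "Cod C k = Dom C y" "Dom C k = Dom C u"
    using epic_comp[OF t(1) v(1)] t v ty by (simp_all add: k_def)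
  have jyk: "ch_map j n \<cdot> (y \<cdot> k) = ch_map j n \<cdot> (dQ n \<cdot> u)"
    using comp_extend[OF t(6), of v] t(1-5) v y j_natural[of u n] ty by (simp add: k_def)
  define y' where "y' = sub C (y \<cdot> k) (dQ n \<cdot> u)"
  have cy: "cycle C (ch_dom j) n (y \<cdot> k)" using cycle_comp[OF _ s(3) k(2,3)] by simp
  have cu: "cycle C (ch_dom j) n (dQ n \<cdot> u)" using cycle_boundary[of "ch_dom j" u n] v by simp
  have du: "Dom C (y \<cdot> k) = Dom C (dQ n \<cdot> u)" using k y v by simp
  have cy': "cycle C (ch_dom j) n y'" unfolding y'_def by (rule cycle_sub[OF _ cy cu du]) simp
  have y': "y' \<in> Arr C" "Cod C y' = ch_ob (ch_dom j) n" "Dom C y' = Dom C u"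
    using k v y by (simp_all add: y'_def)
  have "ch_map j n \<cdot> y' = Zero C (Dom C y') (ch_ob (ch_cod j) n)"
    using jyk k v y by (simp add: y'_def comp_sub sub_self)
  then obtain a where a: "a \<in> Arr C" "Dom C a = Dom C y'" "Cod C a = ch_ob (ch_dom i) n"
    "ch_map i n \<cdot> a = y'"
    using i_lift[OF y'(1,2)] by blast
  have ca: "cycle C (ch_dom i) n a" by (rule cycle_i_reflect) (use a cy' in auto)
  have "clQ n y' = sub C (clQ n (y \<cdot> k)) (Zero C (Dom C u) (Cod C (qQ n)))"
    unfolding y'_def hclass_sub[OF Q cy cu du] using hclass_boundary[OF Q, of u n] v by simp
  also have "\<dots> = clQ n (y \<cdot> k)"
    by (rule sub_zero) (use hclass_arr[OF Q cy] k y in auto)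
  also have "\<dots> = (x \<cdot> s) \<cdot> k" using hclass_comp[OF Q s(3) k(2,3)] s by simp
  finally have "Hi n \<cdot> clP n a = x \<cdot> (s \<cdot> k)"
    using Hi_class[OF ca] a x s k y by simp
  then show "\<exists>p y. epic C p \<and> Cod C p = Dom C x \<and> y \<in> Hom C (Dom C p) (Dom C (Hi n)) \<and> Hi n \<cdot> y = x \<cdot> p"
    using epic_comp[OF s(1) k(1)] s k a y' hclass_arr[OF P ca]
    by (intro exI[of _ "s \<cdot> k"] exI[of _ "clP n a"]) simp
qed simp_all

text \<open>A cycle of \<open>Q\<close> together with zero is a zigzag, which gives the vanishing of the composite.
  If the class of \<open>y = j l\<close> is sent to zero, then \<open>m\<close> is locally \<open>d w\<close>, and \<open>l - i w\<close> is a cycle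
  of \<open>Q\<close> over \<open>y\<close>.\<close>

lemma exact_Hj_connecting: "exact C (Hj (Suc n)) (connecting n)"
proof (rule exactI)
  let ?N = "Suc n"
  note q = presentation_arr[OF Q[of ?N]] and p = presentation_arr[OF P[of n]]
  have zz: "zigzag n (zQ ?N) (Zero C (Dom C (zQ ?N)) (ch_ob (ch_dom i) n))"
    using q(4,7,8) by (simp add: zigzag_def cycle_def)
  have "(connecting n \<cdot> Hj ?N) \<cdot> qQ ?N = Zero C (Dom C (qQ ?N)) (Cod C (qP n))"
  proof -
    have "Hj ?N \<cdot> qQ ?N = clR ?N (ch_map j ?N \<cdot> zQ ?N)"
      using Hj_class[OF q(7)] hclass_universal[OF Q] by simp
    moreover have "clP n (Zero C (Dom C (zQ ?N)) (ch_ob (ch_dom i) n))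
        = Zero C (Dom C (zQ ?N)) (Cod C (qP n))"
      using hclass_eqI[OF P, of "Zero C (Dom C (zQ ?N)) (Dom C (zP n))" n] p q by simp
    ultimately show ?thesis using connecting_class[OF zz] q by simp
  qed
  then show "connecting n \<cdot> Hj ?N = Zero C (Dom C (Hj ?N)) (Cod C (connecting n))"
    using epic_zero[OF q(3), of "connecting n \<cdot> Hj ?N"] q by simp
  fix x assume x: "x \<in> Arr C" "Cod C x = Dom C (connecting n)"
    "connecting n \<cdot> x = Zero C (Dom C x) (Cod C (connecting n))"
  obtain s y where s: "epic C s" "Cod C s = Dom C x" "cycle C (ch_cod j) ?N y" "Dom C y = Dom C s"
    "clR ?N y = x \<cdot> s"
    by (rule hclass_surjective[OF R[of ?N] x(1)]) (use x in auto)
  note y = cycle_arr[OF s(3)]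
  obtain v l where v: "epic C v" "Cod C v = Dom C y" "l \<in> Arr C" "Dom C l = Dom C v"
    "Cod C l = Dom C (ch_map j ?N)" "ch_map j ?N \<cdot> l = y \<cdot> v"
    by (rule epic_lift[OF epic_j[of ?N] y(1)]) (use y in auto)
  have yv: "cycle C (ch_cod j) ?N (y \<cdot> v)" using cycle_comp[OF _ s(3), of v] v by simp
  obtain m where zm: "zigzag n l m"
    by (rule zigzag_exists[of n l]) (use v yv in auto)
  have m: "m \<in> Arr C" "Cod C m = ch_ob (ch_dom i) n" "Dom C m = Dom C l" "ch_map i n \<cdot> m = dQ n \<cdot> l"
    using zm by (auto simp: zigzag_def)
  have clyv: "clR ?N (y \<cdot> v) = x \<cdot> (s \<cdot> v)"
    using hclass_comp[OF R s(3), of v] v s x by simp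
  have "clP n m = connecting n \<cdot> (x \<cdot> (s \<cdot> v))"
    using connecting_class[OF zm] v clyv by simp
  also have "\<dots> = Zero C (Dom C m) (Cod C (qP n))"
    using comp_extend'[OF x(3), of "s \<cdot> v"] x s v m p(5) by simp
  finally obtain t w where t: "epic C t" "Cod C t = Dom C m" "w \<in> Arr C" "Dom C w = Dom C t"
    "Cod C w = ch_ob (ch_dom i) ?N" "m \<cdot> t = dP n \<cdot> w"
    using hclass_zero_boundary[OF P zigzag_cycles(1)[OF zm]] by blast
  have lt: "Cod C t = Dom C l" "t \<in> Arr C" using t m by auto
  define l' where "l' = sub C (l \<cdot> t) (ch_map i ?N \<cdot> w)"
  have l': "l' \<in> Arr C" "Cod C l' = ch_ob (ch_dom j) ?N" "Dom C l' = Dom C t"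
    using v t lt by (simp_all add: l'_def)
  have e1: "dQ n \<cdot> (l \<cdot> t) = ch_map i n \<cdot> (m \<cdot> t)"
    by (rule comp_extend[OF m(4)[symmetric]]) (use m v lt in auto)
  have e2: "ch_map i n \<cdot> (dP n \<cdot> w) = dQ n \<cdot> (ch_map i ?N \<cdot> w)"
    by (rule i_natural) (use t in auto)
  have "dQ n \<cdot> l' = sub C (dQ n \<cdot> (l \<cdot> t)) (dQ n \<cdot> (ch_map i ?N \<cdot> w))"
    using v t lt by (simp add: l'_def comp_sub)
  also have "\<dots> = Zero C (Dom C l') (ch_ob (ch_dom j) n)"
    unfolding e1 t(6) e2 by (rule sub_self) (use t l' in auto)
  finally have cl': "cycle C (ch_dom j) ?N l'" using l' by (simp add: cycle_def)
  have "ch_map j ?N \<cdot> l' = ch_map j ?N \<cdot> (l \<cdot> t)"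
    using v(1-5) t lt by (simp add: l'_def comp_sub sub_zero)
  also have "\<dots> = (y \<cdot> v) \<cdot> t"
    using comp_extend'[OF v(6), of t] v(1-5) lt by simp
  finally have "Hj ?N \<cdot> clQ ?N l' = clR ?N ((y \<cdot> v) \<cdot> t)"
    using Hj_class[OF cl'] by simp
  also have "\<dots> = clR ?N (y \<cdot> v) \<cdot> t"
    by (rule hclass_comp[OF R yv]) (use v lt y in auto)
  also have "\<dots> = x \<cdot> (s \<cdot> (v \<cdot> t))" using clyv x s v lt by simp
  finally show "\<exists>p y. epic C p \<and> Cod C p = Dom C x \<and> y \<in> Hom C (Dom C p) (Dom C (Hj ?N)) \<and>
      Hj ?N \<cdot> y = x \<cdot> p"
    using epic_comp[OF s(1) epic_comp[OF v(1) t(1)]] s v lt l' hclass_arr[OF Q cl']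
    by (intro exI[of _ "s \<cdot> (v \<cdot> t)"] exI[of _ "clQ ?N l'"]) simp
qed simp_all

text \<open>In a zigzag \<open>i m = d l\<close> is a boundary, which gives the vanishing of the composite.
  Conversely, if \<open>i y\<close> is locally a boundary \<open>d w\<close>, then \<open>(w, y)\<close> is a zigzag.\<close>

lemma exact_connecting_Hi: "exact C (connecting n) (Hi n)"
proof (rule exactI)
  let ?N = "Suc n"
  note q = presentation_arr[OF Q[of n]] and r = presentation_arr[OF R[of ?N]]
  obtain e l where e: "epic C e" "Cod C e = Dom C (zR ?N)" "l \<in> Arr C" "Dom C l = Dom C e"
    "Cod C l = Dom C (ch_map j ?N)" "ch_map j ?N \<cdot> l = zR ?N \<cdot> e"
    by (rule epic_lift[OF epic_j[of ?N] r(4)]) (use r in auto)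
  have cze: "cycle C (ch_cod j) ?N (zR ?N \<cdot> e)" using cycle_comp[OF r(1,7)] e by simp
  obtain m where zm: "zigzag n l m"
    by (rule zigzag_exists[of n l]) (use e cze in auto)
  have m: "m \<in> Arr C" "Cod C m = ch_ob (ch_dom i) n" "Dom C m = Dom C l" "ch_map i n \<cdot> m = dQ n \<cdot> l"
    using zm by (auto simp: zigzag_def)
  have qe: "clR ?N (zR ?N \<cdot> e) = qR ?N \<cdot> e"
    by (rule hclass_eqI[OF R]) (use e in auto)
  have "connecting n \<cdot> (qR ?N \<cdot> e) = clP n m" using connecting_class[OF zm] e qe by simp
  moreover have "Hi n \<cdot> clP n m = Zero C (Dom C e) (Cod C (qQ n))"
    using Hi_class[OF zigzag_cycles(1)[OF zm]] hclass_boundary[OF Q, of l n] e m by simp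
  ultimately have "(Hi n \<cdot> connecting n) \<cdot> (qR ?N \<cdot> e) = Zero C (Dom C e) (Cod C (qQ n))"
    using e r by simp
  then show "Hi n \<cdot> connecting n = Zero C (Dom C (connecting n)) (Cod C (Hi n))"
    using epic_zero[OF epic_comp[OF r(3) e(1)], of "Hi n \<cdot> connecting n"] e r by simp
  fix x assume x: "x \<in> Arr C" "Cod C x = Dom C (Hi n)" "Hi n \<cdot> x = Zero C (Dom C x) (Cod C (Hi n))"
  obtain s y where s: "epic C s" "Cod C s = Dom C x" "cycle C (ch_dom i) n y" "Dom C y = Dom C s"
    "clP n y = x \<cdot> s"
    by (rule hclass_surjective[OF P[of n] x(1)]) (use x in auto)
  note y = cycle_arr[OF s(3)] and iy = cycle_i[OF s(3)]
  have "clQ n (ch_map i n \<cdot> y) = Zero C (Dom C (ch_map i n \<cdot> y)) (Cod C (qQ n))"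
    using Hi_class[OF s(3)] comp_extend'[OF x(3), of s] s x y q(5) by simp
  then obtain t w where t: "epic C t" "Cod C t = Dom C (ch_map i n \<cdot> y)" "w \<in> Arr C" "Dom C w = Dom C t"
    "Cod C w = ch_ob (ch_dom j) ?N" "(ch_map i n \<cdot> y) \<cdot> t = dQ n \<cdot> w"
    using hclass_zero_boundary[OF Q iy] by blast
  have ty: "Cod C t = Dom C y" "t \<in> Arr C" using t y by auto
  have "zigzag n w (y \<cdot> t)" using t y ty by (simp add: zigzag_def)
  note con = connecting_class[OF this] and cyc = zigzag_cycles[OF this]
  have "connecting n \<cdot> clR ?N (ch_map j ?N \<cdot> w) = x \<cdot> (s \<cdot> t)"
    using con hclass_comp[OF P s(3) ty(2,1)] s ty x by simp
  then show "\<exists>p y. epic C p \<and> Cod C p = Dom C x \<and> y \<in> Hom C (Dom C p) (Dom C (connecting n)) \<and>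
      connecting n \<cdot> y = x \<cdot> p"
    using epic_comp[OF s(1) t(1)] s ty t(3-5) hclass_arr[OF R cyc(2)]
    by (intro exI[of _ "s \<cdot> t"] exI[of _ "clR ?N (ch_map j ?N \<cdot> w)"]) simp
qed simp_all

text \<open>Everything in degree zero is a cycle, so a lift along \<open>j\<close> of a cycle of \<open>R\<close> is a cycle of
  \<open>Q\<close>.\<close>

lemma exact_Hj_zero:
  assumes "is_zero_object C Z"
  shows "exact C (Hj 0) (Zero C (Cod C (qR 0)) Z)"
proof (rule exactI)
  note r = presentation_arr[OF R[of 0]]
  have Z: "Z \<in> Obj C" using assms by (simp add: is_zero_object_def)
  show "Hj 0 \<in> Arr C" "Zero C (Cod C (qR 0)) Z \<in> Arr C"
    "Cod C (Hj 0) = Dom C (Zero C (Cod C (qR 0)) Z)"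
    "Zero C (Cod C (qR 0)) Z \<cdot> Hj 0 = Zero C (Dom C (Hj 0)) (Cod C (Zero C (Cod C (qR 0)) Z))"
    using r Z by simp_all
  fix x assume x: "x \<in> Arr C" "Cod C x = Dom C (Zero C (Cod C (qR 0)) Z)"
  obtain s y where s: "epic C s" "Cod C s = Dom C x" "cycle C (ch_cod j) 0 y" "Dom C y = Dom C s"
    "clR 0 y = x \<cdot> s"
    by (rule hclass_surjective[OF R[of 0] x(1)]) (use x r Z in auto)
  note y = cycle_arr[OF s(3)]
  obtain v l where v: "epic C v" "Cod C v = Dom C y" "l \<in> Arr C" "Dom C l = Dom C v"
    "Cod C l = Dom C (ch_map j 0)" "ch_map j 0 \<cdot> l = y \<cdot> v"
    by (rule epic_lift[OF epic_j[of 0] y(1)]) (use y in auto)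
  have cl: "cycle C (ch_dom j) 0 l" using v by (simp add: cycle_def)
  have "Hj 0 \<cdot> clQ 0 l = x \<cdot> (s \<cdot> v)"
    using Hj_class[OF cl] v hclass_comp[OF R s(3), of v] s x Z r by simp
  then show "\<exists>p y. epic C p \<and> Cod C p = Dom C x \<and> y \<in> Hom C (Dom C p) (Dom C (Hj 0)) \<and> Hj 0 \<cdot> y = x \<cdot> p"
    using epic_comp[OF s(1) v(1)] s v hclass_arr[OF Q cl]
    by (intro exI[of _ "s \<cdot> v"] exI[of _ "clQ 0 l"]) simp
qed

end

section \<open>Presentations of homology and exact functors\<close>

context abelian_category
begin

text \<open>Since \<open>z\<close> is monic and \<open>z \<cdot> b = d\<close>, the arrow \<open>z \<cdot> y\<close> is locally a boundary iff \<open>y\<close> lifts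
  locally along \<open>b\<close>. The local description of boundaries in a presentation thus amounts to
  exactness of \<open>(b, q)\<close>.\<close>

lemma presentationI:
  assumes c: "is_cpx C c" and z: "monic C z" "cycle C c n z"
    and lift: "\<And>x. cycle C c n x \<Longrightarrow> \<exists>y \<in> Hom C (Dom C x) (Dom C z). z \<cdot> y = x"
    and b: "z \<cdot> b = ch_d c n" and q: "exact C b q" "epic C q" and bz: "Cod C b = Dom C z"
    "Dom C b = ch_ob c (Suc n)"
  shows "homology_presentation C c n z q"
  unfolding homology_presentation_def
proof (intro conjI ballI impI allI iffI)
  note e = exact_arr[OF q(1)]
  note za = cycle_arr[OF z(2)]
  show "Dom C q = Dom C z" using e bz by simp
  fix y assume y: "y \<in> Arr C" "Cod C y = Dom C z"
  {
    assume "q \<cdot> y = Zero C (Dom C y) (Cod C q)"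
    then obtain p w where p: "epic C p" "Cod C p = Dom C y" "w \<in> Arr C" "Dom C w = Dom C p"
      "Cod C w = Dom C b" "b \<cdot> w = y \<cdot> p"
      using exact_lift[OF q(1) y(1)] y e bz by (metis)
    have "z \<cdot> (b \<cdot> w) = ch_d c n \<cdot> w" by (rule comp_extend'[OF b]) (use p za e bz in auto)
    then show "\<exists>p w. epic C p \<and> Cod C p = Dom C y \<and> w \<in> Hom C (Dom C p) (ch_ob c (Suc n)) \<and>
                z \<cdot> (y \<cdot> p) = ch_d c n \<cdot> w"
      using p bz by (intro exI[of _ p] exI[of _ w]) auto
  }
  assume "\<exists>p w. epic C p \<and> Cod C p = Dom C y \<and> w \<in> Hom C (Dom C p) (ch_ob c (Suc n)) \<and>
                z \<cdot> (y \<cdot> p) = ch_d c n \<cdot> w"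
  then obtain p w where p: "epic C p" "Cod C p = Dom C y" "w \<in> Arr C" "Dom C w = Dom C p"
      "Cod C w = ch_ob c (Suc n)" "z \<cdot> (y \<cdot> p) = ch_d c n \<cdot> w" by auto
  have "z \<cdot> (b \<cdot> w) = ch_d c n \<cdot> w" by (rule comp_extend'[OF b]) (use p za e bz in auto)
  then have "y \<cdot> p = b \<cdot> w"
    by (intro monic_cancel[OF z(1), of "y \<cdot> p" "b \<cdot> w"]) (use p y za e bz in auto)
  then have "(q \<cdot> y) \<cdot> p = Zero C (Dom C p) (Cod C q)"
    using comp_extend'[OF e(4), of w] p y za e bz by simp
  then show "q \<cdot> y = Zero C (Dom C y) (Cod C q)"
    using epic_zero[OF p(1), of "q \<cdot> y"] p y za e bz by simp
qed (use assms in auto)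

lemma out_d_arr [simp]:
  assumes "is_cpx C c"
  shows "out_d C c n \<in> Arr C" "Dom C (out_d C c n) = ch_ob c n"
  using assms zero_object_obj
  by (auto simp: out_d_def is_zero_object_def split: nat.split)

text \<open>In degree zero \<open>out_d\<close> is a zero arrow, so that both sides then hold for every arrow into
  \<open>ch_ob c 0\<close>.\<close>

lemma cycle_iff_out_d:
  assumes "is_cpx C c"
  shows "cycle C c n x \<longleftrightarrow> x \<in> Arr C \<and> Cod C x = ch_ob c n \<and>
    out_d C c n \<cdot> x = Zero C (Dom C x) (Cod C (out_d C c n))"
  using assms zero_object_obj
  by (auto simp: out_d_def is_zero_object_def cycle_def split: nat.split)

lemma is_kernel_cycles: "is_cpx C c \<Longrightarrow> is_kernel C (out_d C c n) (cycles C c n)"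
  unfolding cycles_def by (rule is_kernel_kernel) simp

lemma bdry_arr:
  assumes "is_cpx C c"
  shows "bdry C c n \<in> Arr C" "Dom C (bdry C c n) = ch_ob c (Suc n)"
    "Cod C (bdry C c n) = Dom C (cycles C c n)" "cycles C c n \<cdot> bdry C c n = ch_d c n"
proof -
  note k = is_kernel_cycles[OF assms, of n]
  note k' = kernel_arr[OF k]
  have "cycle C c n (ch_d c n)"
    using cycle_boundary[OF assms, of "Ident C (ch_ob c (Suc n))" n] assms by simp
  then obtain b where b: "b \<in> Arr C" "Dom C b = ch_ob c (Suc n)" "Cod C b = Dom C (cycles C c n)"
    "cycles C c n \<cdot> b = ch_d c n"
    using kernel_lift[OF k, of "ch_d c n"] assms cycle_iff_out_d[OF assms] by auto
  have "bdry C c n = b"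
    unfolding bdry_def
  proof (rule the_equality)
    fix b' assume b': "b' \<in> Hom C (ch_ob c (Suc n)) (Dom C (cycles C c n)) \<and>
      cycles C c n \<cdot> b' = ch_d c n"
    show "b' = b" by (rule monic_cancel[OF kernel_monic[OF k]]) (use b b' in auto)
  qed (use b in auto)
  then show "bdry C c n \<in> Arr C" "Dom C (bdry C c n) = ch_ob c (Suc n)"
    "Cod C (bdry C c n) = Dom C (cycles C c n)" "cycles C c n \<cdot> bdry C c n = ch_d c n"
    using b by auto
qed

lemma is_cokernel_hproj: "is_cpx C c \<Longrightarrow> is_cokernel C (bdry C c n) (hproj C c n)"
  unfolding hproj_def by (rule is_cokernel_cokernel) (rule bdry_arr)

lemma standard_presentation:
  assumes "is_cpx C c"
  shows "homology_presentation C c n (cycles C c n) (hproj C c n)"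
proof (rule presentationI[OF assms])
  note k = is_kernel_cycles[OF assms, of n]
  note k' = kernel_arr[OF k]
  show "monic C (cycles C c n)" by (rule kernel_monic[OF k])
  show "cycle C c n (cycles C c n)" using k' assms by (simp add: cycle_iff_out_d)
  show "cycles C c n \<cdot> bdry C c n = ch_d c n" "Cod C (bdry C c n) = Dom C (cycles C c n)"
    "Dom C (bdry C c n) = ch_ob c (Suc n)"
    using bdry_arr[OF assms] by auto
  show "exact C (bdry C c n) (hproj C c n)" "epic C (hproj C c n)"
    using exact_cokernel cokernel_epic is_cokernel_hproj[OF assms] by blast+
  fix x assume "cycle C c n x"
  then have x: "x \<in> Arr C" "Cod C x = Dom C (out_d C c n)"
    "out_d C c n \<cdot> x = Zero C (Dom C x) (Cod C (out_d C c n))"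
    using assms by (auto simp: cycle_iff_out_d)
  show "\<exists>y \<in> Hom C (Dom C x) (Dom C (cycles C c n)). cycles C c n \<cdot> y = x"
    by (rule kernel_lift[OF k x]) auto
qed

end

locale exact_functor_between = C: abelian_category C + D: abelian_category D
  for C :: "('o, 'a, 'z) preadd_scheme" and D :: "('p, 'b, 'w) preadd_scheme" +
  fixes F :: "('o, 'a, 'p, 'b) fctr"
  assumes exact_F: "exact_functor C D F"
begin

lemma F_obj [simp]: "x \<in> Obj C \<Longrightarrow> omap F x \<in> Obj D"
  using exact_F by (simp add: exact_functor_def additive_functor_def is_functor_def)

lemma F_arr [simp]:
  assumes "f \<in> Arr C"
  shows "amap F f \<in> Arr D" "Dom D (amap F f) = omap F (Dom C f)" "Cod D (amap F f) = omap F (Cod C f)"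
  using exact_F assms unfolding exact_functor_def additive_functor_def is_functor_def by auto

lemma F_comp [simp]:
  assumes "f \<in> Arr C" "g \<in> Arr C" "Cod C f = Dom C g"
  shows "amap F (g \<cdot>\<^bsub>C\<^esub> f) = amap F g \<cdot>\<^bsub>D\<^esub> amap F f"
  using exact_F assms unfolding exact_functor_def additive_functor_def is_functor_def by auto

lemma F_zero [simp]:
  assumes "x \<in> Obj C" "y \<in> Obj C"
  shows "amap F (Zero C x y) = Zero D (omap F x) (omap F y)"
proof -
  have "amap F (Add C (Zero C x y) (Zero C x y)) = Add D (amap F (Zero C x y)) (amap F (Zero C x y))"
    using exact_F assms unfolding exact_functor_def additive_functor_def by auto
  then show ?thesis using D.add_idem_zero[of "amap F (Zero C x y)"] assms by (simp add: C.add_zero)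
qed

lemma F_short_exact: "short_exact C f g \<Longrightarrow> short_exact D (amap F f) (amap F g)"
  using exact_F unfolding exact_functor_def by blast

lemma F_monic:
  assumes "monic C f"
  shows "monic D (amap F f)"
proof -
  have c: "is_cokernel C f (cokernel C f)" using C.is_cokernel_cokernel assms by simp
  then have "short_exact C f (cokernel C f)"
    using assms C.exact_cokernel C.cokernel_epic by (simp add: short_exact_def)
  then show ?thesis using F_short_exact by (auto simp: short_exact_def)
qed

lemma F_epic:
  assumes "epic C f"
  shows "epic D (amap F f)"
proof -
  have "is_kernel C f (kernel C f)" using C.is_kernel_kernel assms by simp
  then have "short_exact C (kernel C f) f"
    using assms C.exact_kernel C.kernel_monic by (simp add: short_exact_def)
  then show ?thesis using F_short_exact by (auto simp: short_exact_def)
qed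

text \<open>Exactness of the functor is only given for short exact sequences. Both \<open>f\<close> and \<open>g\<close> are
  therefore factored through their images, \<open>f = k \<cdot> e\<close> and \<open>g = m \<cdot> s\<close>, where \<open>(k, s)\<close> is short
  exact, while \<open>F\<close> preserves the epimorphism \<open>e\<close> and the monomorphism \<open>m\<close>.\<close>

lemma F_exact:
  assumes "exact C f g"
  shows "exact D (amap F f) (amap F g)"
proof -
  note fg = C.exact_arr[OF assms]
  obtain c k where c: "is_cokernel C f c" and k: "is_kernel C c k" and g: "is_kernel C g k"
    using assms unfolding exact_def by auto
  note k' = C.kernel_arr[OF g]
  obtain e where e: "epic C e" "Dom C e = Dom C f" "Cod C e = Dom C k" "k \<cdot>\<^bsub>C\<^esub> e = f"
    using C.image_factorization[OF c k] .
  obtain c2 where c2: "is_cokernel C g c2" using C.ex_cokernel fg by blast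
  obtain m where m: "is_kernel C c2 m" using C.ex_kernel C.cokernel_arr(2)[OF c2] by blast
  note m' = C.kernel_arr[OF m] and c2' = C.cokernel_arr[OF c2]
  obtain s where s: "epic C s" "Dom C s = Dom C g" "Cod C s = Dom C m" "m \<cdot>\<^bsub>C\<^esub> s = g"
    using C.image_factorization[OF c2 m] .
  have "is_kernel C s k"
  proof (rule C.is_kernelI)
    have "m \<cdot>\<^bsub>C\<^esub> (s \<cdot>\<^bsub>C\<^esub> k) = Zero C (Dom C k) (Cod C g)"
      using C.comp_extend'[OF s(4), of k] s m' k' by simp
    then show "s \<cdot>\<^bsub>C\<^esub> k = Zero C (Dom C k) (Cod C s)"
      using C.monic_zero[OF C.kernel_monic[OF m], of "s \<cdot>\<^bsub>C\<^esub> k"] s m' k' c2' by simp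
    fix x assume x: "x \<in> Arr C" "Cod C x = Dom C s" "s \<cdot>\<^bsub>C\<^esub> x = Zero C (Dom C x) (Cod C s)"
    have "g \<cdot>\<^bsub>C\<^esub> x = Zero C (Dom C x) (Cod C g)"
      using C.comp_extend'[OF s(4), of x] s m' c2' x by simp
    then show "\<exists>u. u \<in> Hom C (Dom C x) (Dom C k) \<and> k \<cdot>\<^bsub>C\<^esub> u = x"
      using C.kernel_lift[OF g, of x] x s by auto
  qed (use s k' C.kernel_monic[OF g] in auto)
  then have "short_exact C k s"
    using s C.exact_kernel C.kernel_monic by (simp add: short_exact_def)
  note ks = F_short_exact[OF this]
  show ?thesis
  proof (rule D.exactI)
    show "amap F g \<cdot>\<^bsub>D\<^esub> amap F f = Zero D (Dom D (amap F f)) (Cod D (amap F g))"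
      using fg F_comp[of f g] by simp
    fix x assume x: "x \<in> Arr D" "Cod D x = Dom D (amap F g)"
      "amap F g \<cdot>\<^bsub>D\<^esub> x = Zero D (Dom D x) (Cod D (amap F g))"
    have ms: "amap F m \<cdot>\<^bsub>D\<^esub> amap F s = amap F g" using F_comp[of s m] s m' by simp
    have ke: "amap F k \<cdot>\<^bsub>D\<^esub> amap F e = amap F f" using F_comp[of e k] e k' by simp
    have "amap F m \<cdot>\<^bsub>D\<^esub> (amap F s \<cdot>\<^bsub>D\<^esub> x) = Zero D (Dom D x) (Cod D (amap F g))"
      using D.comp_extend'[OF ms, of x] x s m' fg by simp
    then have "amap F s \<cdot>\<^bsub>D\<^esub> x = Zero D (Dom D x) (Cod D (amap F s))"
      using D.monic_zero[OF F_monic[OF C.kernel_monic[OF m]], of "amap F s \<cdot>\<^bsub>D\<^esub> x"] x s m' c2' fg by simp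
    moreover have "exact D (amap F k) (amap F s)" using ks by (simp add: short_exact_def)
    ultimately obtain p y where p: "epic D p" "Cod D p = Dom D x" "y \<in> Arr D" "Dom D y = Dom D p"
      "Cod D y = Dom D (amap F k)" "amap F k \<cdot>\<^bsub>D\<^esub> y = x \<cdot>\<^bsub>D\<^esub> p"
      using D.exact_lift[of "amap F k" "amap F s" x] x s fg by auto
    obtain r u where r: "epic D r" "Cod D r = Dom D y" "u \<in> Arr D" "Dom D u = Dom D r"
      "Cod D u = Dom D (amap F e)" "amap F e \<cdot>\<^bsub>D\<^esub> u = y \<cdot>\<^bsub>D\<^esub> r"
      by (rule D.epic_lift[OF F_epic[OF e(1)] p(3)]) (use p e k' in auto)
    have "amap F f \<cdot>\<^bsub>D\<^esub> u = amap F k \<cdot>\<^bsub>D\<^esub> (y \<cdot>\<^bsub>D\<^esub> r)"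
      using D.comp_extend'[OF ke, of u] r e k' by simp
    also have "\<dots> = x \<cdot>\<^bsub>D\<^esub> (p \<cdot>\<^bsub>D\<^esub> r)"
      by (rule D.comp_extend[OF p(6)]) (use p r x k' in auto)
    finally show "\<exists>p y. epic D p \<and> Cod D p = Dom D x \<and> y \<in> Hom D (Dom D p) (Dom D (amap F f)) \<and>
        amap F f \<cdot>\<^bsub>D\<^esub> y = x \<cdot>\<^bsub>D\<^esub> p"
      using D.epic_comp[OF p(1) r(1)] p r e fg
      by (intro exI[of _ "p \<cdot>\<^bsub>D\<^esub> r"] exI[of _ u]) simp
  qed (use fg in auto)
qed

lemma F_cpx:
  assumes "is_cpx C c"
  shows "is_cpx D (map_cpx F c)"
  unfolding is_cpx_def map_cpx_def
proof (simp add: assms, intro allI)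
  fix n
  show "amap F (ch_d c n) \<cdot>\<^bsub>D\<^esub> amap F (ch_d c (Suc n))
     = Zero D (omap F (ch_ob c (Suc (Suc n)))) (omap F (ch_ob c n))"
    using F_comp[of "ch_d c (Suc n)" "ch_d c n"] assms by simp
qed

text \<open>A presentation consists of a monomorphism \<open>z\<close> and an epimorphism \<open>q\<close> such that \<open>(z,
  out_d)\<close> and \<open>(bdry, q)\<close> are exact; all four properties are preserved by \<open>F\<close>.\<close>

lemma F_presentation:
  assumes c: "is_cpx C c"
  shows "homology_presentation D (map_cpx F c) n (amap F (cycles C c n)) (amap F (hproj C c n))"
proof (rule D.presentationI[OF F_cpx[OF c]])
  note k = C.is_kernel_cycles[OF c, of n]
  note k' = C.kernel_arr[OF k] and b = C.bdry_arr[OF c, of n]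
    and h = C.cokernel_arr[OF C.is_cokernel_hproj[OF c, of n]]
  note mono = F_monic[OF C.kernel_monic[OF k]]
  show "monic D (amap F (cycles C c n))" by (rule mono)
  show "cycle D (map_cpx F c) n (amap F (cycles C c n))"
    unfolding cycle_def
  proof (intro conjI allI impI)
    fix m assume n: "n = Suc m"
    have "ch_d c m \<cdot>\<^bsub>C\<^esub> cycles C c n = Zero C (Dom C (cycles C c n)) (ch_ob c m)"
      using k' n c by (simp add: out_d_def)
    then show "ch_d (map_cpx F c) m \<cdot>\<^bsub>D\<^esub> amap F (cycles C c n)
        = Zero D (Dom D (amap F (cycles C c n))) (ch_ob (map_cpx F c) m)"
      using F_comp[of "cycles C c n" "ch_d c m"] k' n c by (simp add: map_cpx_def)
  qed (use k' c in \<open>auto simp: map_cpx_def\<close>)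
  show "amap F (cycles C c n) \<cdot>\<^bsub>D\<^esub> amap F (bdry C c n) = ch_d (map_cpx F c) n"
    using F_comp[of "bdry C c n" "cycles C c n"] k' b by (simp add: map_cpx_def)
  show "Cod D (amap F (bdry C c n)) = Dom D (amap F (cycles C c n))"
    "Dom D (amap F (bdry C c n)) = ch_ob (map_cpx F c) (Suc n)"
    using b k' by (simp_all add: map_cpx_def)
  show "exact D (amap F (bdry C c n)) (amap F (hproj C c n))"
    by (rule F_exact[OF C.exact_cokernel[OF C.is_cokernel_hproj[OF c]]])
  show "epic D (amap F (hproj C c n))"
    by (rule F_epic[OF C.cokernel_epic[OF C.is_cokernel_hproj[OF c]]])
  fix x assume "cycle D (map_cpx F c) n x"
  then have x: "x \<in> Arr D" "Cod D x = omap F (ch_ob c n)"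
    "\<And>m. n = Suc m \<Longrightarrow> amap F (ch_d c m) \<cdot>\<^bsub>D\<^esub> x = Zero D (Dom D x) (omap F (ch_ob c m))"
    by (auto simp: cycle_def map_cpx_def)
  \<comment> \<open>The image of the zero object of \<open>C\<close> need not be the chosen zero object of \<open>D\<close>, so the outgoing
    differential in degree zero is treated as the image of a zero arrow.\<close>
  have "amap F (out_d C c n) \<cdot>\<^bsub>D\<^esub> x = Zero D (Dom D x) (Cod D (amap F (out_d C c n)))"
    using x c C.zero_object_obj by (cases n) (auto simp: out_d_def is_zero_object_def)
  then obtain p y where p: "epic D p" "Cod D p = Dom D x" "y \<in> Arr D" "Dom D y = Dom D p"
    "Cod D y = Dom D (amap F (cycles C c n))" "amap F (cycles C c n) \<cdot>\<^bsub>D\<^esub> y = x \<cdot>\<^bsub>D\<^esub> p"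
    using D.exact_lift[OF F_exact[OF C.exact_kernel[OF k]], of x] x c by auto
  obtain w where "w \<in> Arr D" "Dom D w = Dom D x" "Cod D w = Dom D (amap F (cycles C c n))"
    "amap F (cycles C c n) \<cdot>\<^bsub>D\<^esub> w = x"
    by (rule D.monic_local_lift[OF mono x(1) _ p(1-5) p(6)]) (use x k' c in auto)
  then show "\<exists>y \<in> Hom D (Dom D x) (Dom D (amap F (cycles C c n))). amap F (cycles C c n) \<cdot>\<^bsub>D\<^esub> y = x"
    by auto
qed

end

section \<open>Monomorphisms and cokernels of chain maps\<close>

lemma cpx_cat_simps [simp]:
  "Obj (cpx_cat C) = {c. is_cpx C c}" "Arr (cpx_cat C) = {h. is_chmap C h}"
  "Dom (cpx_cat C) = ch_dom" "Cod (cpx_cat C) = ch_cod"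
  "Zero (cpx_cat C) c e = \<lparr>ch_dom = c, ch_cod = e, ch_map = (\<lambda>n. Zero C (ch_ob c n) (ch_ob e n))\<rparr>"
  "h \<cdot>\<^bsub>cpx_cat C\<^esub> g = \<lparr>ch_dom = ch_dom g, ch_cod = ch_cod h, ch_map = (\<lambda>n. ch_map h n \<cdot>\<^bsub>C\<^esub> ch_map g n)\<rparr>"
  by (simp_all add: cpx_cat_def)

context abelian_category
begin

lemma is_chmapI:
  assumes "is_cpx C (ch_dom h)" "is_cpx C (ch_cod h)"
    "\<And>n. ch_map h n \<in> Arr C" "\<And>n. Dom C (ch_map h n) = ch_ob (ch_dom h) n"
    "\<And>n. Cod C (ch_map h n) = ch_ob (ch_cod h) n"
    "\<And>n. ch_d (ch_cod h) n \<cdot> ch_map h (Suc n) = ch_map h n \<cdot> ch_d (ch_dom h) n"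
  shows "is_chmap C h"
  unfolding is_chmap_def Hom_iff using assms by blast

lemma chmap_square:
  "is_chmap C h \<Longrightarrow> ch_d (ch_cod h) n \<cdot> ch_map h (Suc n) = ch_map h n \<cdot> ch_d (ch_dom h) n"
  by (simp only: is_chmap_def)

text \<open>The degreewise kernels form a complex. Its inclusion and the zero map have the same
  composite with \<open>h\<close>, so they agree, and all degreewise kernels vanish.\<close>

lemma chmap_monic_degreewise:
  assumes "monic (cpx_cat C) h"
  shows "monic C (ch_map h n)"
proof -
  have h: "is_chmap C h" using assms by (simp add: monic_def)
  define k where "k n = kernel C (ch_map h n)" for n
  have k: "is_kernel C (ch_map h n) (k n)" for n
    unfolding k_def by (rule is_kernel_kernel) (simp add: h)
  note k' = kernel_arr[OF k]
  have ka [simp]: "k n \<in> Arr C" "Cod C (k n) = ch_ob (ch_dom h) n" for n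
    using k' h by auto
  let ?d = "ch_d (ch_dom h)"
  have "\<exists>e. e \<in> Arr C \<and> Dom C e = Dom C (k (Suc n)) \<and> Cod C e = Dom C (k n) \<and> k n \<cdot> e = ?d n \<cdot> k (Suc n)"
    for n
  proof -
    have "ch_map h n \<cdot> (?d n \<cdot> k (Suc n)) = Zero C (Dom C (k (Suc n))) (ch_ob (ch_cod h) n)"
      using chmap_natural[OF h, of "k (Suc n)" n] k' h by simp
    then show ?thesis using kernel_lift[OF k, of "?d n \<cdot> k (Suc n)" n] h by auto
  qed
  then obtain e where e: "\<And>n. e n \<in> Arr C" "\<And>n. Dom C (e n) = Dom C (k (Suc n))"
    "\<And>n. Cod C (e n) = Dom C (k n)" "\<And>n. k n \<cdot> e n = ?d n \<cdot> k (Suc n)"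
    by metis
  define c where "c = \<lparr>ch_ob = (\<lambda>n. Dom C (k n)), ch_d = e\<rparr>"
  have cpx: "is_cpx C c"
    unfolding is_cpx_def
  proof (intro conjI allI)
    fix n
    have "k n \<cdot> (e n \<cdot> e (Suc n)) = ?d n \<cdot> (k (Suc n) \<cdot> e (Suc n))"
      by (rule comp_extend[OF e(4)]) (use e h in auto)
    also have "\<dots> = Zero C (Dom C (k (Suc (Suc n)))) (ch_ob (ch_dom h) n)"
      unfolding e(4) using h by simp
    finally show "ch_d c n \<cdot> ch_d c (Suc n) = Zero C (ch_ob c (Suc (Suc n))) (ch_ob c n)"
      using monic_zero[OF kernel_monic[OF k], of "e n \<cdot> e (Suc n)" n] e by (simp add: c_def)
  qed (use e in \<open>auto simp: c_def\<close>)
  define u where "u = \<lparr>ch_dom = c, ch_cod = ch_dom h, ch_map = k\<rparr>"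
  define v where "v = \<lparr>ch_dom = c, ch_cod = ch_dom h,
    ch_map = (\<lambda>n. Zero C (Dom C (k n)) (ch_ob (ch_dom h) n))\<rparr>"
  have u: "is_chmap C u"
    by (rule is_chmapI) (use cpx h e in \<open>auto simp: u_def c_def\<close>)
  have v: "is_chmap C v"
    by (rule is_chmapI) (use cpx h e in \<open>auto simp: v_def c_def\<close>)
  have "h \<cdot>\<^bsub>cpx_cat C\<^esub> u = h \<cdot>\<^bsub>cpx_cat C\<^esub> v"
    using k' h by (simp add: u_def v_def fun_eq_iff)
  then have "u = v" using assms u v unfolding monic_def
    by (elim conjE allE[of _ c] ballE[of _ _ u] ballE[of _ _ v]) (auto simp: u_def v_def)
  then have k0: "k n = Zero C (Dom C (k n)) (ch_ob (ch_dom h) n)" for n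
    by (simp add: u_def v_def fun_eq_iff)
  show ?thesis
  proof (rule monicI)
    fix x assume x: "x \<in> Arr C" "Cod C x = Dom C (ch_map h n)"
      "ch_map h n \<cdot> x = Zero C (Dom C x) (Cod C (ch_map h n))"
    obtain w where w: "w \<in> Arr C" "Dom C w = Dom C x" "Cod C w = Dom C (k n)" "k n \<cdot> w = x"
      using kernel_lift[OF k x] .
    have "x = Zero C (Dom C (k n)) (ch_ob (ch_dom h) n) \<cdot> w" using w k0[of n] by simp
    then show "x = Zero C (Dom C x) (Dom C (ch_map h n))" using w h by simp
  qed (simp add: h)
qed

lemma chmap_cokernel_exists:
  assumes h: "is_chmap C h"
  obtains c where "is_cokernel (cpx_cat C) h c" "\<And>n. is_cokernel C (ch_map h n) (ch_map c n)"
proof -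
  define c where "c n = cokernel C (ch_map h n)" for n
  have c: "is_cokernel C (ch_map h n) (c n)" for n
    unfolding c_def by (rule is_cokernel_cokernel) (simp add: h)
  note c' = cokernel_arr[OF c]
  have ca [simp]: "c n \<in> Arr C" "Dom C (c n) = ch_ob (ch_cod h) n" for n
    using c' h by auto
  let ?d = "ch_d (ch_cod h)"
  have "\<exists>e. e \<in> Arr C \<and> Dom C e = Cod C (c (Suc n)) \<and> Cod C e = Cod C (c n) \<and> e \<cdot> c (Suc n) = c n \<cdot> ?d n"
    for n
  proof -
    have "(c n \<cdot> ?d n) \<cdot> ch_map h (Suc n) = Zero C (ch_ob (ch_dom h) (Suc n)) (Cod C (c n))"
      using chmap_square[OF h, of n] comp_extend'[OF c'(4)[of n], of "ch_d (ch_dom h) n"] h by simp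
    then show ?thesis using cokernel_desc[OF c, of "c n \<cdot> ?d n" "Suc n"] h by auto
  qed
  then obtain e where e: "\<And>n. e n \<in> Arr C" "\<And>n. Dom C (e n) = Cod C (c (Suc n))"
    "\<And>n. Cod C (e n) = Cod C (c n)" "\<And>n. e n \<cdot> c (Suc n) = c n \<cdot> ?d n"
    by metis
  define Q where "Q = \<lparr>ch_ob = (\<lambda>n. Cod C (c n)), ch_d = e\<rparr>"
  have cpx: "is_cpx C Q"
    unfolding is_cpx_def
  proof (intro conjI allI)
    fix n
    have "(e n \<cdot> e (Suc n)) \<cdot> c (Suc (Suc n)) = e n \<cdot> (c (Suc n) \<cdot> ?d (Suc n))"
      using e by simp
    also have "\<dots> = c n \<cdot> (?d n \<cdot> ?d (Suc n))"
      by (rule comp_extend[OF e(4)]) (use e h in auto)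
    also have "\<dots> = Zero C (ch_ob (ch_cod h) (Suc (Suc n))) (Cod C (c n))" using h by simp
    finally show "ch_d Q n \<cdot> ch_d Q (Suc n) = Zero C (ch_ob Q (Suc (Suc n))) (ch_ob Q n)"
      using epic_zero[OF cokernel_epic[OF c], of "e n \<cdot> e (Suc n)" "Suc (Suc n)"] e
      by (simp add: Q_def)
  qed (use e in \<open>auto simp: Q_def\<close>)
  define q where "q = \<lparr>ch_dom = ch_cod h, ch_cod = Q, ch_map = c\<rparr>"
  have q: "is_chmap C q"
    by (rule is_chmapI) (use cpx h e in \<open>auto simp: q_def Q_def\<close>)
  have "is_cokernel (cpx_cat C) h q"
    unfolding is_cokernel_def
  proof (intro conjI allI ballI impI)
    show "h \<in> Arr (cpx_cat C)" "q \<in> Arr (cpx_cat C)" "Dom (cpx_cat C) q = Cod (cpx_cat C) h"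
      using h q by (auto simp: q_def)
    show "q \<cdot>\<^bsub>cpx_cat C\<^esub> h = Zero (cpx_cat C) (Dom (cpx_cat C) h) (Cod (cpx_cat C) q)"
      using c'(4) h by (simp add: q_def Q_def fun_eq_iff)
    fix y g assume g: "g \<in> Hom (cpx_cat C) (Cod (cpx_cat C) h) y"
      "g \<cdot>\<^bsub>cpx_cat C\<^esub> h = Zero (cpx_cat C) (Dom (cpx_cat C) h) y"
    have gc: "is_chmap C g" "ch_dom g = ch_cod h" "ch_cod g = y" using g by auto
    have g0: "ch_map g n \<cdot> ch_map h n = Zero C (ch_ob (ch_dom h) n) (ch_ob y n)" for n
      using g(2) by (simp add: fun_eq_iff)
    have "\<exists>u. u \<in> Arr C \<and> Dom C u = Cod C (c n) \<and> Cod C u = ch_ob y n \<and> u \<cdot> c n = ch_map g n" for n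
      using cokernel_desc[OF c, of "ch_map g n" n] g0[of n] gc h by auto
    then obtain u where u: "\<And>n. u n \<in> Arr C" "\<And>n. Dom C (u n) = Cod C (c n)"
      "\<And>n. Cod C (u n) = ch_ob y n" "\<And>n. u n \<cdot> c n = ch_map g n"
      by metis
    define U where "U = \<lparr>ch_dom = Q, ch_cod = y, ch_map = u\<rparr>"
    have yc: "is_cpx C y" using gc by auto
    have U: "is_chmap C U"
    proof (rule is_chmapI)
      fix n
      have "(ch_d y n \<cdot> u (Suc n)) \<cdot> c (Suc n) = ch_map g n \<cdot> ?d n"
        using u yc chmap_square[OF gc(1), of n] gc by simp
      also have "\<dots> = u n \<cdot> (c n \<cdot> ?d n)"
        using comp_extend'[OF u(4)[of n], of "?d n"] u h by simp
      also have "\<dots> = (u n \<cdot> e n) \<cdot> c (Suc n)"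
        using u e by simp
      finally have "ch_d y n \<cdot> u (Suc n) = u n \<cdot> e n"
        by (rule epic_cancel[OF cokernel_epic[OF c]]) (use u e yc h in auto)
      then show "ch_d (ch_cod U) n \<cdot> ch_map U (Suc n) = ch_map U n \<cdot> ch_d (ch_dom U) n"
        by (simp add: U_def Q_def)
    qed (use u yc cpx in \<open>auto simp: U_def Q_def\<close>)
    show "\<exists>!u. u \<in> Hom (cpx_cat C) (Cod (cpx_cat C) q) y \<and> u \<cdot>\<^bsub>cpx_cat C\<^esub> q = g"
    proof (rule ex1I[of _ U])
      show "U \<in> Hom (cpx_cat C) (Cod (cpx_cat C) q) y \<and> U \<cdot>\<^bsub>cpx_cat C\<^esub> q = g"
        using U u gc by (simp add: U_def q_def)
      fix W assume W: "W \<in> Hom (cpx_cat C) (Cod (cpx_cat C) q) y \<and> W \<cdot>\<^bsub>cpx_cat C\<^esub> q = g"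
      then have Wc: "is_chmap C W" "ch_dom W = Q" "ch_cod W = y" by (auto simp: q_def)
      have "ch_map W n = u n" for n
      proof (rule epic_cancel[OF cokernel_epic[OF c[of n]]])
        show "ch_map W n \<cdot> c n = u n \<cdot> c n"
          using arg_cong[OF conjunct2[OF W], of "\<lambda>h. ch_map h n"] u by (simp add: q_def)
      qed (use Wc u in \<open>auto simp: Q_def\<close>)
      then show "W = U" using Wc by (simp add: U_def fun_eq_iff)
    qed
  qed
  then show thesis using that[of q] c by (simp add: q_def)
qed

lemma chmap_comp:
  assumes "is_chmap C g" "is_chmap C h" "ch_cod g = ch_dom h"
  shows "is_chmap C (h \<cdot>\<^bsub>cpx_cat C\<^esub> g)"
proof (rule is_chmapI)
  fix n
  have "ch_d (ch_cod h) n \<cdot> (ch_map h (Suc n) \<cdot> ch_map g (Suc n))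
      = ch_map h n \<cdot> (ch_d (ch_dom h) n \<cdot> ch_map g (Suc n))"
    by (rule chmap_natural) (use assms in auto)
  also have "\<dots> = (ch_map h n \<cdot> ch_map g n) \<cdot> ch_d (ch_dom g) n"
    using chmap_square[OF assms(1), of n] assms by simp
  finally show "ch_d (ch_cod (h \<cdot>\<^bsub>cpx_cat C\<^esub> g)) n \<cdot> ch_map (h \<cdot>\<^bsub>cpx_cat C\<^esub> g) (Suc n) =
    ch_map (h \<cdot>\<^bsub>cpx_cat C\<^esub> g) n \<cdot> ch_d (ch_dom (h \<cdot>\<^bsub>cpx_cat C\<^esub> g)) n"
    by simp
qed (use assms in auto)

text \<open>A cokernel of complexes is isomorphic to the one formed degreewise, by the comparison maps
  \<open>u\<close> and \<open>v\<close>. That \<open>v\<close> is a section of \<open>u\<close> transports epimorphy, and \<open>v \<cdot> r = c\<close> transports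
  exactness.\<close>

lemma chmap_cokernel_degreewise:
  assumes r: "is_cokernel (cpx_cat C) h r"
  shows "is_chmap C h" "is_chmap C r" "ch_dom r = ch_cod h"
    "epic C (ch_map r n)" "exact C (ch_map h n) (ch_map r n)"
proof -
  show h: "is_chmap C h" and rc: "is_chmap C r" and rh: "ch_dom r = ch_cod h"
    using r by (auto simp: is_cokernel_def)
  have r0: "r \<cdot>\<^bsub>cpx_cat C\<^esub> h = Zero (cpx_cat C) (ch_dom h) (ch_cod r)"
    using r by (auto simp: is_cokernel_def)
  have run: "\<exists>!u. u \<in> Hom (cpx_cat C) (ch_cod r) y \<and> u \<cdot>\<^bsub>cpx_cat C\<^esub> r = g"
    if "g \<in> Hom (cpx_cat C) (ch_cod h) y" "g \<cdot>\<^bsub>cpx_cat C\<^esub> h = Zero (cpx_cat C) (ch_dom h) y" for g y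
    using r that unfolding is_cokernel_def
    by (elim conjE allE[of _ y] ballE[of _ _ g]) (simp_all del: Hom_iff add: cpx_cat_simps(3,4))
  obtain c where c: "is_cokernel (cpx_cat C) h c" "\<And>n. is_cokernel C (ch_map h n) (ch_map c n)"
    using chmap_cokernel_exists[OF h] by blast
  have cc: "is_chmap C c" "ch_dom c = ch_cod h" and c0: "c \<cdot>\<^bsub>cpx_cat C\<^esub> h = Zero (cpx_cat C) (ch_dom h) (ch_cod c)"
    using c(1) by (auto simp: is_cokernel_def)
  have "\<exists>!u. u \<in> Hom (cpx_cat C) (ch_cod c) (ch_cod r) \<and> u \<cdot>\<^bsub>cpx_cat C\<^esub> c = r"
    using c(1) rc rh r0 unfolding is_cokernel_def
    by (elim conjE allE[of _ "ch_cod r"] ballE[of _ _ r]) simp_all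
  then obtain u where u: "u \<in> Hom (cpx_cat C) (ch_cod c) (ch_cod r)" "u \<cdot>\<^bsub>cpx_cat C\<^esub> c = r" by blast
  obtain v where v: "v \<in> Hom (cpx_cat C) (ch_cod r) (ch_cod c)" "v \<cdot>\<^bsub>cpx_cat C\<^esub> r = c"
    using run[of c "ch_cod c"] c0 cc by auto
  have uc: "is_chmap C u" "ch_dom u = ch_cod c" "ch_cod u = ch_cod r" using u by auto
  have vc: "is_chmap C v" "ch_dom v = ch_cod r" "ch_cod v = ch_cod c" using v by auto
  have un: "ch_map u n \<cdot> ch_map c n = ch_map r n" for n using arg_cong[OF u(2), of "\<lambda>h. ch_map h n"] by simp
  have vn: "ch_map v n \<cdot> ch_map r n = ch_map c n" for n using arg_cong[OF v(2), of "\<lambda>h. ch_map h n"] by simp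
  let ?id = "\<lparr>ch_dom = ch_cod r, ch_cod = ch_cod r, ch_map = (\<lambda>n. Ident C (ch_ob (ch_cod r) n))\<rparr>"
  have id: "is_chmap C ?id" by (rule is_chmapI) (use rc in auto)
  have uv: "u \<cdot>\<^bsub>cpx_cat C\<^esub> v = ?id"
  proof -
    have "u \<cdot>\<^bsub>cpx_cat C\<^esub> v \<in> Hom (cpx_cat C) (ch_cod r) (ch_cod r)"
      using chmap_comp[OF vc(1) uc(1)] uc vc by simp
    moreover have "(u \<cdot>\<^bsub>cpx_cat C\<^esub> v) \<cdot>\<^bsub>cpx_cat C\<^esub> r = r"
      using uc vc rc cc un vn by (simp add: fun_eq_iff)
    moreover have "?id \<in> Hom (cpx_cat C) (ch_cod r) (ch_cod r)" using id by simp
    moreover have "?id \<cdot>\<^bsub>cpx_cat C\<^esub> r = r" using rc by (simp add: fun_eq_iff)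
    ultimately show ?thesis using run[of r "ch_cod r"] rc rh r0 by (metis Hom_iff cpx_cat_simps(2,3,4) mem_Collect_eq)
  qed
  have uvn: "ch_map u n \<cdot> ch_map v n = Ident C (ch_ob (ch_cod r) n)"
    using arg_cong[OF uv, of "\<lambda>h. ch_map h n"] by simp
  show "epic C (ch_map r n)"
  proof (rule epicI)
    fix s assume s: "s \<in> Arr C" "Dom C s = Cod C (ch_map r n)"
      "s \<cdot> ch_map r n = Zero C (Dom C (ch_map r n)) (Cod C s)"
    have "(s \<cdot> ch_map u n) \<cdot> ch_map c n = Zero C (ch_ob (ch_cod h) n) (Cod C s)"
      using s un[of n] uc cc rc rh by simp
    then have "s \<cdot> ch_map u n = Zero C (ch_ob (ch_cod c) n) (Cod C s)"
      using epic_zero[OF cokernel_epic[OF c(2)[of n]], of "s \<cdot> ch_map u n"] s uc cc rc by simp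
    then have "(s \<cdot> ch_map u n) \<cdot> ch_map v n = Zero C (ch_ob (ch_cod r) n) (Cod C s)"
      using s vc cc rc by simp
    then show "s = Zero C (Cod C (ch_map r n)) (Cod C s)"
      using s uc vc rc uvn by simp
  qed (simp add: rc)
  show "exact C (ch_map h n) (ch_map r n)"
  proof (rule exactI)
    show "ch_map r n \<cdot> ch_map h n = Zero C (Dom C (ch_map h n)) (Cod C (ch_map r n))"
      using arg_cong[OF r0, of "\<lambda>h. ch_map h n"] h rc by simp
    fix x assume x: "x \<in> Arr C" "Cod C x = Dom C (ch_map r n)"
      "ch_map r n \<cdot> x = Zero C (Dom C x) (Cod C (ch_map r n))"
    have "ch_map c n \<cdot> x = Zero C (Dom C x) (Cod C (ch_map c n))"
      using comp_extend'[OF vn[of n], of x] x vc rc cc by simp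
    then show "\<exists>p y. epic C p \<and> Cod C p = Dom C x \<and> y \<in> Hom C (Dom C p) (Dom C (ch_map h n)) \<and>
        ch_map h n \<cdot> y = x \<cdot> p"
      using exact_lift[OF exact_cokernel[OF c(2)], of x n] x cc rc rh by simp metis
  qed (use h rc rh in auto)
qed

end

section \<open>Extension along a pair of vertical arrows\<close>

lemma functor_Hom:
  assumes "is_functor A B F" "f \<in> Arr A"
  shows "amap F f \<in> Arr B" "Dom B (amap F f) = omap F (Dom A f)" "Cod B (amap F f) = omap F (Cod A f)"
  using assms unfolding is_functor_def by auto

context abelian_framed_bicategory
begin

lemma frame_arr [simp]:
  assumes "\<alpha> \<in> Arr (Horiz D)"
  shows "amap (Lf D) \<alpha> \<in> Arr (Vert D)" "amap (Rt D) \<alpha> \<in> Arr (Vert D)"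
    "Dom (Vert D) (amap (Lf D) \<alpha>) = omap (Lf D) (Dom (Horiz D) \<alpha>)"
    "Cod (Vert D) (amap (Lf D) \<alpha>) = omap (Lf D) (Cod (Horiz D) \<alpha>)"
    "Dom (Vert D) (amap (Rt D) \<alpha>) = omap (Rt D) (Dom (Horiz D) \<alpha>)"
    "Cod (Vert D) (amap (Rt D) \<alpha>) = omap (Rt D) (Cod (Horiz D) \<alpha>)"
  using functor_Hom[OF lf_functor assms] functor_Hom[OF rt_functor assms] by auto

lemma frame_comp [simp]:
  assumes "\<alpha> \<in> Arr (Horiz D)" "\<beta> \<in> Arr (Horiz D)" "Cod (Horiz D) \<alpha> = Dom (Horiz D) \<beta>"
  shows "amap (Lf D) (\<beta> \<cdot>\<^bsub>Horiz D\<^esub> \<alpha>) = amap (Lf D) \<beta> \<cdot>\<^bsub>Vert D\<^esub> amap (Lf D) \<alpha>"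
    "amap (Rt D) (\<beta> \<cdot>\<^bsub>Horiz D\<^esub> \<alpha>) = amap (Rt D) \<beta> \<cdot>\<^bsub>Vert D\<^esub> amap (Rt D) \<alpha>"
  using lf_functor rt_functor assms unfolding is_functor_def by auto

sublocale H: category "Horiz D" by (rule horiz_cat)
sublocale V: category "Vert D" by (rule vert_cat)

lemma loc_simps [simp]:
  "Obj (loc D A B) = {M \<in> Obj (Horiz D). omap (Lf D) M = A \<and> omap (Rt D) M = B}"
  "Arr (loc D A B) = {\<alpha> \<in> Arr (Horiz D). amap (Lf D) \<alpha> = Ident (Vert D) A \<and>
                               amap (Rt D) \<alpha> = Ident (Vert D) B}"
  "Dom (loc D A B) = Dom (Horiz D)" "Cod (loc D A B) = Cod (Horiz D)"
  "Comp (loc D A B) = Comp (Horiz D)"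
  by (simp_all add: loc_def)

lemma dcpx_local:
  assumes "is_dcpx D c"
  shows "cpx_left D c \<in> Obj (Vert D)" "cpx_right D c \<in> Obj (Vert D)"
    "is_cpx (loc D (cpx_left D c) (cpx_right D c)) c"
proof -
  obtain A B where AB: "A \<in> Obj (Vert D)" "B \<in> Obj (Vert D)" "is_cpx (loc D A B) c"
    using assms by (auto simp: is_dcpx_def)
  then have "ch_ob c 0 \<in> Obj (loc D A B)" by (simp only: is_cpx_def)
  then have "cpx_left D c = A" "cpx_right D c = B" by (auto simp: cpx_left_def cpx_right_def)
  then show "cpx_left D c \<in> Obj (Vert D)" "cpx_right D c \<in> Obj (Vert D)"
    "is_cpx (loc D (cpx_left D c) (cpx_right D c)) c" using AB by auto
qed

text \<open>Factorizations over the pair of identities are exactly the globular cells, i.e. the arrows of the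
  local category.\<close>

lemma extension_universal:
  assumes K: "extension_choice D K"
    and fg: "f \<in> Arr (Vert D)" "g \<in> Arr (Vert D)"
    and \<alpha>: "\<alpha> \<in> Arr (Horiz D)" "amap (Lf D) \<alpha> = f" "amap (Rt D) \<alpha> = g"
  defines "k \<equiv> K f g (Dom (Horiz D) \<alpha>)"
  shows "k \<in> Arr (Horiz D)" "Dom (Horiz D) k = Dom (Horiz D) \<alpha>"
    "amap (Lf D) k = f" "amap (Rt D) k = g"
    "\<exists>!\<chi>. \<chi> \<in> Hom (loc D (Cod (Vert D) f) (Cod (Vert D) g)) (Cod (Horiz D) k) (Cod (Horiz D) \<alpha>) \<and>
       \<chi> \<cdot>\<^bsub>Horiz D\<^esub> k = \<alpha>"
proof -
  let ?P = "pair_fctr (Lf D) (Rt D)" and ?VV = "prod_cat (Vert D) (Vert D)"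
  have "omap (Lf D) (Dom (Horiz D) \<alpha>) = Dom (Vert D) f" "omap (Rt D) (Dom (Horiz D) \<alpha>) = Dom (Vert D) g"
    using frame_arr[OF \<alpha>(1)] \<alpha>(2,3) by auto
  then have k: "cocartesian (Horiz D) ?VV ?P k" "Dom (Horiz D) k = Dom (Horiz D) \<alpha>"
    "amap (Lf D) k = f" "amap (Rt D) k = g"
    using K fg \<alpha>(1) unfolding extension_choice_def k_def by auto
  then show ka: "k \<in> Arr (Horiz D)" "Dom (Horiz D) k = Dom (Horiz D) \<alpha>"
    "amap (Lf D) k = f" "amap (Rt D) k = g"
    by (auto simp: cocartesian_def)
  let ?u = "(Ident (Vert D) (Cod (Vert D) f), Ident (Vert D) (Cod (Vert D) g))"
  let ?y = "Cod (Horiz D) \<alpha>"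
  have ends: "omap (Lf D) (Cod (Horiz D) k) = Cod (Vert D) f" "omap (Rt D) (Cod (Horiz D) k) = Cod (Vert D) g"
    "omap (Lf D) ?y = Cod (Vert D) f" "omap (Rt D) ?y = Cod (Vert D) g"
    using frame_arr[OF ka(1)] frame_arr[OF \<alpha>(1)] ka \<alpha> by auto
  have u: "?u \<in> Hom ?VV (omap ?P (Cod (Horiz D) k)) (omap ?P ?y)"
    using ends fg by (simp add: prod_cat_def pair_fctr_def)
  have eq: "amap ?P \<alpha> = ?u \<cdot>\<^bsub>?VV\<^esub> amap ?P k"
    using fg \<alpha> ka by (simp add: prod_cat_def pair_fctr_def)
  have "\<exists>!\<chi>. \<chi> \<in> Hom (Horiz D) (Cod (Horiz D) k) ?y \<and> amap ?P \<chi> = ?u \<and> \<chi> \<cdot>\<^bsub>Horiz D\<^esub> k = \<alpha>"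
    using k(1) \<alpha>(1) ka(2) u eq unfolding cocartesian_def
    by (elim conjE ballE[of _ _ ?y] ballE[of _ _ \<alpha>] ballE[of _ _ ?u]) auto
  then show "\<exists>!\<chi>. \<chi> \<in> Hom (loc D (Cod (Vert D) f) (Cod (Vert D) g)) (Cod (Horiz D) k) ?y \<and>
       \<chi> \<cdot>\<^bsub>Horiz D\<^esub> k = \<alpha>"
    by (simp add: pair_fctr_def conj_ac)
qed

text \<open>\<open>extension\<close> is defined on arrows by a definite description; it satisfies its defining
  equation by the universal property applied to the composite of \<open>\<alpha>\<close> with the cocartesian cell
  of its codomain.\<close>

lemma extension_square:
  assumes K: "extension_choice D K"
    and fg: "f \<in> Arr (Vert D)" "g \<in> Arr (Vert D)"
    and \<alpha>: "\<alpha> \<in> Arr (loc D (Dom (Vert D) f) (Dom (Vert D) g))"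
  shows "amap (extension D K f g) \<alpha> \<cdot>\<^bsub>Horiz D\<^esub> K f g (Dom (Horiz D) \<alpha>) = K f g (Cod (Horiz D) \<alpha>) \<cdot>\<^bsub>Horiz D\<^esub> \<alpha>"
proof -
  let ?N = "Cod (Horiz D) \<alpha>"
  have a: "\<alpha> \<in> Arr (Horiz D)" "amap (Lf D) \<alpha> = Ident (Vert D) (Dom (Vert D) f)"
    "amap (Rt D) \<alpha> = Ident (Vert D) (Dom (Vert D) g)" using \<alpha> by auto
  have "omap (Lf D) ?N = Dom (Vert D) f" "omap (Rt D) ?N = Dom (Vert D) g"
    using frame_arr(4,6)[OF a(1)] fg unfolding a(2,3) by simp_all
  then have k: "K f g ?N \<in> Arr (Horiz D)" "Dom (Horiz D) (K f g ?N) = ?N"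
    "amap (Lf D) (K f g ?N) = f" "amap (Rt D) (K f g ?N) = g"
    using K fg a(1) unfolding extension_choice_def cocartesian_def by auto
  let ?\<beta> = "K f g ?N \<cdot>\<^bsub>Horiz D\<^esub> \<alpha>"
  have b: "?\<beta> \<in> Arr (Horiz D)" "amap (Lf D) ?\<beta> = f" "amap (Rt D) ?\<beta> = g"
    "Dom (Horiz D) ?\<beta> = Dom (Horiz D) \<alpha>" "Cod (Horiz D) ?\<beta> = Cod (Horiz D) (K f g ?N)"
    using a k fg by auto
  show ?thesis
    using theI'[OF extension_universal(5)[OF K fg b(1-3)]] unfolding b(4,5)
    by (simp add: extension_def)
qed

end

section \<open>The long exact sequence of a relative pair\<close>

locale framed_relative_pair = D: abelian_framed_bicategory \<AA>
  for \<AA> :: "('o, 'v, 'm, 'c, 'z) abdblcat_scheme" +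
  fixes K :: "'v \<Rightarrow> 'v \<Rightarrow> 'm \<Rightarrow> 'c"
    and \<C> :: "('x, 'f, 'w) cat_scheme"
    and M :: "('x, 'f, ('m, 'c) cpx, ('m, 'c, 'v) dchmap) fctr"
    and X Y :: 'x
    and f :: 'f
  assumes K: "extension_choice \<AA> K"
    and cat: "category \<C>"
    and M: "is_functor \<C> (Ch \<AA>) M"
    and f: "f \<in> Hom \<C> Y X"
    and pair: "relative_pair \<AA> K \<C> M f"
begin

abbreviation "AX \<equiv> loc_at \<AA> M X"
abbreviation "AY \<equiv> loc_at \<AA> M Y"
abbreviation "F \<equiv> ext_along \<AA> K M f"

lemma f': "f \<in> Arr \<C>" "Dom \<C> f = Y" "Cod \<C> f = X"
  using f by auto

lemma M_complexes: "is_dcpx \<AA> (omap M X)" "is_dcpx \<AA> (omap M Y)"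
proof -
  have "X \<in> Obj \<C>" "Y \<in> Obj \<C>"
    using category.dom_obj[OF cat, of f] category.cod_obj[OF cat, of f] f by auto
  then show "is_dcpx \<AA> (omap M X)" "is_dcpx \<AA> (omap M Y)"
    using M unfolding is_functor_def by (auto simp: Ch_def)
qed

lemma local_complexes: "is_cpx AX (omap M X)" "is_cpx AY (omap M Y)"
  using D.dcpx_local(3)[OF M_complexes(1)] D.dcpx_local(3)[OF M_complexes(2)]
  by (simp_all add: loc_at_def)

lemma local_abelian: "abelian_category AX" "abelian_category AY"
  using D.loc_abelian D.dcpx_local[OF M_complexes(1)] D.dcpx_local[OF M_complexes(2)]
  by (simp_all add: loc_at_def)

interpretation E: exact_functor_between AY AX F
  using local_abelian pair f'
  by (simp add: exact_functor_between_def exact_functor_between_axioms_def relative_pair_def)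

abbreviation "l \<equiv> ch_left (amap M f)"
abbreviation "r \<equiv> ch_right (amap M f)"
abbreviation "MY \<equiv> ch_ob (omap M Y)"
abbreviation "MX \<equiv> ch_ob (omap M X)"

lemma Mf:
  "l \<in> Arr (Vert \<AA>)" "Dom (Vert \<AA>) l = cpx_left \<AA> (omap M Y)" "Cod (Vert \<AA>) l = cpx_left \<AA> (omap M X)"
  "r \<in> Arr (Vert \<AA>)" "Dom (Vert \<AA>) r = cpx_right \<AA> (omap M Y)" "Cod (Vert \<AA>) r = cpx_right \<AA> (omap M X)"
  "ch_map (amap M f) n \<in> Arr (Horiz \<AA>)" "Dom (Horiz \<AA>) (ch_map (amap M f) n) = MY n"
  "Cod (Horiz \<AA>) (ch_map (amap M f) n) = MX n"
  "amap (Lf \<AA>) (ch_map (amap M f) n) = l" "amap (Rt \<AA>) (ch_map (amap M f) n) = r"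
  "ch_d (omap M X) n \<cdot>\<^bsub>Horiz \<AA>\<^esub> ch_map (amap M f) (Suc n) =
   ch_map (amap M f) n \<cdot>\<^bsub>Horiz \<AA>\<^esub> ch_d (omap M Y) n"
proof -
  have "amap M f \<in> Hom (Ch \<AA>) (omap M Y) (omap M X)"
    using M f unfolding is_functor_def by blast
  then have "is_dchmap \<AA> (amap M f)" and ends: "ch_dom (amap M f) = omap M Y" "ch_cod (amap M f) = omap M X"
    by (auto simp: Ch_def)
  then have *: "l \<in> Hom (Vert \<AA>) (cpx_left \<AA> (omap M Y)) (cpx_left \<AA> (omap M X))"
    "r \<in> Hom (Vert \<AA>) (cpx_right \<AA> (omap M Y)) (cpx_right \<AA> (omap M X))"
    "\<And>n. ch_map (amap M f) n \<in> Hom (Horiz \<AA>) (MY n) (MX n) \<and>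
      amap (Lf \<AA>) (ch_map (amap M f) n) = l \<and> amap (Rt \<AA>) (ch_map (amap M f) n) = r"
    "\<And>n. ch_d (omap M X) n \<cdot>\<^bsub>Horiz \<AA>\<^esub> ch_map (amap M f) (Suc n) =
          ch_map (amap M f) n \<cdot>\<^bsub>Horiz \<AA>\<^esub> ch_d (omap M Y) n"
    by (simp_all only: is_dchmap_def ends)
  show
    "l \<in> Arr (Vert \<AA>)" "Dom (Vert \<AA>) l = cpx_left \<AA> (omap M Y)" "Cod (Vert \<AA>) l = cpx_left \<AA> (omap M X)"
    "r \<in> Arr (Vert \<AA>)" "Dom (Vert \<AA>) r = cpx_right \<AA> (omap M Y)" "Cod (Vert \<AA>) r = cpx_right \<AA> (omap M X)"
    "ch_map (amap M f) n \<in> Arr (Horiz \<AA>)" "Dom (Horiz \<AA>) (ch_map (amap M f) n) = MY n"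
    "Cod (Horiz \<AA>) (ch_map (amap M f) n) = MX n"
    "amap (Lf \<AA>) (ch_map (amap M f) n) = l" "amap (Rt \<AA>) (ch_map (amap M f) n) = r"
    "ch_d (omap M X) n \<cdot>\<^bsub>Horiz \<AA>\<^esub> ch_map (amap M f) (Suc n) =
     ch_map (amap M f) n \<cdot>\<^bsub>Horiz \<AA>\<^esub> ch_d (omap M Y) n"
    using *(1,2) *(3,4)[of n] unfolding Hom_iff by blast+
qed

abbreviation "k n \<equiv> K l r (MY n)"

lemma k_arr: "k n \<in> Arr (Horiz \<AA>)" "Dom (Horiz \<AA>) (k n) = MY n" "amap (Lf \<AA>) (k n) = l" "amap (Rt \<AA>) (k n) = r"
  using D.extension_universal(1-4)[OF K Mf(1,4,7,10,11), of n] by (simp_all add: Mf)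

lemma AX_Hom: "Hom AX = Hom (loc \<AA> (Cod (Vert \<AA>) l) (Cod (Vert \<AA>) r))"
  by (simp only: loc_at_def Mf)

lemma k_universal:
  assumes "\<alpha> \<in> Arr (Horiz \<AA>)" "Dom (Horiz \<AA>) \<alpha> = MY n" "amap (Lf \<AA>) \<alpha> = l" "amap (Rt \<AA>) \<alpha> = r"
  shows "\<exists>!\<chi>. \<chi> \<in> Hom AX (Cod (Horiz \<AA>) (k n)) (Cod (Horiz \<AA>) \<alpha>) \<and> \<chi> \<cdot>\<^bsub>Horiz \<AA>\<^esub> k n = \<alpha>"
  using D.extension_universal(5)[OF K Mf(1,4) assms(1,3,4)] assms(2) unfolding AX_Hom by simp

lemma AX_simps:
  "Arr AX \<subseteq> Arr (Horiz \<AA>)" "Dom AX = Dom (Horiz \<AA>)" "Cod AX = Cod (Horiz \<AA>)" "Comp AX = Comp (Horiz \<AA>)"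
  by (auto simp: loc_at_def)

text \<open>The cocartesian cells are cancellable against globular cells; this yields the commutation
  with differentials, and the uniqueness, of the factorization of \<open>M(f)\<close>.\<close>

lemma k_epic:
  assumes "\<phi> \<in> Hom AX (Cod (Horiz \<AA>) (k n)) y" "\<psi> \<in> Hom AX (Cod (Horiz \<AA>) (k n)) y"
    "\<phi> \<cdot>\<^bsub>Horiz \<AA>\<^esub> k n = \<psi> \<cdot>\<^bsub>Horiz \<AA>\<^esub> k n"
  shows "\<phi> = \<psi>"
proof -
  let ?\<alpha> = "\<phi> \<cdot>\<^bsub>Horiz \<AA>\<^esub> k n"
  have p: "\<phi> \<in> Arr (Horiz \<AA>)" "Dom (Horiz \<AA>) \<phi> = Cod (Horiz \<AA>) (k n)" "Cod (Horiz \<AA>) \<phi> = y"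
    "amap (Lf \<AA>) \<phi> = Ident (Vert \<AA>) (Cod (Vert \<AA>) l)" "amap (Rt \<AA>) \<phi> = Ident (Vert \<AA>) (Cod (Vert \<AA>) r)"
    using assms(1) by (auto simp: loc_at_def Mf)
  have "\<exists>!\<chi>. \<chi> \<in> Hom AX (Cod (Horiz \<AA>) (k n)) (Cod (Horiz \<AA>) ?\<alpha>) \<and> \<chi> \<cdot>\<^bsub>Horiz \<AA>\<^esub> k n = ?\<alpha>"
    by (rule k_universal) (use p k_arr[of n] Mf(1,4) in simp_all)
  moreover have "Cod (Horiz \<AA>) ?\<alpha> = y" using p k_arr[of n] by simp
  ultimately show ?thesis using assms by metis
qed

lemma F_ob: "omap F N = Cod (Horiz \<AA>) (K l r N)"
  by (simp add: ext_along_def extension_def)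

lemma F_square: "amap F (ch_d (omap M Y) n) \<cdot>\<^bsub>Horiz \<AA>\<^esub> k (Suc n) = k n \<cdot>\<^bsub>Horiz \<AA>\<^esub> ch_d (omap M Y) n"
proof -
  have d: "ch_d (omap M Y) n \<in> Hom AY (MY (Suc n)) (MY n)"
    using local_complexes(2) by (simp only: is_cpx_def)
  then have "ch_d (omap M Y) n \<in> Arr (loc \<AA> (Dom (Vert \<AA>) l) (Dom (Vert \<AA>) r))"
    by (simp only: Mf loc_at_def Hom_iff)
  from D.extension_square[OF K Mf(1,4) this] show ?thesis
    using d by (simp add: ext_along_def loc_at_def)
qed

text \<open>The factorizations of the components of \<open>M(f)\<close> commute with the differentials because both
  composites become \<open>M(f)\<^sub>n \<cdot> d\<close> after precomposition with the cocartesian cell.\<close>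

lemma rel_fact_properties:
  "is_chmap AX (rel_fact \<AA> K \<C> M f)"
  "ch_dom (rel_fact \<AA> K \<C> M f) = map_cpx F (omap M Y)"
  "ch_cod (rel_fact \<AA> K \<C> M f) = omap M X"
proof -
  let ?a = "ch_map (amap M f)"
  let ?h = "\<lambda>n. THE \<chi>. \<chi> \<in> Hom AX (Cod (Horiz \<AA>) (k n)) (MX n) \<and> \<chi> \<cdot>\<^bsub>Horiz \<AA>\<^esub> k n = ?a n"
  have h: "?h n \<in> Hom AX (Cod (Horiz \<AA>) (k n)) (MX n) \<and> ?h n \<cdot>\<^bsub>Horiz \<AA>\<^esub> k n = ?a n" for n
    using theI'[OF k_universal[OF Mf(7,8,10,11), of n]] unfolding Mf(9) .
  define h where "h = ?h"
  have hn: "h n \<in> Hom AX (Cod (Horiz \<AA>) (k n)) (MX n)" "h n \<cdot>\<^bsub>Horiz \<AA>\<^esub> k n = ?a n" for n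
    using h[of n] by (simp_all add: h_def)
  define H where "H = \<lparr>ch_dom = map_cpx F (omap M Y), ch_cod = omap M X, ch_map = h\<rparr>"
  have dX: "ch_d (omap M X) n \<in> Hom AX (MX (Suc n)) (MX n)" for n
    using local_complexes(1) by (simp only: is_cpx_def)
  have dY: "amap F (ch_d (omap M Y) n) \<in> Hom AX (Cod (Horiz \<AA>) (k (Suc n))) (Cod (Horiz \<AA>) (k n))"
    and dY': "ch_d (omap M Y) n \<in> Hom (Horiz \<AA>) (MY (Suc n)) (MY n)" for n
  proof -
    have "ch_d (omap M Y) n \<in> Hom AY (MY (Suc n)) (MY n)"
      using local_complexes(2) by (simp only: is_cpx_def)
    then show "ch_d (omap M Y) n \<in> Hom (Horiz \<AA>) (MY (Suc n)) (MY n)"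
      and "amap F (ch_d (omap M Y) n) \<in> Hom AX (Cod (Horiz \<AA>) (k (Suc n))) (Cod (Horiz \<AA>) (k n))"
      using E.F_arr[of "ch_d (omap M Y) n"] unfolding F_ob[symmetric] by (auto simp: AX_simps loc_at_def)
  qed
  have sq: "ch_d (omap M X) n \<cdot>\<^bsub>AX\<^esub> h (Suc n) = h n \<cdot>\<^bsub>AX\<^esub> amap F (ch_d (omap M Y) n)" for n
  proof (rule k_epic)
    show "ch_d (omap M X) n \<cdot>\<^bsub>AX\<^esub> h (Suc n) \<in> Hom AX (Cod (Horiz \<AA>) (k (Suc n))) (MX n)"
      by (rule E.D.comp_hom[OF hn(1) dX])
    show "h n \<cdot>\<^bsub>AX\<^esub> amap F (ch_d (omap M Y) n) \<in> Hom AX (Cod (Horiz \<AA>) (k (Suc n))) (MX n)"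
      by (rule E.D.comp_hom[OF dY hn(1)])
    have inH: "Hom AX x y \<subseteq> Hom (Horiz \<AA>) x y" for x y by (auto simp: loc_at_def)
    note hH = subsetD[OF inH hn(1)] and dXH = subsetD[OF inH dX] and dYH = subsetD[OF inH dY]
    have "(ch_d (omap M X) n \<cdot>\<^bsub>Horiz \<AA>\<^esub> h (Suc n)) \<cdot>\<^bsub>Horiz \<AA>\<^esub> k (Suc n)
        = ?a n \<cdot>\<^bsub>Horiz \<AA>\<^esub> ch_d (omap M Y) n"
      using hH[of "Suc n"] dXH[of n] k_arr[of "Suc n"] hn(2)[of "Suc n"] Mf(12)[of n] by simp
    also have "\<dots> = h n \<cdot>\<^bsub>Horiz \<AA>\<^esub> (k n \<cdot>\<^bsub>Horiz \<AA>\<^esub> ch_d (omap M Y) n)"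
      by (rule D.H.comp_extend'[OF hn(2), symmetric]) (use hH[of n] k_arr[of n] dY'[of n] in auto)
    also have "\<dots> = (h n \<cdot>\<^bsub>Horiz \<AA>\<^esub> amap F (ch_d (omap M Y) n)) \<cdot>\<^bsub>Horiz \<AA>\<^esub> k (Suc n)"
      unfolding F_square[symmetric] using hH[of n] dYH[of n] k_arr[of "Suc n"] by simp
    finally show "(ch_d (omap M X) n \<cdot>\<^bsub>AX\<^esub> h (Suc n)) \<cdot>\<^bsub>Horiz \<AA>\<^esub> k (Suc n) =
        (h n \<cdot>\<^bsub>AX\<^esub> amap F (ch_d (omap M Y) n)) \<cdot>\<^bsub>Horiz \<AA>\<^esub> k (Suc n)"
      by (simp only: AX_simps)
  qed
  have HC: "is_chmap AX H"
    unfolding is_chmap_def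
  proof (intro conjI allI)
    fix n
    show "ch_map H n \<in> Hom AX (ch_ob (ch_dom H) n) (ch_ob (ch_cod H) n)"
      using hn(1)[of n] by (simp add: H_def map_cpx_def F_ob)
    show "ch_d (ch_cod H) n \<cdot>\<^bsub>AX\<^esub> ch_map H (Suc n) = ch_map H n \<cdot>\<^bsub>AX\<^esub> ch_d (ch_dom H) n"
      using sq[of n] by (simp add: H_def map_cpx_def)
  qed (use local_complexes E.F_cpx[OF local_complexes(2)] in \<open>simp_all add: H_def\<close>)
  have "rel_fact \<AA> K \<C> M f = H"
    unfolding rel_fact_def f'
  proof (rule the_equality)
    show "H \<in> Hom (cpx_cat AX) (map_cpx F (omap M Y)) (omap M X) \<and>
      (\<forall>n. ch_map H n \<cdot>\<^bsub>Horiz \<AA>\<^esub> k n = ?a n)"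
      using HC hn(2) by (simp add: H_def)
    fix G assume G: "G \<in> Hom (cpx_cat AX) (map_cpx F (omap M Y)) (omap M X) \<and>
      (\<forall>n. ch_map G n \<cdot>\<^bsub>Horiz \<AA>\<^esub> k n = ?a n)"
    then have Gc: "is_chmap AX G" "ch_dom G = map_cpx F (omap M Y)" "ch_cod G = omap M X" by auto
    have "ch_map G n = h n" for n
    proof (rule k_epic)
      show "ch_map G n \<in> Hom AX (Cod (Horiz \<AA>) (k n)) (MX n)"
        using E.D.chmap_arr[OF Gc(1)] Gc(2,3) by (simp add: map_cpx_def F_ob)
    qed (use hn G in auto)
    then show "G = H" using Gc by (simp add: H_def fun_eq_iff)
  qed
  then show "is_chmap AX (rel_fact \<AA> K \<C> M f)"
    "ch_dom (rel_fact \<AA> K \<C> M f) = map_cpx F (omap M Y)"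
    "ch_cod (rel_fact \<AA> K \<C> M f) = omap M X"
    using HC by (simp_all add: H_def)
qed

lemma rel_proj_cokernel: "is_cokernel (cpx_cat AX) (rel_fact \<AA> K \<C> M f) (rel_proj \<AA> K \<C> M f)"
  unfolding rel_proj_def cokernel_def f'
  using E.D.chmap_cokernel_exists[OF rel_fact_properties(1)] by (metis someI_ex)

lemma short_exact_relative_pair:
  "short_exact_complexes AX (rel_fact \<AA> K \<C> M f) (rel_proj \<AA> K \<C> M f)
     (\<lambda>n. amap F (cycles AY (omap M Y) n)) (\<lambda>n. amap F (hproj AY (omap M Y) n))
     (cycles AX (omap M X)) (hproj AX (omap M X))
     (cycles AX (rel_cpx \<AA> K \<C> M f)) (hproj AX (rel_cpx \<AA> K \<C> M f))"
proof -
  note q = E.D.chmap_cokernel_degreewise[OF rel_proj_cokernel]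
  have "monic (cpx_cat AX) (rel_fact \<AA> K \<C> M f)"
    using pair f' by (simp add: relative_pair_def)
  note m = E.D.chmap_monic_degreewise[OF this]
  have c: "is_cpx AX (ch_cod (rel_proj \<AA> K \<C> M f))"
    using q(2) by (simp only: is_chmap_def)
  show ?thesis
    unfolding rel_cpx_def
    by unfold_locales
      (use q m rel_fact_properties E.F_presentation[OF local_complexes(2)]
        E.D.standard_presentation[OF local_complexes(1)] E.D.standard_presentation[OF c] in auto)
qed

lemma extended_homology:
  "omap F (abs_homology \<AA> M Y i) = Cod AX (amap F (hproj AY (omap M Y) i))"
  using E.C.cokernel_arr[OF E.C.is_cokernel_hproj[OF local_complexes(2), of i]]
  by (simp add: abs_homology_def homology_def)

end

theorem theorem5p6:
  fixes \<AA> :: "('o, 'v, 'm, 'c) abdblcat"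
    and K :: "'v \<Rightarrow> 'v \<Rightarrow> 'm \<Rightarrow> 'c"
    and \<C> :: "('x, 'f) cat"
    and M :: "('x, 'f, ('m, 'c) cpx, ('m, 'c, 'v) dchmap) fctr"
    and X Y :: 'x
    and f :: 'f
  assumes "abelian_framed_bicategory \<AA>"
    and "extension_choice \<AA> K"
    and "category \<C>"
    and "is_functor \<C> (Ch \<AA>) M"
    and "f \<in> Hom \<C> Y X"
    and "relative_pair \<AA> K \<C> M f"
  shows "let \<A> = loc_at \<AA> M X;
             H = abs_homology \<AA> M X;
             XH = (\<lambda>i. omap (ext_along \<AA> K M f) (abs_homology \<AA> M Y i));
             Hrel = rel_homology \<AA> K \<C> M f;
             a = ext_homology_map \<AA> K \<C> M f;
             b = homology_map \<A> (rel_proj \<AA> K \<C> M f)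
         in abelian_category \<A> \<and>
            (\<forall>i. a i \<in> Hom \<A> (XH i) (H i)) \<and>
            (\<forall>i. b i \<in> Hom \<A> (H i) (Hrel i)) \<and>
            (\<exists>\<delta>. (\<forall>i. \<delta> i \<in> Hom \<A> (Hrel (Suc i)) (XH i)) \<and>
                 (\<forall>i. exact \<A> (b (Suc i)) (\<delta> i)) \<and>
                 (\<forall>i. exact \<A> (\<delta> i) (a i)) \<and>
                 (\<forall>i. exact \<A> (a i) (b i)) \<and>
                 (\<forall>Z. is_zero_object \<A> Z \<longrightarrow> exact \<A> (b 0) (Zero \<A> (Hrel 0) Z)))"
proof -
  interpret framed_relative_pair \<AA> K \<C> M X Y f
    using assms by (simp add: framed_relative_pair_def framed_relative_pair_axioms_def)
  interpret S: short_exact_complexes AX "rel_fact \<AA> K \<C> M f" "rel_proj \<AA> K \<C> M f"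
    "\<lambda>n. amap F (cycles AY (omap M Y) n)" "\<lambda>n. amap F (hproj AY (omap M Y) n)"
    "cycles AX (omap M X)" "hproj AX (omap M X)"
    "cycles AX (rel_cpx \<AA> K \<C> M f)" "hproj AX (rel_cpx \<AA> K \<C> M f)"
    by (rule short_exact_relative_pair)
  have dom: "ch_dom (rel_proj \<AA> K \<C> M f) = omap M X"
    using S.middle rel_fact_properties by simp
  have a: "ext_homology_map \<AA> K \<C> M f i = S.Hi i" for i
    by (simp add: ext_homology_map_def f')
  have b: "homology_map AX (rel_proj \<AA> K \<C> M f) i = S.Hj i" for i
    by (simp add: homology_map_def dom rel_cpx_def)
  have H: "abs_homology \<AA> M X i = Cod AX (hproj AX (omap M X) i)"
    "rel_homology \<AA> K \<C> M f i = Cod AX (hproj AX (rel_cpx \<AA> K \<C> M f) i)" for i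
    by (simp_all add: abs_homology_def homology_def rel_homology_def f')
  show ?thesis
    unfolding Let_def a b H extended_homology
    using local_abelian S.exact_Hi_Hj S.exact_Hj_connecting S.exact_connecting_Hi S.exact_Hj_zero
    by (intro conjI allI impI exI[of _ S.connecting]) auto
qed

end
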